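(* If $y\in\mathcal{I}_\mathbb{Z}$ is I-Grassmannian, then $\hat F_y=P_{\mu(y)}$.
   Context: $S_\mathbb{Z}$ is the group of finitely supported permutations of $\mathbb{Z}$, $s_i=(i,i+1)$, $\mathcal R(w)$ the set of reduced words of $w$. For a reduced word $(s_{a_1},\dots,s_{a_\ell})$, $f_{\mathbf a}=\sum x_{i_1}\cdots x_{i_\ell}$ over positive integers $i_1\le\dots\le i_\ell$ with $i_j<i_{j+1}$ whenever $a_j<a_{j+1}$, and $F_w=\sum_{\mathbf a\in\mathcal R(w)}f_{\mathbf a}$. The Demazure product $\circ$ is the associative product on $S_\mathbb{Z}$ with $u\circ v=uv$ if lengths add and $s_i\circ s_i=s_i$. $\mathcal I_\mathbb{Z}$ is the set of involutions in $S_\mathbb{Z}$; $\mathcal A(y)$ is the set of minimal-length $w$ with $w^{-1}\circ w=y$, and $\hat F_y=\sum_{w\in\mathcal A(y)}F_w$. An integer $i$ is a visible descent of $y$ if $y(i+1)\le\min\{i,y(i)\}$; $y$ is I-Grassmannian if it has at most one visible descent. Every I-Grassmannian $y\neq1$ can be written as $y=(\phi_1,n+1)(\phi_2,n+2)\cdots(\phi_r,n+r)$ with integers $r\ge1$, $\phi_1<\dots<\phi_r\le n$; its shape is the strict partition $\mu(y)=(n+1-\phi_1,\dots,n+1-\phi_r)$, and $\mu(1)=\emptyset$. $P_\mu$ denotes the Schur $P$-function of the strict partition $\mu$ (generating function $\sum_T x^T$ of semistandard marked shifted tableaux of shifted shape $\mu$, with no primes on the diagonal), and $P_\emptyset=1$.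 *)

theory Defs
  imports Main "HOL-Combinatorics.Perm" "HOL-Library.Multiset" "HOL-Library.FuncSet"
begin

unbundle permutation_syntax

section \<open>Power series in \<open>x\<^sub>1, x\<^sub>2, \<dots>\<close>\<close>

text \<open>
  A formal power series with integer coefficients is given by its coefficients, the monomial
  \<open>x\<^sub>i \<cdots> x\<^sub>k\<close> being the multiset \<open>{#i, \<dots>, k#}\<close>.  Every index below is positive, so that
  monomials involving \<open>0\<close> have coefficient 0.
\<close>

type_synonym power_series = "nat multiset \<Rightarrow> int"

text \<open>
  The series \<open>\<Sum>\<^sub>t x\<^bsup>wt t\<^esup>\<close>, \<open>t\<close> ranging over \<open>A\<close>.  It is meaningful if only finitely many members
  of \<open>A\<close> have a given weight, as is the case for sequences and for fillings of a fixed diagram.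
\<close>

definition gen_fun :: "'a set \<Rightarrow> ('a \<Rightarrow> nat multiset) \<Rightarrow> power_series" where
  "gen_fun A wt = (\<lambda>m. int (card {t \<in> A. wt t = m}))"


section \<open>Reduced words and Stanley symmetric functions\<close>

text \<open>The group \<open>S\<^sub>\<int>\<close> is the type \<^typ>\<open>int perm\<close> of finitely supported permutations.\<close>

definition simple_refl :: "int \<Rightarrow> int perm" where
  "simple_refl i = \<langle>i \<leftrightarrow> i + 1\<rangle>"

definition word_perm :: "int list \<Rightarrow> int perm" where
  "word_perm a = prod_list (map simple_refl a)"

text \<open>Minimal word length; the \<^const>\<open>simple_refl\<close>s generate the group.\<close>

definition len :: "int perm \<Rightarrow> nat" where
  "len w = (LEAST l. \<exists>a. word_perm a = w \<and> length a = l)"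

definition reduced_words :: "int perm \<Rightarrow> int list set" where
  "reduced_words w = {a. word_perm a = w \<and> length a = len w}"

definition compatible_seqs :: "int list \<Rightarrow> nat list set" where
  "compatible_seqs a =
     {s. length s = length a \<and> (\<forall>i \<in> set s. 1 \<le> i) \<and>
         (\<forall>j. Suc j < length a \<longrightarrow>
            s ! j \<le> s ! Suc j \<and> (a ! j < a ! Suc j \<longrightarrow> s ! j < s ! Suc j))}"

definition word_fun :: "int list \<Rightarrow> power_series" where
  "word_fun a = gen_fun (compatible_seqs a) mset"

text \<open>The set \<^term>\<open>reduced_words w\<close> is finite: its words only use letters \<open>i\<close> such that \<open>i\<close> and
  \<open>i + 1\<close> lie in the interval spanned by the support of \<open>w\<close>.\<close>

definition stanley :: "int perm \<Rightarrow> power_series" where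
  "stanley w = (\<lambda>m. \<Sum>a \<in> reduced_words w. word_fun a m)"


section \<open>Demazure product and involution Stanley symmetric functions\<close>

definition is_demazure_product :: "(int perm \<Rightarrow> int perm \<Rightarrow> int perm) \<Rightarrow> bool" where
  "is_demazure_product p \<longleftrightarrow>
     (\<forall>u v w. p (p u v) w = p u (p v w)) \<and>
     (\<forall>u v. len (u * v) = len u + len v \<longrightarrow> p u v = u * v) \<and>
     (\<forall>i. p (simple_refl i) (simple_refl i) = simple_refl i)"

text \<open>There is exactly one such product.\<close>

definition demazure :: "int perm \<Rightarrow> int perm \<Rightarrow> int perm"  (infixl \<open>\<circ>\<^sub>D\<close> 70) where
  "demazure = (THE p. is_demazure_product p)"

definition involutions :: "int perm set" where
  "involutions = {y. y * y = 1}"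

definition atoms :: "int perm \<Rightarrow> int perm set" where
  "atoms y = {w. inverse w \<circ>\<^sub>D w = y \<and> (\<forall>v. inverse v \<circ>\<^sub>D v = y \<longrightarrow> len w \<le> len v)}"

text \<open>The set \<^term>\<open>atoms y\<close> is finite, since the letters of a reduced word of an atom of \<open>y\<close>
  occur in the reduced words of \<open>y\<close>.\<close>

definition inv_stanley :: "int perm \<Rightarrow> power_series" where
  "inv_stanley y = (\<lambda>m. \<Sum>w \<in> atoms y. stanley w m)"


section \<open>I-Grassmannian involutions\<close>

definition visible_descent :: "int perm \<Rightarrow> int \<Rightarrow> bool" where
  "visible_descent y i \<longleftrightarrow> y \<langle>$\<rangle> (i + 1) \<le> min i (y \<langle>$\<rangle> i)"

definition I_Grassmannian :: "int perm \<Rightarrow> bool" where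
  "I_Grassmannian y \<longleftrightarrow> (\<forall>i j. visible_descent y i \<longrightarrow> visible_descent y j \<longrightarrow> i = j)"

text \<open>\<open>y = (\<phi>\<^sub>1, n+1) (\<phi>\<^sub>2, n+2) \<cdots> (\<phi>\<^sub>r, n+r)\<close> with \<open>r \<ge> 1\<close> and \<open>\<phi>\<^sub>1 < \<cdots> < \<phi>\<^sub>r \<le> n\<close>; the list
  \<open>\<phi>\<close> is indexed from 0.\<close>

definition Grassmannian_form :: "int perm \<Rightarrow> int \<Rightarrow> int list \<Rightarrow> bool" where
  "Grassmannian_form y n \<phi> \<longleftrightarrow>
     \<phi> \<noteq> [] \<and> sorted_wrt (<) \<phi> \<and> (\<forall>p \<in> set \<phi>. p \<le> n) \<and>
     y = prod_list (map (\<lambda>k. \<langle>\<phi> ! k \<leftrightarrow> n + int (Suc k)\<rangle>) [0..<length \<phi>])"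

text \<open>The cycles of \<open>y\<close> determine \<open>n\<close> and \<open>\<phi>\<close>.  Strict partitions are strictly decreasing lists of
  positive numbers.\<close>

definition shape :: "int perm \<Rightarrow> nat list" where
  "shape y =
     (if y = 1 then []
      else (THE \<mu>. \<exists>n \<phi>. Grassmannian_form y n \<phi> \<and> \<mu> = map (\<lambda>p. nat (n + 1 - p)) \<phi>))"


section \<open>Schur P-functions\<close>

text \<open>The marked alphabet \<open>1' < 1 < 2' < 2 < \<cdots>\<close>.\<close>

datatype marked = Primed nat | Unprimed nat

fun marked_le :: "marked \<Rightarrow> marked \<Rightarrow> bool" where
  "marked_le (Primed i) (Primed j) \<longleftrightarrow> i \<le> j"
| "marked_le (Primed i) (Unprimed j) \<longleftrightarrow> i \<le> j"
| "marked_le (Unprimed i) (Primed j) \<longleftrightarrow> i < j"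
| "marked_le (Unprimed i) (Unprimed j) \<longleftrightarrow> i \<le> j"

fun is_primed :: "marked \<Rightarrow> bool" where
  "is_primed (Primed _) \<longleftrightarrow> True"
| "is_primed (Unprimed _) \<longleftrightarrow> False"

fun unmark :: "marked \<Rightarrow> nat" where
  "unmark (Primed i) = i"
| "unmark (Unprimed i) = i"

text \<open>Boxes are (row, column), both counted from 0; row \<open>i\<close> starts on the diagonal.\<close>

definition shifted_diagram :: "nat list \<Rightarrow> (nat \<times> nat) set" where
  "shifted_diagram \<mu> = {(i, j). i < length \<mu> \<and> i \<le> j \<and> j < i + \<mu> ! i}"

text \<open>Rows and columns weakly increase, no primed entry is repeated in a row, no unprimed entry is
  repeated in a column, and the diagonal has no primed entry.\<close>

definition marked_shifted_tableaux :: "nat list \<Rightarrow> (nat \<times> nat \<Rightarrow> marked) set" where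
  "marked_shifted_tableaux \<mu> =
     {T \<in> shifted_diagram \<mu> \<rightarrow>\<^sub>E {e. 1 \<le> unmark e}.
        (\<forall>i j k. j < k \<longrightarrow> (i, j) \<in> shifted_diagram \<mu> \<longrightarrow> (i, k) \<in> shifted_diagram \<mu> \<longrightarrow>
           marked_le (T (i, j)) (T (i, k)) \<and> (T (i, j) = T (i, k) \<longrightarrow> \<not> is_primed (T (i, j)))) \<and>
        (\<forall>i j k. i < k \<longrightarrow> (i, j) \<in> shifted_diagram \<mu> \<longrightarrow> (k, j) \<in> shifted_diagram \<mu> \<longrightarrow>
           marked_le (T (i, j)) (T (k, j)) \<and> (T (i, j) = T (k, j) \<longrightarrow> is_primed (T (i, j)))) \<and>
        (\<forall>i. (i, i) \<in> shifted_diagram \<mu> \<longrightarrow> \<not> is_primed (T (i, i)))}"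

text \<open>The empty shape has exactly one tableau, of weight \<open>{#}\<close>, so that \<open>P\<^sub>\<emptyset> = 1\<close>.\<close>

definition schur_P :: "nat list \<Rightarrow> power_series" where
  "schur_P \<mu> =
     gen_fun (marked_shifted_tableaux \<mu>)
       (\<lambda>T. image_mset (\<lambda>b. unmark (T b)) (mset_set (shifted_diagram \<mu>)))"

end

theory Submission
  imports Defs
begin

text \<open>
  Both sides are matrix coefficients of products \<open>A(x\<^sub>1) A(x\<^sub>2) \<cdots>\<close> of commuting operators
  \<open>A(t) = \<Prod>\<^sub>i (1 + t u\<^sub>i)\<close>: for the involution words, \<open>u\<^sub>i\<close> removes the last letter \<open>i\<close>; for the tableaux,
  \<open>u\<^sub>c\<close> removes a corner box of content \<open>c\<close>, first the unprimed and then the primed copies of the largest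
  entry.  Commutation makes both series symmetric, and neither depends on \<open>t\<close> after
  substituting \<open>x\<^sub>1 = t, x\<^sub>2 = - t\<close>: on the tableau side since \<open>A(- t) A(t) = 1\<close>, on the other side since reversing the order of the factors of
  \<open>A(t)\<close> does not change its effect on the identity involution.  A nonzero series with these properties
  contains a monomial whose exponents form a strict partition.

  Let \<open>y\<close> be I-Grassmannian with \<open>r\<close> cycles, \<open>\<mu>\<close> its shape, and \<open>n\<close> its visible descent.  Removing letters
  smaller than \<open>n\<close> from \<open>y\<close> is the same as removing boxes off the diagonal from \<open>\<mu>\<close>.  By induction on \<open>|\<mu>|\<close>, the
  difference of the two series then comes from the letters \<open>\<ge> n\<close> of \<open>y\<close> and the boxes removed last from
  \<open>\<mu>\<close>, and there are at most \<open>r\<close> of either, so the difference has degree at most \<open>r\<close> in each variable.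
  As \<open>|\<mu>| \<ge> 1 + \<cdots> + r\<close>, the only strict exponent it can contain is \<open>(r, \<dots>, 1)\<close>, with \<open>\<mu> = (r, \<dots>, 1)\<close>, and
  there the two coefficients agree by induction.
\<close>

section \<open>Parametrised products of linear operators\<close>

text \<open>The operators are transposed: they act on functions of a state, and the outermost factor
  removes first. Applied to the indicator of the identity or of the empty shape and evaluated at the
  given state, a product of them yields the wanted coefficients. The parameters are integers;
  coefficients are compared because a polynomial vanishing at all nonzero integers is zero.

  That the difference of the series comes from the letters \<open>\<ge> n\<close> needs an
  inversion. The letters below \<open>n\<close> and the unprimed contents \<open>\<ge> 1\<close>
  give the same factor \<open>H(t)\<close>, whose inverse is its reversal at \<open>- t\<close>. By
  induction the difference vanishes on all smaller partitions, so this inverse acts on it at \<mu>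
  as the identity: the full difference equals that of the remaining factors. These have degree at
  most \<open>r\<close>, since \<open>y\<close> fixes all points beyond \<open>n + r\<close> and
  since removal by increasing content takes at most one box per row.

  For involution words cancellation holds only next to the identity, for tableaux everywhere;
  symmetry brings the pair of exponents to the right place. The induction covers all
  \<open>n\<close>, since clearing the diagonal of a staircase moves the visible descent to
  \<open>n - 1\<close>.\<close>

lemma int_poly_zero:
  fixes c :: "nat \<Rightarrow> int"
  assumes "\<And>t. t \<noteq> 0 \<Longrightarrow> (\<Sum>k\<le>n. t ^ k * c k) = 0" and "k \<le> n"
  shows "c k = 0"
  using assms
proof (induction n arbitrary: c k)
  case 0
  then show ?case using "0.prems"(1)[of 1] by simp
next
  case (Suc n)
  have split: "c 0 + t * (\<Sum>k\<le>n. t ^ k * c (Suc k)) = 0" if "t \<noteq> 0" for t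
    using Suc.prems(1)[OF that]
    by (simp only: sum.atMost_Suc_shift) (simp add: sum_distrib_left mult.assoc)
  have c0: "c 0 = 0"
  proof (rule ccontr)
    assume "c 0 \<noteq> 0"
    \<comment> \<open>Every nonzero \<open>t\<close> divides \<open>c 0\<close>; this one is too
      large to do so.\<close>
    let ?t = "\<bar>c 0\<bar> + 1"
    have "c 0 = ?t * - (\<Sum>k\<le>n. ?t ^ k * c (Suc k))"
      using split[of ?t] by linarith
    then have "?t dvd c 0" by (rule dvdI)
    then show False using dvd_imp_le_int[OF \<open>c 0 \<noteq> 0\<close>, of ?t] by linarith
  qed
  \<comment> \<open>Division by \<open>t\<close>; the quotient is again known to vanish only at
    nonzero arguments.\<close>
  then have "(\<Sum>k\<le>n. t ^ k * c (Suc k)) = 0" if "t \<noteq> 0" for t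
    using split[OF that] that by simp
  then have "c (Suc j) = 0" if "j \<le> n" for j
    using Suc.IH[of "\<lambda>k. c (Suc k)"] that by blast
  then show ?case using c0 Suc.prems(2) by (cases k) auto
qed

lemma int_poly_zero2:
  fixes c :: "nat \<Rightarrow> nat \<Rightarrow> int"
  assumes "\<And>s t. (\<Sum>j\<le>m. s ^ j * (\<Sum>k\<le>n. t ^ k * c j k)) = 0" and "j \<le> m" "k \<le> n"
  shows "c j k = 0"
  using int_poly_zero[OF int_poly_zero[OF assms(1) assms(2)] assms(3)] by blast

text \<open>Additivity and homogeneity in one equation; \<open>a = -1\<close> gives the value at
  zero and the rule for differences.\<close>

definition lin :: "(('s \<Rightarrow> int) \<Rightarrow> 's \<Rightarrow> int) \<Rightarrow> bool" where
  "lin F \<longleftrightarrow> (\<forall>a f g. F (\<lambda>y. f y + a * g y) = (\<lambda>y. F f y + a * F g y))"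

lemma linD: "lin F \<Longrightarrow> F (\<lambda>y. f y + a * g y) = (\<lambda>y. F f y + a * F g y)"
  by (auto simp: lin_def)

lemma lin_zero: "lin F \<Longrightarrow> F (\<lambda>y. 0) = (\<lambda>y. 0)"
  using linD[of F "\<lambda>y. 0" "-1" "\<lambda>y. 0"] by (simp add: fun_eq_iff)

lemma lin_diff: "lin F \<Longrightarrow> F (\<lambda>y. f y - g y) = (\<lambda>y. F f y - F g y)"
  using linD[of F f "-1" g] by simp

lemma lin_sum:
  assumes "lin F" "finite I"
  shows "F (\<lambda>y. \<Sum>i\<in>I. a i * f i y) = (\<lambda>y. \<Sum>i\<in>I. a i * F (f i) y)"
  using assms(2)
proof (induction I rule: finite_induct)
  case empty
  show ?case by (simp add: lin_zero[OF assms(1)])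
next
  case (insert x I)
  have "F (\<lambda>y. \<Sum>i\<in>insert x I. a i * f i y) = F (\<lambda>y. (\<Sum>i\<in>I. a i * f i y) + a x * f x y)"
    using insert by (simp add: add.commute)
  also have "\<dots> = (\<lambda>y. F (\<lambda>y. \<Sum>i\<in>I. a i * f i y) y + a x * F (f x) y)"
    by (rule linD[OF assms(1)])
  finally show ?case using insert by (simp add: add.commute)
qed

definition elem :: "('i \<Rightarrow> ('s \<Rightarrow> int) \<Rightarrow> 's \<Rightarrow> int) \<Rightarrow> int \<Rightarrow> 'i \<Rightarrow> ('s \<Rightarrow> int) \<Rightarrow> 's \<Rightarrow> int" where
  "elem u t i g = (\<lambda>y. g y + t * u i g y)"

text \<open>The product of the factors \<open>1 + t u_i\<close> in list order. The head is the
  outermost factor, so for removal operators it acts on the state first.\<close>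

definition elems :: "('i \<Rightarrow> ('s \<Rightarrow> int) \<Rightarrow> 's \<Rightarrow> int) \<Rightarrow> int \<Rightarrow> 'i list \<Rightarrow> ('s \<Rightarrow> int) \<Rightarrow> 's \<Rightarrow> int" where
  "elems u t is g = foldr (elem u t) is g"

lemma elems_Nil [simp]: "elems u t [] g = g"
  and elems_Cons [simp]: "elems u t (i # is) g = elem u t i (elems u t is g)"
  and elems_append [simp]: "elems u t (is @ js) g = elems u t is (elems u t js g)"
  by (simp_all add: elems_def)

text \<open>The coefficient of \<open>t\<^sup>k\<close> in \<^const>\<open>elems\<close>.\<close>

fun elems_coeff :: "('i \<Rightarrow> ('s \<Rightarrow> int) \<Rightarrow> 's \<Rightarrow> int) \<Rightarrow> 'i list \<Rightarrow> nat \<Rightarrow> ('s \<Rightarrow> int) \<Rightarrow> 's \<Rightarrow> int" where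
  "elems_coeff u [] k g = (\<lambda>y. if k = 0 then g y else 0)"
| "elems_coeff u (i # is) 0 g = elems_coeff u is 0 g"
| "elems_coeff u (i # is) (Suc k) g =
     (\<lambda>y. elems_coeff u is (Suc k) g y + u i (elems_coeff u is k g) y)"

lemma elems_coeff_0 [simp]: "elems_coeff u is 0 g = g"
  by (induction "is") auto

lemma elem_lin: "lin (u i) \<Longrightarrow> lin (elem u t i)"
  by (auto simp: lin_def elem_def algebra_simps)

lemma elems_lin: "(\<And>i. i \<in> set is \<Longrightarrow> lin (u i)) \<Longrightarrow> lin (elems u t is)"
proof (induction "is")
  case (Cons i "is")
  then have "lin (elem u t i)" "lin (elems u t is)" by (auto intro: elem_lin)
  then show ?case unfolding lin_def by simp
qed (simp add: lin_def)

lemma elems_coeff_big: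
  assumes "\<And>i. lin (u i)"
  shows "k > length is \<Longrightarrow> elems_coeff u is k g = (\<lambda>y. 0)"
proof (induction "is" arbitrary: k)
  case (Cons i "is")
  then show ?case using lin_zero[OF assms] by (cases k) auto
qed auto

lemma elems_expand:
  assumes "\<And>i. lin (u i)"
  shows "elems u t is g = (\<lambda>y. \<Sum>k\<le>length is. t ^ k * elems_coeff u is k g y)"
proof (induction "is")
  case (Cons i "is")
  let ?n = "length is" and ?e = "elems_coeff u is"
  have "elems u t (i # is) g y = (\<Sum>k\<le>Suc ?n. t ^ k * elems_coeff u (i # is) k g y)" for y
  proof -
    have "elems u t (i # is) g y =
      (\<Sum>k\<le>?n. t ^ k * ?e k g y) + t * (\<Sum>k\<le>?n. t ^ k * u i (?e k g) y)"
      by (simp add: elem_def Cons lin_sum[OF assms])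
    also have "(\<Sum>k\<le>?n. t ^ k * ?e k g y) = (\<Sum>k\<le>Suc ?n. t ^ k * ?e k g y)"
      by (simp add: elems_coeff_big[of u, OF assms])
    also have "\<dots> = g y + (\<Sum>k\<le>?n. t ^ Suc k * ?e (Suc k) g y)"
      by (simp only: sum.atMost_Suc_shift) simp
    finally show ?thesis
      by (simp only: sum.atMost_Suc_shift)
        (simp add: sum_distrib_left sum.distrib algebra_simps)
  qed
  then show ?case by auto
qed simp

lemma elems_coeff_lin:
  assumes "\<And>i. lin (u i)"
  shows "lin (elems_coeff u is k)"
proof (induction "is" arbitrary: k)
  case Nil
  show ?case by (cases k) (simp_all add: lin_def)
next
  case (Cons i "is")
  show ?case
  proof (cases k)
    case 0
    then show ?thesis by (simp add: lin_def)
  next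
    case (Suc j)
    have "lin (elems_coeff u is (Suc j))" "lin (elems_coeff u is j)" "lin (u i)"
      using Cons assms by auto
    then show ?thesis unfolding lin_def Suc by (simp add: algebra_simps)
  qed
qed

text \<open>Both products are polynomials in \<open>s\<close> and \<open>t\<close>; equality at all
  integers gives equality of coefficients.\<close>

lemma elems_coeff_commute:
  assumes lin: "\<And>i. lin (u i)"
    and comm: "\<And>s t g. elems u s is (elems u t is g) = elems u t is (elems u s is g)"
  shows "elems_coeff u is j (elems_coeff u is k g) = elems_coeff u is k (elems_coeff u is j g)"
proof (cases "j \<le> length is \<and> k \<le> length is")
  case True
  let ?n = "length is" and ?e = "elems_coeff u is"
  have exp: "elems u s is (elems u t is g) y =
    (\<Sum>j\<le>?n. s ^ j * (\<Sum>k\<le>?n. t ^ k * ?e j (?e k g) y))" for s t y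
  proof -
    have "elems u s is (elems u t is g) y
      = (\<Sum>j\<le>?n. s ^ j * ?e j (\<lambda>y. \<Sum>k\<le>?n. t ^ k * ?e k g y) y)"
      by (simp add: elems_expand[of u, OF lin])
    then show ?thesis by (simp add: lin_sum[OF elems_coeff_lin[of u, OF lin]])
  qed
  show ?thesis
  proof
    fix y
    have "(\<Sum>j\<le>?n. s ^ j * (\<Sum>k\<le>?n. t ^ k * (?e j (?e k g) y - ?e k (?e j g) y))) = 0" for s t
    proof -
      have "(\<Sum>j\<le>?n. s ^ j * (\<Sum>k\<le>?n. t ^ k * ?e k (?e j g) y)) = elems u t is (elems u s is g) y"
        unfolding exp sum_distrib_left
        by (subst sum.swap) (simp add: algebra_simps)
      then show ?thesis
        unfolding right_diff_distrib sum_subtractf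
        using exp[of s t y] comm[of s t g] by simp
    qed
    from int_poly_zero2[OF this] True
    show "?e j (?e k g) y = ?e k (?e j g) y" by (metis eq_iff_diff_eq_0)
  qed
next
  case False
  then have "j > length is \<or> k > length is" by auto
  then show ?thesis
    by (auto simp: elems_coeff_big[of u, OF lin] lin_zero[OF elems_coeff_lin[of u, OF lin]])
qed

text \<open>This is the coefficient of \<open>t ^ d\<close> in
  \<open>A(- t) A(t) g = g\<close>.\<close>

lemma elems_coeff_cancel:
  assumes lin: "\<And>i. lin (u i)"
    and inv: "\<And>t. elems u (- t) is (elems u t is g) = g"
    and d: "d > 0"
  shows "(\<Sum>j\<le>d. (- 1) ^ j * elems_coeff u is j (elems_coeff u is (d - j) g) y) = 0"
proof -
  let ?n = "length is" and ?e = "elems_coeff u is"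
  let ?c = "\<lambda>d. \<Sum>j\<le>d. (- 1) ^ j * ?e j (?e (d - j) g) y"
  let ?x = "\<lambda>j k. (- 1) ^ j * ?e j (?e k g) y"
  have zero: "?e j (?e k g) y = 0" if "j > ?n \<or> k > ?n" for j k
    using that by (auto simp: elems_coeff_big[of u, OF lin] lin_zero[OF elems_coeff_lin[of u, OF lin]])
  have "(\<Sum>d\<le>2 * ?n. t ^ d * (?c d - (if d = 0 then g y else 0))) = 0" for t
  proof -
    have "g y = (\<Sum>j\<le>?n. (- t) ^ j * ?e j (\<lambda>y. \<Sum>k\<le>?n. t ^ k * ?e k g y) y)"
      using inv[of t] by (simp add: elems_expand[of u, OF lin] fun_eq_iff)
    also have "\<dots> = (\<Sum>j\<le>?n. (- t) ^ j * (\<Sum>k\<le>?n. t ^ k * ?e j (?e k g) y))"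
      by (simp add: lin_sum[OF elems_coeff_lin[of u, OF lin]])
    also have "\<dots> = (\<Sum>j\<le>?n. \<Sum>k\<le>?n. t ^ (j + k) * ?x j k)"
      by (simp add: sum_distrib_left power_add power_minus[of t] mult_ac)
    also have "\<dots> = (\<Sum>(j, k)\<in>{..?n} \<times> {..?n}. t ^ (j + k) * ?x j k)"
      by (simp add: sum.cartesian_product)
    \<comment> \<open>Terms with an index above \<open>?n\<close> vanish, so the square may be
      enlarged to a triangle, which can be summed by total degree.\<close>
    also have "\<dots> = (\<Sum>(j, k)\<in>{(j, k). j + k \<le> 2 * ?n}. t ^ (j + k) * ?x j k)"
    proof (rule sum.mono_neutral_left)
      have "{(j, k). j + k \<le> 2 * ?n} \<subseteq> {..2 * ?n} \<times> {..2 * ?n}" by auto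
      then show "finite {(j, k). j + k \<le> 2 * ?n}" by (rule finite_subset) simp
      show "\<forall>i\<in>{(j, k). j + k \<le> 2 * ?n} - {..?n} \<times> {..?n}. (case i of (j, k) \<Rightarrow> t ^ (j + k) * ?x j k) = 0"
        using zero by (auto simp: not_le) (metis not_le)+
    qed auto
    also have "\<dots> = (\<Sum>d\<le>2 * ?n. \<Sum>j\<le>d. t ^ (j + (d - j)) * ?x j (d - j))"
      by (rule sum.triangle_reindex_eq)
    also have "\<dots> = (\<Sum>d\<le>2 * ?n. t ^ d * ?c d)"
      by (simp add: sum_distrib_left)
    finally have "(\<Sum>d\<le>2 * ?n. t ^ d * ?c d) = g y" by simp
    then show ?thesis
      by (simp add: right_diff_distrib sum_subtractf if_distrib[of "\<lambda>x. _ * x"] sum.delta cong: if_cong)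
  qed
  from int_poly_zero[OF this, of d] show ?thesis
  proof (cases "d \<le> 2 * ?n")
    \<comment> \<open>The polynomial identity only reaches \<open>2 * ?n\<close>; beyond it every
      single term vanishes.\<close>
    case False
    then have "j > ?n \<or> d - j > ?n" if "j \<le> d" for j using that by linarith
    then show ?thesis using zero by (intro sum.neutral) auto
  qed (use d in auto)
qed

text \<open>The coefficient of a monomial in \<open>A(x_N) \<cdots> A(x_1) g\<close>; the list of
  exponents starts with that of the outermost factor, which belongs to the largest variable.\<close>

definition iter_coeff :: "('i \<Rightarrow> ('s \<Rightarrow> int) \<Rightarrow> 's \<Rightarrow> int) \<Rightarrow> 'i list \<Rightarrow> ('s \<Rightarrow> int) \<Rightarrow> nat list \<Rightarrow> 's \<Rightarrow> int" where
  "iter_coeff u is g l = foldr (elems_coeff u is) l g"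

lemma iter_coeff_Nil [simp]: "iter_coeff u is g [] = g"
  and iter_coeff_Cons [simp]: "iter_coeff u is g (k # l) = elems_coeff u is k (iter_coeff u is g l)"
  by (simp_all add: iter_coeff_def)

lemma iter_coeff_perm:
  assumes "\<And>i. lin (u i)"
    and "\<And>s t g. elems u s is (elems u t is g) = elems u t is (elems u s is g)"
    and "mset l = mset l'"
  shows "iter_coeff u is g l = iter_coeff u is g l'"
proof -
  have "fold (elems_coeff u is) (rev l) = fold (elems_coeff u is) (rev l')"
    using assms(3)
    by (intro fold_multiset_equiv) (auto simp: fun_eq_iff elems_coeff_commute[of u, OF assms(1,2)])
  then show ?thesis by (simp add: iter_coeff_def foldr_conv_fold)
qed

text \<open>The first hypothesis says that \<open>t\<close> cancels on substituting \<open>x\<^sub>1 = t, x\<^sub>2 = - t\<close>; with it a repeated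
  entry \<open>a, a\<close> can be traded for entries \<open>a + k, a - k\<close> with a larger sum of squares.\<close>

lemma cancel_vanish:
  fixes C :: "nat multiset \<Rightarrow> int"
  assumes cancel: "\<And>a M. a > 0 \<Longrightarrow>
      (\<Sum>j\<le>2 * a. (- 1) ^ j * C (add_mset j (add_mset (2 * a - j) M))) = 0"
    and zero: "\<And>M. C (add_mset 0 M) = C M"
    and deg: "\<And>M. sum_mset M \<noteq> d \<Longrightarrow> C M = 0"
    and big: "\<And>k M. k > r \<Longrightarrow> C (add_mset k M) = 0"
    and d: "d \<ge> \<Sum>{1..r}"
    and top: "C (mset_set {1..r}) = 0"
  shows "C M = 0"
proof -
  have *: "C M = 0" if "sum_mset M = d" for M
    using that
  \<comment> \<open>A multiset of sum \<open>d\<close> has sum of squares at most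
    \<open>d * d\<close>, so the induction may proceed from larger sums of squares to smaller
    ones.\<close>
  proof (induction "d * d - sum_mset (image_mset (\<lambda>x. x * x) M)" arbitrary: M rule: less_induct)
    case less
    define sq where "sq = (\<lambda>M :: nat multiset. sum_mset (image_mset (\<lambda>x. x * x) M))"
    have sq_le: "sq M \<le> sum_mset M * sum_mset M" for M
      by (induction M) (auto simp: sq_def algebra_simps)
    have M0: "C (filter_mset (\<lambda>x. x > 0) N) = C N" for N
    proof -
      have "C (N + replicate_mset n 0) = C N" for n N by (induction n) (auto simp: zero)
      moreover have "N = filter_mset (\<lambda>x. x > 0) N + replicate_mset (count N 0) 0"
        by (rule multiset_eqI) auto
      ultimately show ?thesis by metis
    qed
    show ?case
    proof (cases "\<exists>a > 0. count M a \<ge> 2")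
      case True
      then obtain a where a: "a > 0" "count M a \<ge> 2" by blast
      obtain N where N: "M = add_mset a (add_mset a N)"
      proof -
        have "replicate_mset 2 a \<subseteq># M" using a(2) by (simp add: count_le_replicate_mset_subset_eq)
        then obtain N where "M = replicate_mset 2 a + N" by (metis subset_mset.add_diff_inverse)
        then show ?thesis using that[of N] by (simp add: numeral_2_eq_2)
      qed
      have other: "C (add_mset j (add_mset (2 * a - j) N)) = 0" if j: "j \<le> 2 * a" "j \<noteq> a" for j
      proof (rule less.hyps)
        let ?M = "add_mset j (add_mset (2 * a - j) N)"
        show s: "sum_mset ?M = d" using less.prems that by (simp add: N)
        \<comment> \<open>Convexity: spreading \<open>a, a\<close> apart with fixed sum increases
          the sum of squares. Hence only the term \<open>j = a\<close> survives in the cancellation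
          relation.\<close>
        have "j * j + (2 * a - j) * (2 * a - j) > a * a + a * a"
        proof (cases "j < a")
          case True
          then obtain k where "a = j + k" "k > 0" using less_imp_add_positive by blast
          then show ?thesis by (simp add: algebra_simps)
        next
          case False
          then obtain k where k: "j = a + k" "k > 0" using j(2) by (metis less_imp_add_positive linorder_neqE_nat)
          then obtain b where "a = b + k" using j(1) by (metis add_le_cancel_left le_add_diff_inverse2 mult_2)
          then show ?thesis using k by (simp add: algebra_simps)
        qed
        then have "sq ?M > sq M" by (simp add: sq_def N)
        moreover have "sq ?M \<le> d * d" using sq_le[of ?M] s by simp
        ultimately show "d * d - sum_mset (image_mset (\<lambda>x. x * x) ?M) < d * d - sum_mset (image_mset (\<lambda>x. x * x) M)"
          unfolding sq_def by linarith
      qed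
      have "(\<Sum>j\<le>2 * a. (- 1) ^ j * C (add_mset j (add_mset (2 * a - j) N))) =
        (\<Sum>j\<in>{a}. (- 1) ^ j * C (add_mset j (add_mset (2 * a - j) N)))"
        using other by (intro sum.mono_neutral_right) auto
      then have "(- 1) ^ a * C M = 0" using cancel[OF a(1), of N] by (simp add: N mult_2)
      then show ?thesis by simp
    next
      case False
      define P where "P = filter_mset (\<lambda>x. x > 0) M"
      show ?thesis
      proof (cases "\<exists>k\<in>#P. k > r")
        case True
        then show ?thesis using big M0[of M] P_def by (metis insert_DiffM)
      next
        case small: False
        have "count P x \<le> 1" for x using False by (auto simp: P_def not_le) (metis One_nat_def less_2_cases_iff le_less zero_le not_less_zero)
        then have P: "P = mset_set (set_mset P)"
          by (intro multiset_eqI)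
             (metis count_eq_zero_iff count_mset_set(1,3) finite_set_mset le_antisym less_one not_le)
        have sub: "set_mset P \<subseteq> {1..r}" using small by (auto simp: P_def)
        have sumP: "\<Sum>(set_mset P) = d"
        proof -
          have "sum_mset P = sum_mset M" unfolding P_def by (induction M) auto
          moreover have "sum_mset P = \<Sum>(set_mset P)"
            by (subst P) (simp add: sum_unfold_sum_mset)
          ultimately show ?thesis using less.prems by simp
        qed
        \<comment> \<open>Distinct parts from \<open>{1..r}\<close> with sum at least
          \<open>\<Sum>{1..r}\<close> must use all of \<open>{1..r}\<close>.\<close>
        have "set_mset P = {1..r}"
        proof (rule ccontr)
          assume "set_mset P \<noteq> {1..r}"
          then obtain x where "x \<in> {1..r}" "x \<notin> set_mset P" using sub by blast
          then have "\<Sum>(set_mset P) < \<Sum>{1..r}"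
            using sub by (intro sum_strict_mono2[of _ _ x]) auto
          then show False using sumP d by simp
        qed
        then show ?thesis using top M0[of M] P P_def by simp
      qed
    qed
  qed
  then show ?thesis using deg by (cases "sum_mset M = d") auto
qed

section \<open>Commuting products\<close>

lemma elem_0 [simp]: "elem u 0 i g = g"
  by (simp add: elem_def)

lemma elem_add:
  assumes "lin (u i)" "\<And>g. u i (u i g) = (\<lambda>y. 0)"
  shows "elem u s i (elem u t i g) = elem u (s + t) i g"
  by (simp add: elem_def linD[OF assms(1)] assms(2) algebra_simps)

lemma elem_commute:
  assumes "lin (u i)" "lin (u j)" "\<And>g. u i (u j g) = u j (u i g)"
  shows "elem u s i (elem u t j g) = elem u t j (elem u s i g)"
  by (simp add: elem_def linD[OF assms(1)] linD[OF assms(2)] assms(3) algebra_simps)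

lemma elem_elems_commute:
  assumes "lin (u i)" "\<And>j. j \<in> set is \<Longrightarrow> lin (u j)"
    and "\<And>j g. j \<in> set is \<Longrightarrow> u i (u j g) = u j (u i g)"
  shows "elem u s i (elems u t is g) = elems u t is (elem u s i g)"
  using assms(2,3)
proof (induction "is")
  case (Cons j "is")
  have "elem u s i (elem u t j (elems u t is g)) = elem u t j (elem u s i (elems u t is g))"
    by (rule elem_commute) (use Cons.prems assms(1) in auto)
  then show ?case using Cons by simp
qed simp

text \<open>The product telescopes from the middle, where \<open>1 - t u_i\<close> meets
  \<open>1 + t u_i\<close> and \<open>u_i\<close> has square zero.\<close>

lemma elems_rev_inverse:
  assumes "\<And>i. i \<in> set is \<Longrightarrow> lin (u i)" "\<And>i g. i \<in> set is \<Longrightarrow> u i (u i g) = (\<lambda>y. 0)"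
  shows "elems u (- t) (rev is) (elems u t is g) = g"
  using assms
proof (induction "is" arbitrary: g)
  case (Cons i "is")
  then have "elem u (- t) i (elem u t i (elems u t is g)) = elems u t is g"
    by (subst elem_add) auto
  then show ?case using Cons by simp
qed simp

text \<open>The relations of the nilCoxeter algebra of type A.\<close>

locale nil_ops =
  fixes u :: "nat \<Rightarrow> ('s \<Rightarrow> int) \<Rightarrow> 's \<Rightarrow> int"
  assumes lin: "lin (u i)"
    and square: "u i (u i g) = (\<lambda>y. 0)"
    and far: "Suc i < j \<Longrightarrow> u i (u j g) = u j (u i g)"
    and braid: "u i (u (Suc i) (u i g)) = u (Suc i) (u i (u (Suc i) g))"
begin

lemma add: "elem u s i (elem u t i g) = elem u (s + t) i g"
  by (rule elem_add[of u, OF lin square])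

text \<open>The Yang--Baxter equation in additive form: after expansion squares vanish and the cubic
  terms agree by \<open>braid\<close>.\<close>

lemma yang_baxter:
  "elem u s i (elem u (s + t) (Suc i) (elem u t i g)) =
   elem u t (Suc i) (elem u (s + t) i (elem u s (Suc i) g))"
  unfolding elem_def linD[OF lin] square braid lin_zero[OF lin]
  by (rule ext) (simp add: algebra_simps)

lemma elem_upt_commute:
  assumes "Suc i < a"
  shows "elem u s i (elems u t [a..<b] g) = elems u t [a..<b] (elem u s i g)"
  by (rule elem_elems_commute) (use assms in \<open>auto intro: lin far\<close>)

text \<open>The commutation behind the symmetry of Stanley's functions. Splitting off the two
  smallest generators reduces it to the same statement from \<open>Suc a\<close> on and to one
  Yang--Baxter move.\<close>

lemma upt_commute:
  "elems u s [a..<b] (elems u t [a..<b] g) = elems u t [a..<b] (elems u s [a..<b] g)"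
proof (induction "b - a" arbitrary: a g s t)
  case 0
  then show ?case by simp
next
  case (Suc n)
  have *: "elems u t [a..<b] g = elem u t a (elems u t [Suc a..<b] g)" for t g
    using Suc.hyps(2) by (simp add: upt_conv_Cons)
  show ?case
  proof (cases "Suc a < b")
    case False
    then show ?thesis by (simp add: * add add.commute)
  next
    case True
    have "elems u x [Suc a..<b] g = elem u x (Suc a) (elems u x [Suc (Suc a)..<b] g)" for x g
      using True by (simp add: upt_conv_Cons)
    then have tail: "elems u x [Suc (Suc a)..<b] g = elem u (- x) (Suc a) (elems u x [Suc a..<b] g)" for x g
      by (simp add: add)
    define J where "J = (\<lambda>x. elems u x [Suc a..<b])"
    \<comment> \<open>The factors beyond \<open>Suc a\<close> commute with generator
      \<open>a\<close>; moved past it and completed to \<open>J x\<close> by the correction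
      \<open>elem u (- x) (Suc a)\<close>, they leave \<open>Q x y\<close> in front of
      \<open>J x (J y g)\<close>.\<close>
    define Q where "Q = (\<lambda>x y g. elem u x a (elem u x (Suc a) (elem u y a (elem u (- x) (Suc a) g))))"
    have "elems u x [a..<b] (elems u y [a..<b] g) = Q x y (J x (J y g))" for x y
    proof -
      have "elems u x [a..<b] (elems u y [a..<b] g)
        = elem u x a (elem u x (Suc a) (elems u x [Suc (Suc a)..<b] (elem u y a (J y g))))"
        using True by (simp add: * J_def upt_conv_Cons)
      also have "\<dots> = elem u x a (elem u x (Suc a) (elem u y a (elems u x [Suc (Suc a)..<b] (J y g))))"
        by (subst elem_upt_commute) auto
      finally show ?thesis by (simp add: tail Q_def J_def)
    qed
    moreover have "J x (J y g) = J y (J x g)" for x y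
      unfolding J_def using Suc.hyps(2) by (intro Suc.hyps(1)) auto
    moreover have "Q x y g = Q y x g" for x y g
    proof -
      \<comment> \<open>Writing the parameter \<open>x\<close> at \<open>a\<close> as
        \<open>y + (x - y)\<close> makes \<open>yang_baxter\<close> applicable with parameters
        \<open>x - y\<close> and \<open>y\<close>.\<close>
      have "Q x y g = elem u y a (elem u (x - y) a (elem u ((x - y) + y) (Suc a) (elem u y a (elem u (- x) (Suc a) g))))"
        by (simp add: Q_def add)
      also have "\<dots> = elem u y a (elem u y (Suc a) (elem u x a (elem u (x - y) (Suc a) (elem u (- x) (Suc a) g))))"
        by (subst yang_baxter) simp
      finally show ?thesis by (simp add: Q_def add)
    qed
    ultimately show ?thesis by metis
  qed
qed

lemma rev_upt_inverse: "elems u (- t) (rev [a..<b]) (elems u t [a..<b] g) = g"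
  by (rule elems_rev_inverse) (auto intro: lin square)

lemma upt_rev_inverse: "elems u t [a..<b] (elems u (- t) (rev [a..<b]) g) = g"
  using elems_rev_inverse[of "rev [a..<b]" u "- t" g] by (simp add: lin square)

text \<open>The decreasing product at \<open>t\<close> is the two-sided inverse of the increasing
  one at \<open>- t\<close>, and inverses of commuting operators commute.\<close>

lemma rev_upt_commute:
  "elems u s (rev [a..<b]) (elems u t (rev [a..<b]) g) =
   elems u t (rev [a..<b]) (elems u s (rev [a..<b]) g)"
proof -
  let ?I = "\<lambda>t. elems u t [a..<b]" and ?R = "\<lambda>t. elems u t (rev [a..<b])"
  define g' where "g' = ?R s (?R t g)"
  have "?I (- s) g' = ?R t g" "?I (- t) (?R t g) = g"
    using upt_rev_inverse[of "- s" a b] upt_rev_inverse[of "- t" a b] by (simp_all add: g'_def)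
  then have "?I (- s) (?I (- t) g') = g" by (metis upt_commute)
  moreover have "?R t (?R s (?I (- s) (?I (- t) g'))) = g'"
    using rev_upt_inverse[of "- s" a b] rev_upt_inverse[of "- t" a b] by simp
  ultimately show ?thesis by (simp add: g'_def)
qed

lemma upt_rev_commute:
  "elems u s [a..<b] (elems u t (rev [a..<b]) g) = elems u t (rev [a..<b]) (elems u s [a..<b] g)"
proof -
  let ?I = "\<lambda>t. elems u t [a..<b]" and ?R = "\<lambda>t. elems u t (rev [a..<b])"
  have "?I s (?R t g) = ?I s (?R t (?R (- s) (?I s g)))" by (simp add: rev_upt_inverse)
  also have "\<dots> = ?I s (?R (- s) (?R t (?I s g)))" by (simp add: rev_upt_commute)
  finally show ?thesis by (simp add: upt_rev_inverse)
qed

end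

text \<open>The order in which the boxes with one entry are taken away: unprimed ones by contents
  \<open>m, \<dots>, 0\<close>, then primed ones by contents \<open>1, \<dots>, m\<close>. Content 0
  occurs once since the diagonal has no primes.\<close>

definition K_word :: "nat \<Rightarrow> nat list" where
  "K_word m = rev [1..<Suc m] @ 0 # [1..<Suc m]"

text \<open>The generator \<open>0\<close> acts as a reflecting wall.  Commutation comes down to the type \<open>B\<^sub>2\<close> Yang--Baxter
  equation, here the symmetry of \<open>R\<close> in the proof of \<open>K_commute\<close>.\<close>

locale nil_ops_B =
  fixes v :: "nat \<Rightarrow> ('s \<Rightarrow> int) \<Rightarrow> 's \<Rightarrow> int"
  assumes lin: "lin (v i)"
    and square: "v i (v i g) = (\<lambda>y. 0)"
    and far: "Suc i < j \<Longrightarrow> v i (v j g) = v j (v i g)"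
    and braid: "0 < i \<Longrightarrow> v i (v (Suc i) (v i g)) = v (Suc i) (v i (v (Suc i) g))"
    and refl: "v (Suc 0) (v 0 (v (Suc 0) g)) = (\<lambda>y. 0)"
begin

sublocale A: nil_ops "\<lambda>i. v (Suc i)"
  by unfold_locales (auto intro: lin square far braid)

lemma elems_Suc: "elems v t (map Suc is) g = elems (\<lambda>i. v (Suc i)) t is g"
  by (induction "is") (auto simp: elem_def)

abbreviation H :: "nat \<Rightarrow> int \<Rightarrow> ('s \<Rightarrow> int) \<Rightarrow> 's \<Rightarrow> int" where
  "H m t \<equiv> elems v t (rev [1..<Suc m])"
abbreviation H' :: "nat \<Rightarrow> int \<Rightarrow> ('s \<Rightarrow> int) \<Rightarrow> 's \<Rightarrow> int" where
  "H' m t \<equiv> elems v t [1..<Suc m]"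

lemma add: "elem v s i (elem v t i g) = elem v (s + t) i g"
  by (rule elem_add[of v, OF lin square])

lemma shift_word: "[1..<Suc m] = map Suc [0..<m]"
  by (simp add: map_Suc_upt)

lemma H_A: "H m t g = elems (\<lambda>i. v (Suc i)) t (rev [0..<m]) g"
  unfolding shift_word rev_map elems_Suc ..

lemma H'_A: "H' m t g = elems (\<lambda>i. v (Suc i)) t [0..<m] g"
  unfolding shift_word elems_Suc ..

lemma H_inverse: "H' m (- t) (H m t g) = g"
  unfolding H_A H'_A using A.upt_rev_inverse[of "- t"] by simp

lemma K_inverse: "elems v (- t) (K_word m) (elems v t (K_word m) g) = g"
  using elems_rev_inverse[of "K_word m" v t g] by (simp add: K_word_def lin square)

lemma K_commute:
  "elems v s (K_word m) (elems v t (K_word m) g) = elems v t (K_word m) (elems v s (K_word m) g)"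
proof (cases m)
  case 0
  then show ?thesis by (simp add: K_word_def add add.commute)
next
  case (Suc n)
  define H2 H2' where "H2 = (\<lambda>t. elems v t (rev [2..<Suc m]))" and "H2' = (\<lambda>t. elems v t [2..<Suc m])"
  have "[1..<Suc m] = 1 # [2..<Suc m]"
    using Suc by (simp add: upt_conv_Cons numeral_2_eq_2)
  then have H: "H m t g = H2 t (elem v t 1 g)" and H': "H' m t g = elem v t 1 (H2' t g)" for t g
    by (simp_all add: H2_def H2'_def del: upt_Suc)
  have K: "elems v t (K_word m) g = H m t (elem v t 0 (H' m t g))" for t g
    by (simp add: K_word_def del: upt_Suc)
  \<comment> \<open>The middle factor that remains once \<open>H m s\<close> and
    \<open>H' m t\<close> have been interchanged and moved past generator 0; they do so up to their
    factor at generator 1, which the outer two terms correct.\<close>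
  define R where "R = (\<lambda>s t g. elem v (- s) 1 (elem v t 0 (elem v (s + t) 1 (elem v s 0 (elem v (- t) 1 g)))))"
  have KK: "elems v t (K_word m) (elems v s (K_word m) g) = H m t (H m s (R s t (H' m t (H' m s g))))" for s t
  proof -
    have "H' m t (H m s g) = H m s (H' m t g)" for g
      unfolding H_A H'_A by (rule A.upt_rev_commute)
    moreover have "elem v t 0 (H2 s g) = H2 s (elem v t 0 g)" for t s g
      unfolding H2_def by (rule elem_elems_commute) (auto intro: lin far)
    moreover have "elem v s 0 (H2' t g) = H2' t (elem v s 0 g)" for t s g
      unfolding H2'_def by (rule elem_elems_commute) (auto intro: lin far)
    moreover have "H2 s g = H m s (elem v (- s) 1 g)" "H2' t g = elem v (- t) 1 (H' m t g)" for s t g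
      by (simp_all only: H H' add right_minus left_minus elem_0)
    ultimately show ?thesis unfolding K R_def
      by (metis (no_types, lifting) H H' add)
  qed
  \<comment> \<open>By \<open>square\<close> and \<open>refl\<close> the expansion collapses to
    \<open>1 + (s + t) v_0 + s t (s + t) v_0 v_1 v_0\<close>, which is symmetric.\<close>
  have "R s t g = R t s g" for s t g
    unfolding R_def elem_def One_nat_def linD[OF lin] square refl lin_zero[OF lin]
    by (rule ext) (simp add: algebra_simps)
  moreover have "H m t (H m s g) = H m s (H m t g)" "H' m t (H' m s g) = H' m s (H' m t g)" for g
    unfolding H_A H'_A by (rule A.rev_upt_commute A.upt_commute)+
  ultimately show ?thesis unfolding KK by simp
qed

end

section \<open>Length and Demazure product on \<open>S\<^sub>\<int>\<close>\<close>

lemma apply_simple_refl: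
  "simple_refl i \<langle>$\<rangle> x = (if x = i then i + 1 else if x = i + 1 then i else x)"
  by (auto simp: simple_refl_def)

lemma apply_mult: "(u * v) \<langle>$\<rangle> x = u \<langle>$\<rangle> (v \<langle>$\<rangle> x)"
  by (simp add: apply_times)

lemma apply_inverse_apply [simp]:
  "inverse u \<langle>$\<rangle> (u \<langle>$\<rangle> x) = x" "u \<langle>$\<rangle> (inverse u \<langle>$\<rangle> x) = x"
  by (simp_all flip: apply_mult)

lemma inverse_apply_eq_iff: "inverse u \<langle>$\<rangle> x = z \<longleftrightarrow> x = u \<langle>$\<rangle> z"
  by auto

lemma simple_refl_square [simp]: "simple_refl i * simple_refl i = 1" "u * simple_refl i * simple_refl i = u"
  "simple_refl i * (simple_refl i * u) = u"
  by (auto simp: simple_refl_def mult.assoc) (simp flip: mult.assoc)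

lemma inverse_simple_refl [simp]: "inverse (simple_refl i) = simple_refl i"
  by (simp add: simple_refl_def)

lemma simple_refl_twice [simp]: "simple_refl i \<langle>$\<rangle> (simple_refl i \<langle>$\<rangle> x) = x"
  by (simp flip: apply_mult)

definition desc :: "int \<Rightarrow> int perm \<Rightarrow> bool" where
  "desc i w \<longleftrightarrow> w \<langle>$\<rangle> (i + 1) < w \<langle>$\<rangle> i"

lemma not_desc: "\<not> desc i w \<longleftrightarrow> w \<langle>$\<rangle> i < w \<langle>$\<rangle> (i + 1)"
  using apply_inj[of w i "i + 1"] by (auto simp: desc_def)

lemma desc_mult_simple_refl: "desc i (w * simple_refl i) \<longleftrightarrow> \<not> desc i w"
  by (simp add: not_desc) (simp add: desc_def apply_mult apply_simple_refl)

definition inversions :: "int perm \<Rightarrow> (int \<times> int) set" where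
  "inversions w = {(a, b). a < b \<and> w \<langle>$\<rangle> b < w \<langle>$\<rangle> a}"

lemma affected_bound:
  fixes w :: "int perm"
  obtains m M where "\<And>x. x < m \<Longrightarrow> w \<langle>$\<rangle> x = x" "\<And>x. M < x \<Longrightarrow> w \<langle>$\<rangle> x = x"
proof (rule that[of "Min (affected w)" "Max (affected w)"])
  show "w \<langle>$\<rangle> x = x" if "x < Min (affected w)" for x
    using that Min_le[OF finite_affected, of x w] by (meson in_affected not_le)
  show "w \<langle>$\<rangle> x = x" if "Max (affected w) < x" for x
    using that Max_ge[OF finite_affected, of x w] by (meson in_affected not_le)
qed

lemma inversions_one [simp]: "inversions 1 = {}"
  by (auto simp: inversions_def)

lemma finite_inversions [simp]: "finite (inversions w)"
proof -
  obtain m M where m: "\<And>x. x < m \<Longrightarrow> w \<langle>$\<rangle> x = x" and M: "\<And>x. M < x \<Longrightarrow> w \<langle>$\<rangle> x = x"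
    using affected_bound[of w] by blast
  have "m \<le> a \<and> b \<le> M" if "a < b" "w \<langle>$\<rangle> b < w \<langle>$\<rangle> a" for a b
  proof
    show "m \<le> a"
    proof (rule ccontr)
      assume "\<not> m \<le> a"
      then have "w \<langle>$\<rangle> b < m" "w \<langle>$\<rangle> b < a" using that m[of a] by auto
      then show False using that m[of "w \<langle>$\<rangle> b"] apply_inj[of w "w \<langle>$\<rangle> b" b] by simp
    qed
    show "b \<le> M"
    proof (rule ccontr)
      assume "\<not> b \<le> M"
      then have "M < w \<langle>$\<rangle> a" "b < w \<langle>$\<rangle> a" using that M[of b] by auto
      then show False using that M[of "w \<langle>$\<rangle> a"] apply_inj[of w "w \<langle>$\<rangle> a" a] by simp
    qed
  qed
  then have "inversions w \<subseteq> {m..M} \<times> {m..M}"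
    by (force simp: inversions_def)
  then show ?thesis by (rule finite_subset) simp
qed

lemma simple_refl_less:
  "x \<noteq> y \<Longrightarrow> {x, y} \<noteq> {i, i + 1} \<Longrightarrow> simple_refl i \<langle>$\<rangle> x < simple_refl i \<langle>$\<rangle> y \<longleftrightarrow> x < y"
  by (auto simp: apply_simple_refl)

text \<open>Exchanging the positions \<open>i\<close> and \<open>i + 1\<close> carries inversions to
  inversions; the only new one is \<open>(i, i + 1)\<close>.\<close>

lemma card_inversions_asc:
  assumes "\<not> desc i w"
  shows "card (inversions (w * simple_refl i)) = Suc (card (inversions w))"
proof -
  let ?s = "simple_refl i"
  let ?f = "\<lambda>(a, b). (?s \<langle>$\<rangle> a, ?s \<langle>$\<rangle> b)"
  have "inversions (w * ?s) = insert (i, i + 1) (?f ` inversions w)"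
  proof (intro set_eqI iffI)
    fix p assume "p \<in> inversions (w * ?s)"
    then obtain a b where p: "p = (a, b)" "a < b" "w \<langle>$\<rangle> (?s \<langle>$\<rangle> b) < w \<langle>$\<rangle> (?s \<langle>$\<rangle> a)"
      by (auto simp: inversions_def apply_mult)
    show "p \<in> insert (i, i + 1) (?f ` inversions w)"
    proof (cases "a = i \<and> b = i + 1")
      case False
      then have "?s \<langle>$\<rangle> a < ?s \<langle>$\<rangle> b" using p(2) by (auto simp: apply_simple_refl)
      then have "(?s \<langle>$\<rangle> a, ?s \<langle>$\<rangle> b) \<in> inversions w" using p by (simp add: inversions_def)
      then show ?thesis using p(1) by force
    qed (use p in simp)
  next
    fix p assume "p \<in> insert (i, i + 1) (?f ` inversions w)"
    then consider "p = (i, i + 1)" | a b where "p = ?f (a, b)" "(a, b) \<in> inversions w" by auto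
    then show "p \<in> inversions (w * ?s)"
    proof cases
      case 1
      then show ?thesis using assms
        by (simp add: not_desc inversions_def apply_mult apply_simple_refl)
    next
      case 2
      then have "a < b" "\<not> (a = i \<and> b = i + 1)" "w \<langle>$\<rangle> b < w \<langle>$\<rangle> a"
        using assms by (auto simp: inversions_def not_desc)
      then show ?thesis using 2(1) by (auto simp: inversions_def apply_mult) (auto simp: apply_simple_refl)
    qed
  qed
  moreover have "inj_on ?f (inversions w)" by (auto simp: inj_on_def apply_inj)
  moreover have "(i, i + 1) \<notin> ?f ` inversions w"
    by (auto simp: inversions_def apply_simple_refl split: if_splits)
  ultimately show ?thesis by (simp add: card_image)
qed

lemma card_inversions_desc:
  "desc i w \<Longrightarrow> card (inversions w) = Suc (card (inversions (w * simple_refl i)))"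
  using card_inversions_asc[of i "w * simple_refl i"] by (simp add: desc_mult_simple_refl)

text \<open>Values grow by at least 1 at each step while far points on both sides are fixed, which
  leaves no room for any other growth.\<close>

lemma no_desc_imp_one:
  assumes "\<And>i. \<not> desc i w"
  shows "w = 1"
proof (rule perm_eqI)
  fix x
  obtain m M where m: "\<And>x. x < m \<Longrightarrow> w \<langle>$\<rangle> x = x" and M: "\<And>x. M < x \<Longrightarrow> w \<langle>$\<rangle> x = x"
    using affected_bound[of w] by blast
  have inc: "w \<langle>$\<rangle> i + 1 \<le> w \<langle>$\<rangle> (i + 1)" for i using assms[of i] by (simp add: not_desc)
  have up: "w \<langle>$\<rangle> (z + int k) \<ge> w \<langle>$\<rangle> z + int k" for z k
  proof (induction k)
    case (Suc k)
    then show ?case using inc[of "z + int k"] by (simp add: algebra_simps)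
  qed simp
  define z where "z = min x m - 1"
  define y where "y = max x M + 1"
  have "w \<langle>$\<rangle> z = z" "w \<langle>$\<rangle> y = y" using m M by (auto simp: z_def y_def)
  moreover have "int (nat (x - z)) = x - z" "int (nat (y - x)) = y - x" by (auto simp: z_def y_def)
  ultimately have "x \<le> w \<langle>$\<rangle> x" "w \<langle>$\<rangle> x \<le> x"
    using up[of z "nat (x - z)"] up[of x "nat (y - x)"] by simp_all
  then show "w \<langle>$\<rangle> x = 1 \<langle>$\<rangle> x" by simp
qed

lemma word_perm_Nil [simp]: "word_perm [] = 1"
  and word_perm_Cons: "word_perm (i # a) = simple_refl i * word_perm a"
  and word_perm_snoc: "word_perm (a @ [i]) = word_perm a * simple_refl i"
  by (simp_all add: word_perm_def)

lemma card_inversions_mult_le: "card (inversions (w * simple_refl i)) \<le> Suc (card (inversions w))"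
  using card_inversions_asc[of i w] card_inversions_desc[of i w] by (cases "desc i w") auto

lemma card_inversions_word: "card (inversions (word_perm a)) \<le> length a"
proof (induction a rule: rev_induct)
  case (snoc i a)
  then show ?case using card_inversions_mult_le[of "word_perm a" i] by (simp add: word_perm_snoc)
qed simp

lemma ex_word: "\<exists>a. word_perm a = w \<and> length a = card (inversions w)"
proof (induction "card (inversions w)" arbitrary: w)
  case 0
  then have "w = 1" using card_inversions_desc[of _ w] by (intro no_desc_imp_one) auto
  then show ?case by (intro exI[of _ "[]"]) simp
next
  case (Suc n)
  obtain i where i: "desc i w"
  proof (rule ccontr)
    assume "\<not> thesis"
    then have "w = 1" using that by (intro no_desc_imp_one) blast
    then show False using Suc.hyps(2) by simp
  qed
  then obtain a where "word_perm a = w * simple_refl i" "length a = card (inversions (w * simple_refl i))"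
    using Suc card_inversions_desc[OF i] by (metis Suc_inject)
  then show ?case using card_inversions_desc[OF i]
    by (intro exI[of _ "a @ [i]"]) (simp add: word_perm_snoc)
qed

lemma len_eq: "len w = card (inversions w)"
  unfolding len_def
proof (rule Least_equality)
  show "\<exists>a. word_perm a = w \<and> length a = card (inversions w)" by (rule ex_word)
qed (auto intro: card_inversions_word)

lemma len_asc: "\<not> desc i w \<Longrightarrow> len (w * simple_refl i) = Suc (len w)"
  by (simp add: len_eq card_inversions_asc)

lemma len_mult_le: "len (w * simple_refl i) \<le> Suc (len w)"
  by (simp add: len_eq card_inversions_mult_le)

lemma len_word: "len (word_perm a) \<le> length a"
  by (simp add: len_eq card_inversions_word)

lemma reduced_words_ne: "\<exists>a. a \<in> reduced_words w"
  using ex_word[of w] by (auto simp: reduced_words_def len_eq)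

lemma len_one [simp]: "len 1 = 0"
  by (simp add: len_eq)

lemma inverse_word_perm: "inverse (word_perm a) = word_perm (rev a)"
  by (induction a) (simp_all add: word_perm_Cons word_perm_snoc)

lemma len_inverse [simp]: "len (inverse w) = len w"
proof -
  have "len (inverse w) \<le> len w" for w
  proof -
    obtain a where "a \<in> reduced_words w" using reduced_words_ne by blast
    then show ?thesis using len_word[of "rev a"] by (auto simp: reduced_words_def inverse_word_perm)
  qed
  from this[of w] this[of "inverse w"] show ?thesis by simp
qed

section \<open>The Demazure product, built from right and left multiplication by simple
  reflections\<close>

definition dem_right :: "int \<Rightarrow> int perm \<Rightarrow> int perm" where
  "dem_right i u = (if desc i u then u else u * simple_refl i)"

definition dem_left :: "int \<Rightarrow> int perm \<Rightarrow> int perm" where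
  "dem_left i u = inverse (dem_right i (inverse u))"

lemma L_eq: "dem_left i u = (if desc i (inverse u) then u else simple_refl i * u)"
  by (simp add: dem_left_def dem_right_def)

lemma simple_refl_conj:
  assumes "{u \<langle>$\<rangle> i, u \<langle>$\<rangle> (i + 1)} = {j, j + 1}"
  shows "simple_refl j * u = u * simple_refl i"
proof (rule perm_eqI)
  fix x
  have "u \<langle>$\<rangle> x \<noteq> j \<and> u \<langle>$\<rangle> x \<noteq> j + 1" if "x \<noteq> i" "x \<noteq> i + 1"
    using that assms apply_inj[of u x i] apply_inj[of u x "i + 1"] by (auto simp: doubleton_eq_iff)
  then show "(simple_refl j * u) \<langle>$\<rangle> x = (u * simple_refl i) \<langle>$\<rangle> x"
    using assms by (auto simp: apply_mult apply_simple_refl doubleton_eq_iff)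
qed

lemma desc_simple_refl_mult:
  assumes "{u \<langle>$\<rangle> i, u \<langle>$\<rangle> (i + 1)} \<noteq> {j, j + 1}"
  shows "desc i (simple_refl j * u) \<longleftrightarrow> desc i u"
  using simple_refl_less[of "u \<langle>$\<rangle> (i + 1)" "u \<langle>$\<rangle> i" j] assms
  by (auto simp: desc_def apply_mult apply_inj insert_commute)

text \<open>If \<open>u\<close> carries \<open>{i, i + 1}\<close> to \<open>{j, j + 1}\<close>, then
  \<open>s_j u = u s_i\<close> and the left and right descents occur together; otherwise neither
  operation affects the descent condition of the other.\<close>

lemma T_L_commute: "dem_right i (dem_left j u) = dem_left j (dem_right i u)"
proof (cases "{u \<langle>$\<rangle> i, u \<langle>$\<rangle> (i + 1)} = {j, j + 1}")
  case True
  then have inv: "{inverse u \<langle>$\<rangle> j, inverse u \<langle>$\<rangle> (j + 1)} = {i, i + 1}"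
    by (auto simp: doubleton_eq_iff inverse_apply_eq_iff)
  have "desc j (inverse u) \<longleftrightarrow> desc i u"
    using True inv by (auto simp: desc_def doubleton_eq_iff inverse_apply_eq_iff)
  moreover have "desc i (u * simple_refl i) \<longleftrightarrow> \<not> desc i u"
    by (rule desc_mult_simple_refl)
  moreover have "desc j (inverse u * simple_refl j) \<longleftrightarrow> \<not> desc j (inverse u)"
    by (rule desc_mult_simple_refl)
  ultimately show ?thesis
    using simple_refl_conj[OF True] simple_refl_conj[OF inv] by (auto simp: dem_right_def L_eq)
next
  case False
  then have inv: "{inverse u \<langle>$\<rangle> j, inverse u \<langle>$\<rangle> (j + 1)} \<noteq> {i, i + 1}"
    by (auto simp: doubleton_eq_iff inverse_apply_eq_iff)
  show ?thesis
    using desc_simple_refl_mult[OF False] desc_simple_refl_mult[OF inv]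
    by (auto simp: dem_right_def L_eq mult.assoc)
qed

lemma L_fold_T: "fold dem_right a (dem_left j u) = dem_left j (fold dem_right a u)"
  by (induction a arbitrary: u) (simp_all add: T_L_commute)

lemma fold_L_inverse: "fold dem_left a (inverse u) = inverse (fold dem_right a u)"
  by (induction a arbitrary: u) (simp_all add: dem_left_def)

lemma fold_T_additive:
  "len (u * word_perm a) = len u + length a \<Longrightarrow> fold dem_right a u = u * word_perm a"
proof (induction a rule: rev_induct)
  case (snoc i a)
  have len: "len (u * word_perm a) = len u + length a"
  proof -
    have "len (u * word_perm a) \<le> len u + length a"
    proof (induction a rule: rev_induct)
      case (snoc j b)
      then show ?case using len_mult_le[of "u * word_perm b" j] by (simp add: word_perm_snoc mult.assoc)
    qed simp
    then show ?thesis
      using snoc.prems len_mult_le[of "u * word_perm a" i] by (simp add: word_perm_snoc mult.assoc)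
  qed
  have "\<not> desc i (u * word_perm a)"
    using len snoc.prems card_inversions_desc[of i "u * word_perm a"]
    by (auto simp: word_perm_snoc mult.assoc len_eq)
  then show ?case using snoc.IH[OF len] by (simp add: dem_right_def word_perm_snoc mult.assoc)
qed simp

lemma fold_T_reduced: "a \<in> reduced_words w \<Longrightarrow> fold dem_right a 1 = w"
  using fold_T_additive[of 1 a] by (auto simp: reduced_words_def)

lemma len_T: "len (dem_right i u) \<le> Suc (len u)"
  by (simp add: dem_right_def len_mult_le)

lemma len_fold_T: "len (fold dem_right a u) \<le> len u + length a"
proof (induction a arbitrary: u)
  case (Cons i a)
  then show ?case using len_T[of i u] by (simp add: order_trans[OF Cons])
qed simp

lemma fold_T_len:
  "len (fold dem_right a 1) = length a \<Longrightarrow> a \<in> reduced_words (fold dem_right a 1)"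
proof (induction a rule: rev_induct)
  case Nil
  then show ?case by (simp add: reduced_words_def)
next
  case (snoc i a)
  let ?w = "fold dem_right a 1"
  have *: "len (dem_right i ?w) = Suc (length a)" using snoc.prems by simp
  have "len ?w \<le> length a" using len_fold_T[of a 1] by simp
  then have "len ?w = length a" "\<not> desc i ?w"
    using * len_T[of i ?w] by (auto simp: dem_right_def split: if_splits)
  then have "dem_right i ?w = ?w * simple_refl i" "word_perm a = ?w"
    using snoc.IH by (auto simp: dem_right_def[of i] reduced_words_def)
  then show ?case using * by (simp add: reduced_words_def word_perm_snoc)
qed

text \<open>Since the right operators commute with the left operators, a product of right operators is
  determined by its value at 1.\<close>

lemma fold_T_cong:
  assumes "fold dem_right a 1 = fold dem_right b 1"
  shows "fold dem_right a u = fold dem_right b u"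
proof -
  obtain c where "c \<in> reduced_words (inverse u)" using reduced_words_ne by blast
  then have c: "u = fold dem_left c 1" using fold_L_inverse[of c 1] by (simp add: fold_T_reduced)
  have "fold dem_right a (fold dem_left c x) = fold dem_left c (fold dem_right a x)" for a x
    by (induction c arbitrary: x) (simp_all add: L_fold_T)
  then show ?thesis using assms by (simp add: c)
qed

definition demazure_product :: "int perm \<Rightarrow> int perm \<Rightarrow> int perm" where
  "demazure_product u v = fold dem_right (SOME a. a \<in> reduced_words v) u"

lemma demazure_product_eq: "fold dem_right a 1 = v \<Longrightarrow> demazure_product u v = fold dem_right a u"
  unfolding demazure_product_def
  using fold_T_cong fold_T_reduced[OF someI_ex[OF reduced_words_ne[of v]]] by metis

lemma is_demazure_product: "is_demazure_product demazure_product"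
  unfolding is_demazure_product_def
proof (intro conjI allI impI)
  fix u v w
  obtain a b where ab: "a \<in> reduced_words v" "b \<in> reduced_words w" using reduced_words_ne by metis
  then have "demazure_product v w = fold dem_right b v" using demazure_product_eq fold_T_reduced by blast
  also have "\<dots> = fold dem_right (a @ b) 1" using ab by (simp add: fold_T_reduced)
  finally have "demazure_product u (demazure_product v w) = fold dem_right (a @ b) u"
    using demazure_product_eq[of "a @ b" "fold dem_right (a @ b) 1" u] by simp
  moreover have "demazure_product (demazure_product u v) w = fold dem_right b (fold dem_right a u)"
    using ab demazure_product_eq fold_T_reduced by metis
  ultimately show "demazure_product (demazure_product u v) w = demazure_product u (demazure_product v w)"
    by simp
next
  fix u v assume *: "len (u * v) = len u + len v"
  obtain a where a: "a \<in> reduced_words v" using reduced_words_ne by blast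
  then show "demazure_product u v = u * v"
    using * demazure_product_eq[OF fold_T_reduced[OF a]] fold_T_additive[of u a]
    by (simp add: reduced_words_def)
next
  fix i
  have "fold dem_right [i] 1 = simple_refl i" by (simp add: dem_right_def desc_def)
  then show "demazure_product (simple_refl i) (simple_refl i) = simple_refl i"
    using demazure_product_eq[of "[i]" "simple_refl i" "simple_refl i"]
    by (simp add: dem_right_def desc_def apply_simple_refl)
qed

lemma len_simple_refl [simp]: "len (simple_refl i) = 1"
  using len_asc[of i 1] by (simp add: desc_def)

text \<open>By associativity only \<open>p u s_i\<close> matters. At a descent
  \<open>u = x s_i\<close> with lengths adding, so that
  \<open>p u s_i = p x (p s_i s_i) = u\<close>.\<close>

lemma is_demazure_product_unique:
  assumes p: "is_demazure_product p"
  shows "p = demazure_product"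
proof (intro ext)
  fix u v
  have assoc: "p (p u v) w = p u (p v w)"
    and add: "len (u * v) = len u + len v \<Longrightarrow> p u v = u * v"
    and idem: "p (simple_refl i) (simple_refl i) = simple_refl i" for u v w i
    using p by (auto simp: is_demazure_product_def)
  have pT: "p u (simple_refl i) = dem_right i u" for u i
  proof (cases "desc i u")
    case True
    define x where "x = u * simple_refl i"
    have "\<not> desc i x" using True by (simp add: x_def desc_mult_simple_refl)
    then have "p x (simple_refl i) = u" using add[of x "simple_refl i"] len_asc[of i x]
      by (simp add: x_def)
    then have "p u (simple_refl i) = u" using assoc[of x] idem by metis
    then show ?thesis using True by (simp add: dem_right_def)
  next
    case False
    then show ?thesis using add[of u "simple_refl i"] len_asc[of i u] by (simp add: dem_right_def)
  qed
  have "p u (word_perm a) = fold dem_right a u" if "length a = len (word_perm a)" for a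
    using that
  proof (induction a rule: rev_induct)
    case Nil
    then show ?case using add[of u 1] by simp
  next
    case (snoc i a)
    then have "len (word_perm a * simple_refl i) = len (word_perm a) + 1" "len (word_perm a) = length a"
      using len_mult_le[of "word_perm a" i] len_word[of a] by (auto simp: word_perm_snoc)
    then have "word_perm (a @ [i]) = p (word_perm a) (simple_refl i)"
      using add by (simp add: word_perm_snoc)
    then have "p u (word_perm (a @ [i])) = p (p u (word_perm a)) (simple_refl i)"
      by (simp add: assoc)
    then show ?case using snoc.IH \<open>len (word_perm a) = length a\<close> by (simp add: pT)
  qed
  moreover obtain a where "a \<in> reduced_words v" using reduced_words_ne by blast
  ultimately show "p u v = demazure_product u v"
    using demazure_product_eq[OF fold_T_reduced] by (auto simp: reduced_words_def)
qed

lemma demazure_eq: "demazure = demazure_product"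
  unfolding demazure_def using is_demazure_product is_demazure_product_unique
  by (intro the_equality) auto

text \<open>Demazure conjugation by \<open>s_i\<close>: iterated from 1 along a word whose Demazure
  product is \<open>w\<close>, it gives the Demazure product of \<open>inverse w\<close> and
  \<open>w\<close>.\<close>

definition dem_conj :: "int \<Rightarrow> int perm \<Rightarrow> int perm" where
  "dem_conj i y = dem_left i (dem_right i y)"

lemma fold_D_eq: "fold dem_conj a y = fold dem_right a (fold dem_left a y)"
proof (induction a arbitrary: y)
  case (Cons i a)
  have "dem_right i (fold dem_left a (dem_left i y)) = fold dem_left a (dem_right i (dem_left i y))"
  proof -
    have "dem_right i (fold dem_left b x) = fold dem_left b (dem_right i x)" for b x
      by (induction b arbitrary: x) (simp_all add: T_L_commute)
    then show ?thesis by simp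
  qed
  then show ?case using Cons[of "dem_left i (dem_right i y)"] by (simp add: dem_conj_def T_L_commute)
qed simp

lemma demazure_conj: "inverse (fold dem_right a 1) \<circ>\<^sub>D fold dem_right a 1 = fold dem_conj a 1"
  using fold_L_inverse[of a 1] by (simp add: demazure_eq demazure_product_eq[OF refl] fold_D_eq)

section \<open>Involution words\<close>

lemma involutionD: "y \<in> involutions \<Longrightarrow> y \<langle>$\<rangle> (y \<langle>$\<rangle> x) = x"
  by (simp add: involutions_def flip: apply_mult)

lemma involutionI: "(\<And>x. y \<langle>$\<rangle> (y \<langle>$\<rangle> x) = x) \<Longrightarrow> y \<in> involutions"
  by (auto simp: involutions_def apply_mult intro!: perm_eqI)

lemma inverse_involution: "y \<in> involutions \<Longrightarrow> inverse y = y"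
  using perm.inverse_unique[of y y] by (simp add: involutions_def)

lemma one_involution [simp]: "1 \<in> involutions"
  by (simp add: involutions_def)

definition fixes_both :: "int \<Rightarrow> int perm \<Rightarrow> bool" where
  "fixes_both i y \<longleftrightarrow> y \<langle>$\<rangle> i = i \<and> y \<langle>$\<rangle> (i + 1) = i + 1"

lemma D_desc: "y \<in> involutions \<Longrightarrow> desc i y \<Longrightarrow> dem_conj i y = y"
  by (simp add: dem_conj_def dem_right_def L_eq inverse_involution)

text \<open>At an ascent \<open>s_i\<close> commutes with \<open>y\<close> exactly if both points
  are fixed; the second multiplication is then absorbed.\<close>

lemma D_asc:
  assumes y: "y \<in> involutions" and asc: "\<not> desc i y"
  shows "dem_conj i y = (if fixes_both i y then y * simple_refl i else simple_refl i * y * simple_refl i)"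
proof (cases "fixes_both i y")
  case True
  then have "desc i (simple_refl i * y)"
    by (simp add: desc_def fixes_both_def apply_mult apply_simple_refl)
  then show ?thesis using assms True by (simp add: dem_conj_def dem_right_def L_eq inverse_involution)
next
  case False
  then have "{y \<langle>$\<rangle> i, y \<langle>$\<rangle> (i + 1)} \<noteq> {i, i + 1}"
    using asc by (auto simp: fixes_both_def desc_def doubleton_eq_iff)
  from desc_simple_refl_mult[OF this] asc False show ?thesis
    using y by (simp add: dem_conj_def dem_right_def L_eq inverse_involution mult.assoc)
qed

text \<open>Removes the last letter of an involution word.\<close>

definition rem :: "int \<Rightarrow> int perm \<Rightarrow> int perm" where
  "rem i y = (if y \<langle>$\<rangle> i = i + 1 then y * simple_refl i else simple_refl i * y * simple_refl i)"

text \<open>Four times the length of an involution word. Proper conjugation at an ascent adds 2 to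
  the length; in the commuting case the length grows by 1 and two more points move. The sum grows by
  4 either way.\<close>

definition rank :: "int perm \<Rightarrow> nat" where
  "rank y = 2 * len y + card (affected y)"

lemma involution_conj:
  "y \<in> involutions \<Longrightarrow> simple_refl i * y * simple_refl i \<in> involutions"
  by (rule involutionI) (simp add: apply_mult involutionD)

lemma simple_refl_mult_conj_asc:
  assumes y: "y \<in> involutions" and asc: "\<not> desc i y" and "\<not> fixes_both i y"
  shows "\<not> desc i (simple_refl i * y)" "len (simple_refl i * y) = Suc (len y)"
    "len (simple_refl i * y * simple_refl i) = len y + 2"
proof -
  have "{y \<langle>$\<rangle> i, y \<langle>$\<rangle> (i + 1)} \<noteq> {i, i + 1}"
    using assms by (auto simp: fixes_both_def desc_def doubleton_eq_iff)
  then show *: "\<not> desc i (simple_refl i * y)"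
    using desc_simple_refl_mult asc by blast
  have "len (inverse (simple_refl i * y)) = Suc (len y)"
    using len_asc[OF asc] y by (simp add: inverse_involution)
  then show "len (simple_refl i * y) = Suc (len y)" by (simp only: len_inverse)
  then show "len (simple_refl i * y * simple_refl i) = len y + 2"
    using len_asc[OF *] by simp
qed

lemma D_asc_props:
  assumes y: "y \<in> involutions" and asc: "\<not> desc i y"
  shows "dem_conj i y \<in> involutions" "desc i (dem_conj i y)" "rem i (dem_conj i y) = y" "rank (dem_conj i y) = rank y + 4"
proof -
  let ?s = "simple_refl i"
  have "dem_conj i y \<in> involutions \<and> desc i (dem_conj i y) \<and> rem i (dem_conj i y) = y \<and> rank (dem_conj i y) = rank y + 4"
  proof (cases "fixes_both i y")
    case True
    then have dem_conj: "dem_conj i y = y * ?s" by (simp add: D_asc y asc)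
    have f: "y \<langle>$\<rangle> i = i" "y \<langle>$\<rangle> (i + 1) = i + 1" using True by (auto simp: fixes_both_def)
    have "y \<langle>$\<rangle> (?s \<langle>$\<rangle> (y \<langle>$\<rangle> (?s \<langle>$\<rangle> x))) = x" for x
    proof -
      have "y \<langle>$\<rangle> x \<noteq> i" "y \<langle>$\<rangle> x \<noteq> i + 1" if "x \<noteq> i" "x \<noteq> i + 1"
        using that f apply_inj[of y x i] apply_inj[of y x "i + 1"] by auto
      then show ?thesis using f involutionD[OF y] by (auto simp: apply_simple_refl)
    qed
    then have "y * ?s \<in> involutions" by (intro involutionI) (simp add: apply_mult)
    moreover have "affected (y * ?s) = insert i (insert (i + 1) (affected y))"
    proof (rule set_eqI)
      fix x
      show "x \<in> affected (y * ?s) \<longleftrightarrow> x \<in> insert i (insert (i + 1) (affected y))"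
        using f by (cases "x = i \<or> x = i + 1") (auto simp: in_affected apply_mult apply_simple_refl)
    qed
    then have "card (affected (y * ?s)) = card (affected y) + 2"
      using f by (simp add: in_affected)
    ultimately show ?thesis using f asc
      by (simp add: dem_conj rank_def len_asc desc_mult_simple_refl rem_def apply_mult apply_simple_refl)
  next
    case False
    then have dem_conj: "dem_conj i y = ?s * y * ?s" by (simp add: D_asc y asc)
    have "affected (?s * y * ?s) = apply ?s ` affected y"
    proof (intro set_eqI iffI)
      fix x assume "x \<in> affected (?s * y * ?s)"
      then have "?s \<langle>$\<rangle> x \<in> affected y" by (auto simp: in_affected apply_mult)
      then show "x \<in> apply ?s ` affected y" by (metis imageI simple_refl_twice)
    qed (auto simp: in_affected apply_mult apply_inj)
    then have "card (affected (?s * y * ?s)) = card (affected y)"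
      by (simp add: card_image inj_on_def apply_inj)
    moreover have "desc i (?s * y * ?s)"
      using simple_refl_mult_conj_asc(1)[OF y asc False] by (simp add: desc_mult_simple_refl)
    moreover have "(?s * y * ?s) \<langle>$\<rangle> i \<noteq> i + 1"
    proof
      assume "(?s * y * ?s) \<langle>$\<rangle> i = i + 1"
      then have "y \<langle>$\<rangle> (i + 1) = i" by (simp add: apply_mult apply_simple_refl split: if_splits)
      then show False using asc involutionD[OF y, of "i + 1"] by (simp add: desc_def)
    qed
    then have "rem i (?s * y * ?s) = y" by (simp add: rem_def mult.assoc)
    ultimately show ?thesis using simple_refl_mult_conj_asc[OF y asc False] y
      by (simp add: dem_conj rank_def involution_conj)
  qed
  then show "dem_conj i y \<in> involutions" "desc i (dem_conj i y)" "rem i (dem_conj i y) = y" "rank (dem_conj i y) = rank y + 4"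
    by blast+
qed

lemma rem_props:
  assumes y: "y \<in> involutions" and desc: "desc i y"
  shows "rem i y \<in> involutions" "\<not> desc i (rem i y)" "dem_conj i (rem i y) = y"
proof -
  let ?s = "simple_refl i"
  have "rem i y \<in> involutions \<and> \<not> desc i (rem i y) \<and> dem_conj i (rem i y) = y"
  proof (cases "y \<langle>$\<rangle> i = i + 1")
    case True
    then have f: "y \<langle>$\<rangle> (i + 1) = i" using involutionD[OF y, of i] by simp
    have inv: "y * ?s \<in> involutions"
    proof (rule involutionI)
      fix x
      have "y \<langle>$\<rangle> x \<noteq> i" "y \<langle>$\<rangle> x \<noteq> i + 1" if "x \<noteq> i" "x \<noteq> i + 1"
        using that f True apply_inj[of y x i] apply_inj[of y x "i + 1"] by auto
      then show "(y * ?s) \<langle>$\<rangle> ((y * ?s) \<langle>$\<rangle> x) = x"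
        using f True involutionD[OF y] by (auto simp: apply_mult apply_simple_refl)
    qed
    moreover have "\<not> desc i (y * ?s)" using desc by (simp add: desc_mult_simple_refl)
    moreover have "fixes_both i (y * ?s)"
      using f True by (simp add: fixes_both_def apply_mult apply_simple_refl)
    ultimately show ?thesis using True by (simp add: rem_def D_asc)
  next
    case False
    have ne: "{y \<langle>$\<rangle> i, y \<langle>$\<rangle> (i + 1)} \<noteq> {i, i + 1}"
      using False desc by (auto simp: desc_def doubleton_eq_iff)
    then have asc: "\<not> desc i (?s * y * ?s)"
      using desc desc_simple_refl_mult by (auto simp: desc_mult_simple_refl)
    have "\<not> fixes_both i (?s * y * ?s)"
    proof
      assume "fixes_both i (?s * y * ?s)"
      then have "y \<langle>$\<rangle> i = i" "y \<langle>$\<rangle> (i + 1) = i + 1"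
        by (auto simp: fixes_both_def apply_mult apply_simple_refl split: if_splits)
      then show False using desc by (simp add: desc_def)
    qed
    then have "dem_conj i (?s * y * ?s) = ?s * (?s * y * ?s) * ?s"
      using asc involution_conj[OF y] by (simp add: D_asc)
    also have "\<dots> = y" by (simp add: mult.assoc)
    finally show ?thesis using False asc involution_conj[OF y] by (simp add: rem_def)
  qed
  then show "rem i y \<in> involutions" "\<not> desc i (rem i y)" "dem_conj i (rem i y) = y" by blast+
qed

lemma rank_rem: "y \<in> involutions \<Longrightarrow> desc i y \<Longrightarrow> rank y = rank (rem i y) + 4"
  using D_asc_props(4)[OF rem_props(1,2)] rem_props(3) by simp

lemma D_involution: "y \<in> involutions \<Longrightarrow> dem_conj i y \<in> involutions"
  by (cases "desc i y") (simp_all add: D_desc D_asc_props)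

lemma rank_D: "y \<in> involutions \<Longrightarrow> rank (dem_conj i y) = (if desc i y then rank y else rank y + 4)"
  by (cases "desc i y") (simp_all add: D_desc D_asc_props)

lemma fold_D_involution: "y \<in> involutions \<Longrightarrow> fold dem_conj a y \<in> involutions"
  by (induction a arbitrary: y) (simp_all add: D_involution)

lemma rank_fold_D: "y \<in> involutions \<Longrightarrow> rank (fold dem_conj a y) \<le> rank y + 4 * length a"
proof (induction a arbitrary: y)
  case (Cons i a)
  then show ?case using Cons.IH[OF D_involution[OF Cons.prems, of i]] rank_D[OF Cons.prems, of i]
    by (simp split: if_splits)
qed simp

text \<open>Precomposition with the removal of a last letter \<open>i\<close>. The value 0 off the
  involutions lets the operator relations hold on all permutations.\<close>

definition inv_op :: "int \<Rightarrow> (int perm \<Rightarrow> int) \<Rightarrow> int perm \<Rightarrow> int" where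
  "inv_op i g y = (if y \<in> involutions \<and> desc i y then g (rem i y) else 0)"

lemma lin_inv_op: "lin (inv_op i)"
  by (auto simp: lin_def inv_op_def)

text \<open>A rank that grows by 4 with every letter means that every letter is an ascent, so that
  the removals retrace the word.\<close>

lemma inv_op_word1:
  assumes "z \<in> involutions" "rank (fold dem_conj (rev a) z) = rank z + 4 * length a"
  shows "foldr inv_op a g (fold dem_conj (rev a) z) = g z"
  using assms(2)
proof (induction a)
  case (Cons i a)
  let ?y = "fold dem_conj (rev a) z"
  have y: "?y \<in> involutions" by (rule fold_D_involution) fact
  have "rank ?y \<le> rank z + 4 * length a" using rank_fold_D[OF assms(1), of "rev a"] by simp
  then have "\<not> desc i ?y" "rank ?y = rank z + 4 * length a"
    using Cons.prems rank_D[OF y, of i] by (auto split: if_splits)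
  then show ?case using Cons.IH D_asc_props[OF y, of i] by (simp add: inv_op_def)
qed simp

lemma inv_op_word2:
  assumes "foldr inv_op a g y \<noteq> 0" "a \<noteq> []"
  shows "y \<in> involutions \<and> (\<exists>z\<in>involutions. y = fold dem_conj (rev a) z \<and> rank y = rank z + 4 * length a)"
  using assms
proof (induction a arbitrary: y)
  case (Cons i a)
  then have y: "y \<in> involutions" "desc i y" and 0: "foldr inv_op a g (rem i y) \<noteq> 0"
    by (auto simp: inv_op_def[of i] split: if_splits)
  have "\<exists>z\<in>involutions. rem i y = fold dem_conj (rev a) z \<and> rank (rem i y) = rank z + 4 * length a"
    using Cons.IH[OF 0] rem_props(1)[OF y] by (cases "a = []") auto
  then show ?case using y rem_props(3)[OF y] rank_rem[OF y] by auto
qed simp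

text \<open>Transfers relations from Demazure conjugation to the removal operators: equal length and
  equal effect make both words strict at the same places.\<close>

lemma inv_op_word_cong:
  assumes "\<And>z. fold dem_conj (rev a) z = fold dem_conj (rev b) z" "length a = length b" "a \<noteq> []"
  shows "foldr inv_op a g = foldr inv_op b g"
proof
  fix y
  have *: "foldr inv_op a g y = foldr inv_op b g y"
    if ab: "\<And>z. fold dem_conj (rev a) z = fold dem_conj (rev b) z" "length a = length b" "a \<noteq> []"
      "foldr inv_op a g y \<noteq> 0" for a b
  proof -
    obtain z where "z \<in> involutions" "y = fold dem_conj (rev a) z" "rank y = rank z + 4 * length a"
      using inv_op_word2 ab(3,4) by blast
    then show ?thesis using inv_op_word1[of z a g] inv_op_word1[of z b g] ab(1,2) by simp
  qed
  have "b \<noteq> []" using assms by auto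
  then show "foldr inv_op a g y = foldr inv_op b g y"
    using *[of a b] *[of b a] assms by (cases "foldr inv_op a g y = 0") auto
qed

lemma fold_D_cong:
  assumes "fold dem_right a 1 = fold dem_right b 1"
  shows "fold dem_conj a z = fold dem_conj b z"
proof -
  have "fold dem_left a u = fold dem_left b u" for u
    using fold_L_inverse[of a "inverse u"] fold_L_inverse[of b "inverse u"] fold_T_cong[OF assms] by simp
  then show ?thesis by (simp add: fold_D_eq fold_T_cong[OF assms])
qed

lemma T_braid: "fold dem_right [i, i + 1, i] 1 = fold dem_right [i + 1, i, i + 1] 1"
proof -
  have 1: "fold dem_right [i, i + 1, i] 1 = simple_refl i * simple_refl (i + 1) * simple_refl i"
    by (simp add: dem_right_def desc_def apply_mult apply_simple_refl)
  have 2: "fold dem_right [i + 1, i, i + 1] 1 = simple_refl (i + 1) * simple_refl i * simple_refl (i + 1)"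
    by (simp add: dem_right_def desc_def apply_mult apply_simple_refl)
  show ?thesis unfolding 1 2
    by (rule perm_eqI) (simp add: apply_mult apply_simple_refl)
qed

lemma T_far:
  assumes "i + 1 < j"
  shows "fold dem_right [i, j] 1 = fold dem_right [j, i] 1"
proof -
  have 1: "fold dem_right [i, j] 1 = simple_refl i * simple_refl j"
    using assms by (simp add: dem_right_def desc_def apply_mult apply_simple_refl)
  have 2: "fold dem_right [j, i] 1 = simple_refl j * simple_refl i"
    using assms by (simp add: dem_right_def desc_def apply_mult apply_simple_refl)
  show ?thesis unfolding 1 2
    by (rule perm_eqI) (use assms in \<open>simp add: apply_mult apply_simple_refl\<close>)
qed

lemma inv_op_square: "inv_op i (inv_op i g) = (\<lambda>y. 0)"
  using rem_props(2) by (auto simp: inv_op_def)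

lemma inv_op_far: "i + 1 < j \<Longrightarrow> inv_op i (inv_op j g) = inv_op j (inv_op i g)"
  using inv_op_word_cong[of "[i, j]" "[j, i]" g] fold_D_cong[OF T_far[of i j]] by simp

lemma inv_op_braid: "inv_op i (inv_op (i + 1) (inv_op i g)) = inv_op (i + 1) (inv_op i (inv_op (i + 1) g))"
  using inv_op_word_cong[of "[i, i + 1, i]" "[i + 1, i, i + 1]" g] fold_D_cong[OF T_braid[of i]] by simp

lemma nil_ops_inv_op: "nil_ops (\<lambda>n. inv_op (lo + int n))"
proof
  fix i g
  show "inv_op (lo + int i) (inv_op (lo + int (Suc i)) (inv_op (lo + int i) g)) =
    inv_op (lo + int (Suc i)) (inv_op (lo + int i) (inv_op (lo + int (Suc i)) g))"
    using inv_op_braid[of "lo + int i" g] by (simp add: add_ac)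
next
  fix i j :: nat and g
  assume "Suc i < j"
  then show "inv_op (lo + int i) (inv_op (lo + int j) g) = inv_op (lo + int j) (inv_op (lo + int i) g)"
    by (intro inv_op_far) simp
qed (simp_all add: lin_inv_op inv_op_square)

section \<open>Behaviour at the identity involution\<close>

definition delta :: "'s \<Rightarrow> 's \<Rightarrow> int" where
  "delta x y = (if y = x then 1 else 0)"

lemma inv_op_word_delta:
  assumes "a \<noteq> []"
  shows "foldr inv_op a (delta 1) y =
    (if y = fold dem_conj (rev a) 1 \<and> rank y = 4 * length a then 1 else 0)"
proof (cases "foldr inv_op a (delta 1) y = 0")
  case True
  then show ?thesis using inv_op_word1[of 1 a "delta 1"] by (auto simp: rank_def delta_def)
next
  case False
  then obtain z where z: "z \<in> involutions" "y = fold dem_conj (rev a) z" "rank y = rank z + 4 * length a"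
    using inv_op_word2 assms by blast
  then have "foldr inv_op a (delta 1) y = delta 1 z" using inv_op_word1[of z a] by simp
  then show ?thesis using z False by (auto simp: delta_def rank_def split: if_splits)
qed

text \<open>Conjugating 1 by \<open>i\<close> and then by \<open>j\<close> gives the Demazure
  product of \<open>s_j, s_i, s_j\<close>; for adjacent letters the braid relation makes it
  symmetric in \<open>i\<close> and \<open>j\<close>.\<close>

lemma inv_op_delta_commute: "inv_op i (inv_op j (delta 1)) = inv_op j (inv_op i (delta 1))"
proof -
  have *: "inv_op i (inv_op (i + 1) (delta 1)) = inv_op (i + 1) (inv_op i (delta 1))" for i
  proof -
    have "dem_conj i (dem_conj (i + 1) 1) = dem_conj (i + 1) (dem_conj i 1)"
    proof -
      have T1: "dem_right i 1 = simple_refl i" and L1: "dem_left i 1 = simple_refl i" for i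
        by (simp_all add: dem_right_def L_eq desc_def)
      have DD: "dem_conj j (dem_conj i 1) = fold dem_right [j, i, j] 1" for i j
      proof -
        have "dem_conj i 1 = dem_right i 1" by (simp add: T1 D_asc desc_def fixes_both_def)
        then have "dem_conj j (dem_conj i 1) = dem_left j (dem_right j (dem_right i 1))" by (simp add: dem_conj_def)
        also have "\<dots> = dem_right j (dem_right i (dem_left j 1))" by (simp only: T_L_commute)
        finally show ?thesis by (simp add: T1 L1)
      qed
      show ?thesis using T_braid[of i] unfolding DD by simp
    qed
    then show ?thesis
      using inv_op_word_delta[of "[i, i + 1]"] inv_op_word_delta[of "[i + 1, i]"] by (auto simp: fun_eq_iff)
  qed
  consider "i = j" | "j = i + 1" | "i = j + 1" | "i + 1 < j" | "j + 1 < i" by linarith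
  then show ?thesis
  proof cases
    case 4
    then show ?thesis by (rule inv_op_far)
  next
    case 5
    then show ?thesis by (rule inv_op_far[symmetric])
  qed (simp_all add: *)
qed

text \<open>After reversing the tail by induction, generator \<open>a\<close> commutes with
  everything beyond \<open>Suc a\<close>, and next to \<open>g\<close> it may be exchanged with
  generator \<open>Suc a\<close>.\<close>

lemma (in nil_ops) upt_boundary:
  assumes "\<And>i j. u i (u j g) = u j (u i g)"
  shows "elems u t [a..<b] g = elems u t (rev [a..<b]) g"
proof (induction "b - a" arbitrary: a)
  case (Suc n)
  have IH: "elems u t [Suc a..<b] g = elems u t (rev [Suc a..<b]) g"
    using Suc.hyps by auto
  have a: "[a..<b] = a # [Suc a..<b]" using Suc.hyps(2) by (simp add: upt_conv_Cons)
  show ?case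
  proof (cases "Suc a < b")
    case True
    let ?E = "elems u t (rev [Suc (Suc a)..<b])"
    have b: "[Suc a..<b] = Suc a # [Suc (Suc a)..<b]" using True by (simp add: upt_conv_Cons)
    have "elem u t a (elem u t (Suc a) g) = elem u t (Suc a) (elem u t a g)"
      by (simp add: elem_def linD[OF lin] assms[of a "Suc a"] algebra_simps)
    moreover have "elem u t a (?E (elem u t (Suc a) g)) = ?E (elem u t a (elem u t (Suc a) g))"
      by (rule elem_elems_commute) (auto intro: lin far)
    moreover have "elems u t [a..<b] g = elem u t a (elems u t (rev [Suc a..<b]) g)"
      by (simp add: a IH)
    ultimately show ?thesis by (simp add: a b)
  qed (simp add: a)
qed simp

lemma elems_map: "elems u t (map f is) g = elems (\<lambda>k. u (f k)) t is g"
  by (induction "is") (auto simp: elem_def)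

definition ivl :: "int \<Rightarrow> nat \<Rightarrow> int list" where
  "ivl lo n = map (\<lambda>k. lo + int k) [0..<n]"

lemma set_ivl: "set (ivl lo n) = {lo..<lo + int n}"
proof -
  have "x \<in> (\<lambda>k. lo + int k) ` {0..<n}" if "lo \<le> x" "x < lo + int n" for x
    using that by (intro image_eqI[of _ _ "nat (x - lo)"]) auto
  then show ?thesis by (auto simp: ivl_def)
qed

lemma ivl_commute:
  "elems inv_op s (ivl lo n) (elems inv_op t (ivl lo n) g) = elems inv_op t (ivl lo n) (elems inv_op s (ivl lo n) g)"
  unfolding ivl_def elems_map by (rule nil_ops.upt_commute[OF nil_ops_inv_op])

lemma ivl_cancel: "elems inv_op (- t) (ivl lo n) (elems inv_op t (ivl lo n) (delta 1)) = delta 1"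
proof -
  interpret nil_ops "\<lambda>n. inv_op (lo + int n)" by (rule nil_ops_inv_op)
  have "elems inv_op t (ivl lo n) (delta 1) = elems (\<lambda>n. inv_op (lo + int n)) t (rev [0..<n]) (delta 1)"
    unfolding ivl_def elems_map by (rule upt_boundary) (rule inv_op_delta_commute)
  then show ?thesis using upt_rev_inverse[of "- t" 0 n "delta 1"] by (simp add: ivl_def elems_map)
qed

section \<open>Coefficients as sums over words\<close>

definition inc_words :: "int set \<Rightarrow> nat \<Rightarrow> int list set" where
  "inc_words A k = {b. sorted_wrt (<) b \<and> set b \<subseteq> A \<and> length b = k}"

lemma finite_inc_words: "finite A \<Longrightarrow> finite (inc_words A k)"
  by (rule finite_subset[OF _ finite_lists_length_eq[of A k]]) (auto simp: inc_words_def)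

lemma foldr_lin: "(\<And>i. lin (u i)) \<Longrightarrow> lin (foldr u b)"
proof (induction b)
  case (Cons i b)
  then have "lin (u i)" "lin (foldr u b)" by auto
  then show ?case unfolding lin_def by simp
qed (simp add: lin_def)

lemma inc_words_0 [simp]: "inc_words A 0 = {[]}"
  by (auto simp: inc_words_def)

lemma inc_words_insert:
  assumes "\<And>x. x \<in> A \<Longrightarrow> i < x"
  shows "inc_words (insert i A) (Suc k) = inc_words A (Suc k) \<union> (#) i ` inc_words A k"
proof (intro set_eqI iffI)
  fix b assume b: "b \<in> inc_words (insert i A) (Suc k)"
  show "b \<in> inc_words A (Suc k) \<union> (#) i ` inc_words A k"
  proof (cases "i \<in> set b")
    case False
    then show ?thesis using b by (auto simp: inc_words_def)
  next
    case True
    obtain j c where c: "b = j # c" using b by (cases b) (auto simp: inc_words_def)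
    have "j = i" using True b c assms[of j] by (force simp: inc_words_def)
    then show ?thesis using b c by (force simp: inc_words_def)
  qed
qed (use assms in \<open>auto simp: inc_words_def subset_iff\<close>)

text \<open>Choosing the summand \<open>t u_i\<close> in \<open>k\<close> of the factors spells a
  strictly increasing word.\<close>

lemma elems_coeff_inc_words:
  assumes lin: "\<And>i. lin (u i)" and "sorted_wrt (<) is"
  shows "elems_coeff u is k g y = (\<Sum>b\<in>inc_words (set is) k. foldr u b g y)"
  using assms(2)
proof (induction "is" arbitrary: k y)
  case Nil
  have "inc_words {} (Suc k) = {}" for k by (auto simp: inc_words_def)
  then show ?case by (cases k) auto
next
  case (Cons i "is")
  show ?case
  proof (cases k)
    case (Suc j)
    let ?A = "set is"
    have i: "\<And>x. x \<in> ?A \<Longrightarrow> i < x" and IH: "elems_coeff u is k g y = (\<Sum>b\<in>inc_words ?A k. foldr u b g y)" for k y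
      using Cons by auto
    have fin: "finite (inc_words ?A k)" for k by (simp add: finite_inc_words)
    have "u i (elems_coeff u is j g) y = u i (\<lambda>y. \<Sum>b\<in>inc_words ?A j. 1 * foldr u b g y) y"
      by (simp add: IH[abs_def])
    also have "\<dots> = (\<Sum>b\<in>inc_words ?A j. foldr u (i # b) g y)"
      by (subst lin_sum[OF lin fin]) simp
    also have "\<dots> = (\<Sum>b\<in>(#) i ` inc_words ?A j. foldr u b g y)"
      by (subst sum.reindex) auto
    finally have "elems_coeff u (i # is) k g y =
        (\<Sum>b\<in>inc_words ?A (Suc j). foldr u b g y) + (\<Sum>b\<in>(#) i ` inc_words ?A j. foldr u b g y)"
      by (simp add: Suc IH)
    also have "\<dots> = (\<Sum>b\<in>inc_words (set (i # is)) k. foldr u b g y)"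
    proof (subst sum.union_disjoint[symmetric])
      show "inc_words ?A (Suc j) \<inter> (#) i ` inc_words ?A j = {}"
        using i by (force simp: inc_words_def)
    qed (use i in \<open>auto simp: fin Suc inc_words_insert\<close>)
    finally show ?thesis .
  qed simp
qed

definition blocks :: "int set \<Rightarrow> nat list \<Rightarrow> int list list set" where
  "blocks A l = {bs. list_all2 (\<lambda>b k. b \<in> inc_words A k) bs l}"

lemma blocks_Nil [simp]: "blocks A [] = {[]}"
  by (auto simp: blocks_def)

lemma blocks_Cons: "blocks A (k # l) = (\<lambda>(b, bs). b # bs) ` (inc_words A k \<times> blocks A l)"
  by (auto simp: blocks_def list_all2_Cons2)

lemma finite_blocks: "finite A \<Longrightarrow> finite (blocks A l)"
  by (induction l) (simp_all add: blocks_Cons finite_inc_words)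

lemma iter_coeff_blocks:
  assumes lin: "\<And>i. lin (u i)" and s: "sorted_wrt (<) is"
  shows "iter_coeff u is g l y = (\<Sum>bs\<in>blocks (set is) l. foldr u (concat bs) g y)"
proof (induction l arbitrary: y)
  case (Cons k l)
  let ?B = "inc_words (set is) k" and ?Bs = "blocks (set is) l"
  have "iter_coeff u is g (k # l) y = (\<Sum>b\<in>?B. foldr u b (\<lambda>y. \<Sum>bs\<in>?Bs. 1 * foldr u (concat bs) g y) y)"
    by (simp add: elems_coeff_inc_words[of u, OF lin s] Cons[abs_def])
  also have "\<dots> = (\<Sum>b\<in>?B. \<Sum>bs\<in>?Bs. foldr u (concat (b # bs)) g y)"
    by (subst lin_sum[OF foldr_lin[OF lin] finite_blocks]) simp_all
  also have "\<dots> = (\<Sum>bs\<in>blocks (set is) (k # l). foldr u (concat bs) g y)"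
    unfolding sum.cartesian_product blocks_Cons
    by (subst sum.reindex) (auto simp: inj_on_def intro: sum.cong)
  finally show ?case .
qed simp

text \<open>A word of length \<open>l\<close> reaches rank at most \<open>4 * l\<close>, so the
  second condition selects the shortest words for \<open>y\<close>.\<close>

definition involution_words :: "int perm \<Rightarrow> int list set" where
  "involution_words y = {a. fold dem_conj a 1 = y \<and> rank y = 4 * length a}"

lemma involution_words_iff: "foldr inv_op b (delta 1) y = (if rev b \<in> involution_words y then 1 else 0)"
  using inv_op_word_delta[of b y]
  by (cases "b = []") (auto simp: involution_words_def delta_def rank_def)

lemma involution_words_Cons:
  assumes "rev (i # b) \<in> involution_words y"
  shows "y \<in> involutions" "desc i y" "rev b \<in> involution_words (rem i y)"
proof -
  have "foldr inv_op (i # b) (delta 1) y \<noteq> 0" using assms by (simp only: involution_words_iff) simp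
  then show "y \<in> involutions" "desc i y" "rev b \<in> involution_words (rem i y)"
    by (auto simp: inv_op_def[of i] involution_words_iff split: if_splits)
qed

text \<open>A letter just removed is no longer a descent. Hence letters sharing an index in a
  compatible sequence decrease strictly, not just weakly.\<close>

lemma successively_involution_words: "rev b \<in> involution_words y \<Longrightarrow> successively (\<noteq>) b"
proof (induction b arbitrary: y)
  case (Cons i b)
  from involution_words_Cons[OF Cons.prems] have *: "desc i y" "y \<in> involutions"
    "rev b \<in> involution_words (rem i y)" by auto
  show ?case
  proof (cases b)
    case (Cons j c)
    have "i \<noteq> j" using * rem_props(2)[of y i] involution_words_Cons[of j c "rem i y"] Cons by auto
    then show ?thesis using Cons.IH[OF *(3)] Cons by simp
  qed simp
qed simp

lemma supp_desc:
  fixes lo hi :: int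
  assumes "\<And>x. x < lo \<or> hi < x \<Longrightarrow> y \<langle>$\<rangle> x = x" "desc i y"
  shows "lo \<le> i" "i < hi"
proof -
  have out: "lo \<le> y \<langle>$\<rangle> x \<and> y \<langle>$\<rangle> x \<le> hi" if "lo \<le> x" "x \<le> hi" for x
    using assms(1)[of "y \<langle>$\<rangle> x"] apply_inj[of y "y \<langle>$\<rangle> x" x] that by force
  show "lo \<le> i"
    using assms(1)[of i] assms(1)[of "i + 1"] assms(2) out[of "i + 1"] by (force simp: desc_def)
  show "i < hi"
    using assms(1)[of i] assms(1)[of "i + 1"] assms(2) out[of i] by (force simp: desc_def)
qed

lemma supp_rem:
  fixes lo hi :: int
  assumes "\<And>x. x < lo \<or> hi < x \<Longrightarrow> y \<langle>$\<rangle> x = x" "lo \<le> i" "i < hi" "x < lo \<or> hi < x"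
  shows "rem i y \<langle>$\<rangle> x = x"
  using assms by (auto simp: rem_def apply_mult apply_simple_refl)

lemma involution_words_letters:
  fixes lo hi :: int
  assumes "\<And>x. x < lo \<or> hi < x \<Longrightarrow> y \<langle>$\<rangle> x = x" "rev b \<in> involution_words y"
  shows "set b \<subseteq> {lo..<hi}"
  using assms
proof (induction b arbitrary: y)
  case (Cons i b)
  note * = involution_words_Cons[OF Cons.prems(2)]
  have i: "lo \<le> i" "i < hi" using supp_desc[of lo hi y i] Cons.prems(1) *(2) by auto
  have "set b \<subseteq> {lo..<hi}"
    by (rule Cons.IH[OF supp_rem[OF Cons.prems(1) i] *(3)])
  then show ?case using i by simp
qed simp

lemma finite_involution_words: "finite (involution_words y)"
proof -
  obtain lo hi where lh: "\<And>x. x < lo \<Longrightarrow> y \<langle>$\<rangle> x = x" "\<And>x. hi < x \<Longrightarrow> y \<langle>$\<rangle> x = x"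
    using affected_bound[of y] by metis
  have "set a \<subseteq> {lo..<hi} \<and> length a = rank y div 4" if "a \<in> involution_words y" for a
    using involution_words_letters[of lo hi y "rev a"] lh that by (auto simp: involution_words_def)
  then have "involution_words y \<subseteq> {a. set a \<subseteq> {lo..<hi} \<and> length a = rank y div 4}" by blast
  then show ?thesis by (rule finite_subset) (rule finite_lists_length_eq, simp)
qed

lemma ex_strict_word: "\<exists>b. fold dem_conj b 1 = fold dem_conj a 1 \<and> rank (fold dem_conj a 1) = 4 * length b"
proof (induction a rule: rev_induct)
  case Nil
  then show ?case by (intro exI[of _ "[]"]) (simp add: rank_def)
next
  case (snoc i a)
  then obtain b where b: "fold dem_conj b 1 = fold dem_conj a 1" "rank (fold dem_conj a 1) = 4 * length b" by blast
  have y: "fold dem_conj a 1 \<in> involutions" by (simp add: fold_D_involution)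
  show ?case
  proof (cases "desc i (fold dem_conj a 1)")
    case True
    then show ?thesis using b y by (intro exI[of _ b]) (simp add: D_desc)
  next
    case False
    then show ?thesis using b y by (intro exI[of _ "b @ [i]"]) (simp add: rank_D)
  qed
qed

text \<open>By \<open>demazure_conj\<close> a reduced word of an atom is a word for \<open>y\<close>
  under conjugation; the rank bounds its length below by \<open>rank y / 4\<close>, and a word
  without redundant letters attains this.\<close>

lemma atom_word_iff:
  "w \<in> atoms y \<and> a \<in> reduced_words w \<longleftrightarrow> a \<in> involution_words y \<and> w = fold dem_right a 1"
proof (intro iffI conjI; elim conjE)
  assume w: "w \<in> atoms y" and a: "a \<in> reduced_words w"
  show wa: "w = fold dem_right a 1" using fold_T_reduced[OF a] by simp
  then have y: "fold dem_conj a 1 = y" using w demazure_conj[of a] by (simp add: atoms_def)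
  obtain b where b: "fold dem_conj b 1 = y" "rank y = 4 * length b" using ex_strict_word[of a] y by auto
  then have "len w \<le> len (fold dem_right b 1)" using w demazure_conj[of b] by (simp add: atoms_def)
  also have "\<dots> \<le> length b" using len_fold_T[of b 1] by simp
  finally have "length a \<le> length b" using a by (simp add: reduced_words_def)
  moreover have "rank y \<le> 4 * length a" using rank_fold_D[of 1 a] y by (simp add: rank_def)
  ultimately show "a \<in> involution_words y" using b y by (simp add: involution_words_def)
next
  assume a: "a \<in> involution_words y" and w: "w = fold dem_right a 1"
  have conj: "inverse w \<circ>\<^sub>D w = y" using a w demazure_conj[of a] by (simp add: involution_words_def)
  have min: "length a \<le> len v" if "inverse v \<circ>\<^sub>D v = y" for v
  proof -
    obtain b where b: "b \<in> reduced_words v" using reduced_words_ne by blast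
    then have "fold dem_conj b 1 = y" using that demazure_conj[of b] by (simp add: fold_T_reduced)
    then have "rank y \<le> 4 * length b" using rank_fold_D[of 1 b] by (simp add: rank_def)
    then show ?thesis using a b by (simp add: involution_words_def reduced_words_def)
  qed
  then have len: "len w = length a" using conj len_fold_T[of a 1] w by (simp add: le_antisym)
  then show "w \<in> atoms y" using conj min by (simp add: atoms_def)
  show "a \<in> reduced_words w" using len w fold_T_len by simp
qed

lemma inv_stanley_eq: "inv_stanley y m = (\<Sum>a\<in>involution_words y. word_fun a m)"
proof -
  have sub: "reduced_words w \<subseteq> involution_words y" if "w \<in> atoms y" for w
    using that atom_word_iff[of w y] by blast
  have "atoms y \<subseteq> (\<lambda>a. fold dem_right a 1) ` involution_words y"
    using reduced_words_ne atom_word_iff[of _ y] by blast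
  then have fin: "finite (atoms y)" by (rule finite_subset) (simp add: finite_involution_words)
  \<comment> \<open>A word determines its permutation, so reduced words of different atoms are
    different.\<close>
  have "(\<Sum>w\<in>atoms y. \<Sum>a\<in>reduced_words w. word_fun a m) = (\<Sum>a\<in>(\<Union>w\<in>atoms y. reduced_words w). word_fun a m)"
  proof (rule sum.UNION_disjoint[symmetric])
    show "\<forall>w\<in>atoms y. finite (reduced_words w)"
      using sub finite_subset[OF _ finite_involution_words] by blast
  qed (use fin in \<open>auto simp: reduced_words_def\<close>)
  also have "(\<Union>w\<in>atoms y. reduced_words w) = involution_words y"
    using atom_word_iff[of _ y] by blast
  finally show ?thesis by (simp add: inv_stanley_def stanley_def)
qed

text \<open>The list \<open>[k\<^sub>N, \<dots>, k\<^sub>1]\<close> encodes the monomial \<open>x\<^sub>1\<^bsup>k\<^sub>1\<^esup> \<cdots> x\<^sub>N\<^bsup>k\<^sub>N\<^esup>\<close>, whose indices in increasing order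
  are \<open>mono_seq [k\<^sub>N, \<dots>, k\<^sub>1]\<close>.\<close>

fun mono_seq :: "nat list \<Rightarrow> nat list" where
  "mono_seq [] = []"
| "mono_seq (k # l) = mono_seq l @ replicate k (Suc (length l))"

lemma mono_seq_set: "x \<in> set (mono_seq l) \<Longrightarrow> 1 \<le> x \<and> x \<le> length l"
  by (induction l) (auto simp: le_Suc_eq)

lemma sorted_mono_seq: "sorted (mono_seq l)"
proof (induction l)
  case (Cons k l)
  then show ?case using mono_seq_set[of _ l] by (auto simp: sorted_append le_Suc_eq)
qed simp

lemma ex_mono_seq:
  assumes "0 \<notin># m"
  shows "\<exists>l. mset (mono_seq l) = m"
proof -
  have "\<exists>l. mset (mono_seq l) = m \<and> length l = N" if "\<forall>x\<in>#m. 1 \<le> x \<and> x \<le> N" for N m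
    using that
  proof (induction N arbitrary: m)
    case 0
    then have "m = {#}" by (cases m) auto
    then show ?case by simp
  next
    case (Suc N)
    obtain l where l: "mset (mono_seq l) = filter_mset (\<lambda>x. x \<noteq> Suc N) m" "length l = N"
      using Suc.IH[of "filter_mset (\<lambda>x. x \<noteq> Suc N) m"] Suc.prems by (force simp: le_Suc_eq)
    have "filter_mset (\<lambda>x. x \<noteq> Suc N) m + replicate_mset (count m (Suc N)) (Suc N) = m"
      by (rule multiset_eqI) auto
    then show ?case using l by (intro exI[of _ "count m (Suc N) # l"]) simp
  qed
  moreover have "\<forall>x\<in>#m. 1 \<le> x \<and> x \<le> Max (set_mset m)"
    using assms by (metis Max_ge One_nat_def Suc_leI finite_set_mset gr0I)
  ultimately show ?thesis by blast
qed

abbreviation compatible_step :: "nat \<times> int \<Rightarrow> nat \<times> int \<Rightarrow> bool" where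
  "compatible_step p q \<equiv> fst p \<le> fst q \<and> (snd p < snd q \<longrightarrow> fst p < fst q)"

lemma compatible_seqs_iff:
  "s \<in> compatible_seqs a \<longleftrightarrow> length s = length a \<and> (\<forall>i\<in>set s. 1 \<le> i) \<and> successively compatible_step (zip s a)"
  by (auto simp: compatible_seqs_def successively_conv_nth)

text \<open>Cut \<open>a\<close> where the index changes. Within a piece the letters must decrease,
  as neighbours differ, so the reversed piece is an increasing word; across a cut the index grows
  and nothing is required.\<close>

lemma compatible_mono_seq:
  assumes "successively (\<noteq>) a" "set a \<subseteq> A"
  shows "mono_seq l \<in> compatible_seqs a \<longleftrightarrow> (\<exists>bs\<in>blocks A l. a = rev (concat bs))"
  using assms
proof (induction l arbitrary: a)
  case Nil
  then show ?case by (auto simp: compatible_seqs_iff)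
next
  case (Cons k l)
  have pos: "\<forall>i\<in>set (mono_seq l). 1 \<le> i" for l using mono_seq_set by blast
  have rep: "successively compatible_step (zip (replicate k N) c) \<longleftrightarrow> rev c \<in> inc_words A k"
    if c: "length c = k" "successively (\<noteq>) c" "set c \<subseteq> A" for c N
  proof -
    have "successively compatible_step (zip (replicate k N) c) \<longleftrightarrow> successively (>) c"
      using c(1,2) by (auto simp: successively_conv_nth not_less le_less) (metis le_less linorder_neqE_linordered_idom not_less)+
    also have "\<dots> \<longleftrightarrow> sorted_wrt (>) c" by (rule successively_conv_sorted_wrt) (simp add: transp_def)
    finally show ?thesis using c by (simp add: inc_words_def sorted_wrt_rev)
  qed
  show ?case
  proof
    assume s: "mono_seq (k # l) \<in> compatible_seqs a"
    define a1 a2 where "a1 = take (length (mono_seq l)) a" and "a2 = drop (length (mono_seq l)) a"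
    have a: "a = a1 @ a2" "length a1 = length (mono_seq l)" "length a2 = k"
      using s by (auto simp: a1_def a2_def compatible_seqs_iff)
    have ne: "successively (\<noteq>) a1" "successively (\<noteq>) a2" "set a1 \<subseteq> A" "set a2 \<subseteq> A"
      using Cons.prems a(1) by (auto simp: successively_append_iff)
    have "mono_seq l \<in> compatible_seqs a1" "successively compatible_step (zip (replicate k (Suc (length l))) a2)"
      using s a pos[of l] by (auto simp: compatible_seqs_iff successively_append_iff)
    then obtain bs where "bs \<in> blocks A l" "a1 = rev (concat bs)" "rev a2 \<in> inc_words A k"
      using Cons.IH[OF ne(1,3)] rep[OF a(3) ne(2,4)] by auto
    then show "\<exists>bs\<in>blocks A (k # l). a = rev (concat bs)"
      using a(1) by (intro bexI[of _ "rev a2 # bs"]) (auto simp: blocks_Cons)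
  next
    assume "\<exists>bs\<in>blocks A (k # l). a = rev (concat bs)"
    then obtain b bs where b: "b \<in> inc_words A k" "bs \<in> blocks A l" "a = rev (concat bs) @ rev b"
      by (auto simp: blocks_Cons)
    have ne: "successively (\<noteq>) (rev (concat bs))" "successively (\<noteq>) (rev b)"
      "set (rev (concat bs)) \<subseteq> A" "set (rev b) \<subseteq> A" "length (rev b) = k"
      using Cons.prems b by (auto simp: successively_append_iff inc_words_def)
    have 1: "mono_seq l \<in> compatible_seqs (rev (concat bs))"
      using Cons.IH[OF ne(1,3)] b(2) by blast
    have 2: "successively compatible_step (zip (replicate k (Suc (length l))) (rev b))"
      using rep[OF ne(5,2,4)] b(1) by simp
    have len: "length (mono_seq l) = length (rev (concat bs))" using 1 by (simp add: compatible_seqs_iff)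
    have "fst (last (zip (mono_seq l) (rev (concat bs)))) < fst (hd (zip (replicate k (Suc (length l))) (rev b)))"
      if "zip (mono_seq l) (rev (concat bs)) \<noteq> []" "zip (replicate k (Suc (length l))) (rev b) \<noteq> []"
    proof -
      have "fst (last (zip (mono_seq l) (rev (concat bs)))) \<le> length l"
        using last_in_set[OF that(1)] mono_seq_set[of _ l] by (metis fst_conv prod.collapse set_zip_leftD)
      moreover have "fst (hd (zip (replicate k (Suc (length l))) (rev b))) = Suc (length l)"
        using hd_in_set[OF that(2)] by (metis in_set_replicate prod.collapse set_zip_leftD)
      ultimately show ?thesis by simp
    qed
    then have "zip (mono_seq l) (rev (concat bs)) = [] \<or> zip (replicate k (Suc (length l))) (rev b) = [] \<or>
        compatible_step (last (zip (mono_seq l) (rev (concat bs)))) (hd (zip (replicate k (Suc (length l))) (rev b)))"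
      by (meson less_imp_le)
    then have "successively compatible_step
        (zip (mono_seq l) (rev (concat bs)) @ zip (replicate k (Suc (length l))) (rev b))"
      using 1 2 unfolding successively_append_iff compatible_seqs_iff by blast
    then show "mono_seq (k # l) \<in> compatible_seqs a"
      using len ne(5) pos[of l] unfolding b(3) compatible_seqs_iff mono_seq.simps zip_append[OF len]
      by auto
  qed
qed

lemma blocks_inj: "inj_on (\<lambda>bs. rev (concat bs)) (blocks A l)"
proof (induction l)
  case (Cons k l)
  then show ?case by (auto simp: inj_on_def blocks_Cons inc_words_def)
qed simp

lemma word_fun_mono_seq: "word_fun a (mset (mono_seq l)) = (if mono_seq l \<in> compatible_seqs a then 1 else 0)"
proof -
  have "s = mono_seq l" if "s \<in> compatible_seqs a" "mset s = mset (mono_seq l)" for s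
  proof -
    have "sorted s" using that(1)
      by (auto simp: compatible_seqs_def sorted_iff_nth_Suc)
    then show ?thesis using that(2) sorted_mono_seq by (metis properties_for_sort)
  qed
  then have "{s \<in> compatible_seqs a. mset s = mset (mono_seq l)} = (if mono_seq l \<in> compatible_seqs a then {mono_seq l} else {})"
    by auto
  then show ?thesis by (simp add: word_fun_def gen_fun_def)
qed

text \<open>Any interval of letters that covers the support of \<open>y\<close> may be used, since
  all involution words of \<open>y\<close> live there.\<close>

lemma inv_stanley_iter_coeff:
  assumes supp: "\<And>x. x < lo \<or> lo + int n < x \<Longrightarrow> y \<langle>$\<rangle> x = x"
  shows "inv_stanley y (mset (mono_seq l)) = iter_coeff inv_op (ivl lo n) (delta 1) l y"
proof -
  let ?A = "{lo..<lo + int n}"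
  have sorted: "sorted_wrt (<) (ivl lo n)"
    by (simp add: ivl_def sorted_wrt_map sorted_wrt_less_idx sorted_wrt_upt)
  have letters: "set a \<subseteq> ?A" "successively (\<noteq>) a" if "a \<in> involution_words y" for a
    using involution_words_letters[of lo "lo + int n" y "rev a"] supp that
      successively_involution_words[of "rev a" y] by (auto elim: successively_mono)
  have "inv_stanley y (mset (mono_seq l)) = (\<Sum>a\<in>involution_words y. if mono_seq l \<in> compatible_seqs a then 1 else 0)"
    by (simp add: inv_stanley_eq word_fun_mono_seq)
  also have "\<dots> = (\<Sum>a\<in>involution_words y. if \<exists>bs\<in>blocks ?A l. a = rev (concat bs) then 1 else 0)"
    by (intro sum.cong if_cong compatible_mono_seq letters refl)
  also have "\<dots> = int (card {a \<in> involution_words y. \<exists>bs\<in>blocks ?A l. a = rev (concat bs)})"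
    by (simp add: sum.If_cases finite_involution_words Int_def)
  also have "{a \<in> involution_words y. \<exists>bs\<in>blocks ?A l. a = rev (concat bs)} =
      (\<lambda>bs. rev (concat bs)) ` {bs \<in> blocks ?A l. rev (concat bs) \<in> involution_words y}"
    by auto
  also have "card \<dots> = card {bs \<in> blocks ?A l. rev (concat bs) \<in> involution_words y}"
    by (rule card_image) (rule inj_on_subset[OF blocks_inj], auto)
  also have "int \<dots> = (\<Sum>bs\<in>blocks ?A l. foldr inv_op (concat bs) (delta 1) y)"
    unfolding involution_words_iff by (simp add: sum.If_cases finite_blocks Int_def)
  also have "\<dots> = iter_coeff inv_op (ivl lo n) (delta 1) l y"
    by (simp add: iter_coeff_blocks[of inv_op, OF lin_inv_op sorted] set_ivl)
  finally show ?thesis .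
qed

lemma inv_stanley_zero: "0 \<in># m \<Longrightarrow> inv_stanley y m = 0"
proof -
  assume "0 \<in># m"
  then have *: "{s \<in> compatible_seqs a. mset s = m} = {}" for a
    by (force simp: compatible_seqs_def)
  have "word_fun a m = 0" for a unfolding word_fun_def gen_fun_def * by simp
  then show ?thesis by (simp add: inv_stanley_eq)
qed

section \<open>Strict partitions\<close>

text \<open>A strict partition is the finite set of its parts.  Removing the last box of the row of length
  \<open>c + 1\<close>, which has content \<open>c\<close>, replaces \<open>c + 1\<close> by \<open>c\<close>.\<close>

definition strict_partition :: "nat set \<Rightarrow> bool" where
  "strict_partition S \<longleftrightarrow> finite S \<and> 0 \<notin> S"

definition removable :: "nat \<Rightarrow> nat set \<Rightarrow> bool" where
  "removable c S \<longleftrightarrow> Suc c \<in> S \<and> c \<notin> S"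

text \<open>Taking out 0 discards a row that has become empty.\<close>

definition lower :: "nat \<Rightarrow> nat set \<Rightarrow> nat set" where
  "lower c S = (S - {Suc c}) \<union> ({c} - {0})"

definition part_op :: "nat \<Rightarrow> (nat set \<Rightarrow> int) \<Rightarrow> nat set \<Rightarrow> int" where
  "part_op c g S = (if removable c S then g (lower c S) else 0)"

lemma lin_part_op: "lin (part_op c)"
  by (auto simp: lin_def part_op_def)

interpretation part: nil_ops_B part_op
proof
  fix i j :: nat and g
  show "lin (part_op i)" by (rule lin_part_op)
  show "part_op i (part_op i g) = (\<lambda>y. 0)"
    by (auto simp: part_op_def removable_def lower_def)
  \<comment> \<open>Once 2 has become 1 and disappeared, no part 2 is left for another removal of
    content 1.\<close>
  show "part_op (Suc 0) (part_op 0 (part_op (Suc 0) g)) = (\<lambda>y. 0)"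
    by (auto simp: part_op_def removable_def lower_def)
  \<comment> \<open>Both sides vanish for positive \<open>i\<close>. For \<open>i = 0\<close> the
    left side need not: 1 disappears, 2 becomes 1 and disappears in turn.\<close>
  show "part_op i (part_op (Suc i) (part_op i g)) = part_op (Suc i) (part_op i (part_op (Suc i) g))" if "0 < i"
    using that by (auto simp: part_op_def removable_def lower_def fun_eq_iff)
  show "part_op i (part_op j g) = part_op j (part_op i g)" if "Suc i < j"
  proof
    fix S
    have "removable j (lower i S) = removable j S" "removable i (lower j S) = removable i S"
      "lower i (lower j S) = lower j (lower i S)"
      using that by (auto simp: removable_def lower_def)
    then show "part_op i (part_op j g) S = part_op j (part_op i g) S"
      by (auto simp: part_op_def)
  qed
qed

lemma lower_props:
  assumes "strict_partition S" "removable c S"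
  shows "strict_partition (lower c S)" "\<Sum>S = Suc (\<Sum>(lower c S))"
proof -
  have fin: "finite S" and c: "Suc c \<in> S" "c \<notin> S"
    using assms by (auto simp: strict_partition_def removable_def)
  show "strict_partition (lower c S)"
    using assms by (auto simp: strict_partition_def lower_def)
  have "\<Sum>S = Suc c + \<Sum>(S - {Suc c})" using fin c by (simp add: sum.remove)
  moreover have "\<Sum>(lower c S) = c + \<Sum>(S - {Suc c})"
    using fin c by (cases "c = 0") (auto simp: lower_def)
  ultimately show "\<Sum>S = Suc (\<Sum>(lower c S))" by simp
qed

lemma lower_bound: "removable c S \<Longrightarrow> S \<subseteq> {1..b} \<Longrightarrow> lower c S \<subseteq> {1..b}"
  by (force simp: removable_def lower_def)

text \<open>With contents increasing, a part lowered once is too small for all later contents, so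
  each part above \<open>c\<close> loses at most one box.\<close>

lemma elems_coeff_degree:
  assumes "finite S" "k > card {s \<in> S. s > c}"
  shows "elems_coeff part_op [c..<b] k g S = 0"
  using assms
proof (induction "b - c" arbitrary: c k S)
  case 0
  then show ?case by simp
next
  case (Suc n)
  then have w: "[c..<b] = c # [Suc c..<b]" by (simp add: upt_conv_Cons)
  obtain j where k: "k = Suc j" using Suc.prems by (cases k) auto
  have "card {s \<in> S. s > Suc c} \<le> card {s \<in> S. s > c}"
    using Suc.prems(1) by (intro card_mono) auto
  then have "elems_coeff part_op [Suc c..<b] k g S = 0"
    using Suc.hyps(2) Suc.prems by (intro Suc.hyps(1)) auto
  moreover have "part_op c (elems_coeff part_op [Suc c..<b] j g) S = 0"
  proof (cases "removable c S")
    case True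
    have "{s \<in> S. s > c} = insert (Suc c) {s \<in> lower c S. s > Suc c}"
      using True by (auto simp: removable_def lower_def)
    then have "card {s \<in> S. s > c} = Suc (card {s \<in> lower c S. s > Suc c})"
      using Suc.prems(1) by (simp add: lower_def)
    then have "elems_coeff part_op [Suc c..<b] j g (lower c S) = 0"
      using Suc.hyps(2) Suc.prems k by (intro Suc.hyps(1)) (auto simp: lower_def)
    then show ?thesis by (simp add: part_op_def)
  qed (simp add: part_op_def)
  ultimately show ?case by (simp add: w k)
qed

text \<open>Every term but the identity evaluates \<open>Y\<close> at a smaller partition, where it
  is 0.\<close>

lemma elems_part_op_triangular:
  assumes "strict_partition S" "S \<subseteq> {1..b}"
    and "\<And>S'. strict_partition S' \<Longrightarrow> S' \<subseteq> {1..b} \<Longrightarrow> \<Sum>S' < \<Sum>S \<Longrightarrow> Y S' = 0"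
  shows "elems part_op t cs Y S = Y S"
  using assms
proof (induction cs arbitrary: S)
  case (Cons c cs)
  have IH: "elems part_op t cs Y S' = Y S'"
    if "strict_partition S'" "S' \<subseteq> {1..b}" "\<Sum>S' \<le> \<Sum>S" for S'
    using that Cons.prems(3) by (intro Cons.IH) auto
  have "part_op c (elems part_op t cs Y) S = 0"
  proof (cases "removable c S")
    case True
    then show ?thesis
      using IH[of "lower c S"] Cons.prems lower_props[of S c] lower_bound[of c S b]
      by (simp add: part_op_def)
  qed (simp add: part_op_def)
  then show ?case using IH[OF Cons.prems(1,2)] by (simp add: elem_def)
qed simp

lemma elems_coeff_graded:
  assumes "\<And>i g y. V y \<Longrightarrow> u i g y \<noteq> 0 \<Longrightarrow> \<exists>z. V z \<and> deg y = deg z + d \<and> g z \<noteq> 0"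
    and "V y" "elems_coeff u is k g y \<noteq> 0"
  shows "\<exists>z. V z \<and> deg y = deg z + d * k \<and> g z \<noteq> (0 :: int)"
  using assms(2,3)
proof (induction "is" arbitrary: k y)
  case Nil
  then show ?case by (auto split: if_splits)
next
  case (Cons i "is")
  show ?case
  proof (cases k)
    case 0
    then show ?thesis using Cons.prems by auto
  next
    case (Suc j)
    then consider "elems_coeff u is k g y \<noteq> 0" | "u i (elems_coeff u is j g) y \<noteq> 0"
      using Cons.prems(2) by fastforce
    then show ?thesis
    proof cases
      case 1
      then show ?thesis using Cons by blast
    next
      case 2
      then obtain z where z: "V z" "deg y = deg z + d" "elems_coeff u is j g z \<noteq> 0"
        using assms(1)[OF Cons.prems(1)] by blast
      then obtain z' where "V z'" "deg z = deg z' + d * j" "g z' \<noteq> 0" using Cons.IH by blast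
      then show ?thesis using z(2) Suc by (intro exI[of _ z']) simp
    qed
  qed
qed

lemma iter_coeff_graded:
  assumes "\<And>i g y. V y \<Longrightarrow> u i g y \<noteq> 0 \<Longrightarrow> \<exists>z. V z \<and> deg y = deg z + d \<and> g z \<noteq> 0"
    and "V y" "iter_coeff u is g l y \<noteq> 0"
  shows "\<exists>z. V z \<and> deg y = deg z + d * sum_list l \<and> g z \<noteq> (0 :: int)"
  using assms(2,3)
proof (induction l arbitrary: y)
  case (Cons k l)
  then obtain z where z: "V z" "deg y = deg z + d * k" "iter_coeff u is g l z \<noteq> 0"
    using elems_coeff_graded[where V = V and deg = deg and d = d and u = u, OF assms(1)] by fastforce
  then obtain z' where "V z'" "deg z = deg z' + d * sum_list l" "g z' \<noteq> 0" using Cons.IH by blast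
  then show ?case using z(2) by (intro exI[of _ z']) (simp add: algebra_simps)
qed auto

lemma iter_coeff_part_op_graded:
  assumes "strict_partition S" "iter_coeff part_op cs (delta {}) l S \<noteq> 0"
  shows "\<Sum>S = sum_list l"
proof -
  have "\<exists>z. strict_partition z \<and> \<Sum>S = \<Sum>z + 1 * sum_list l \<and> delta {} z \<noteq> 0"
  proof (rule iter_coeff_graded[where V = strict_partition and deg = Sum and d = 1, OF _ assms])
    show "\<exists>z. strict_partition z \<and> \<Sum>y = \<Sum>z + 1 \<and> g z \<noteq> 0"
      if "strict_partition y" "part_op c g y \<noteq> 0" for c g y
      using that lower_props[of y c] by (auto simp: part_op_def split: if_splits)
  qed
  then show ?thesis by (auto simp: delta_def split: if_splits)
qed

lemma iter_coeff_inv_op_graded: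
  assumes "y \<in> involutions" "iter_coeff inv_op is (delta 1) l y \<noteq> 0"
  shows "rank y = 4 * sum_list l"
proof -
  have "\<exists>z. z \<in> involutions \<and> rank y = rank z + 4 * sum_list l \<and> delta 1 z \<noteq> 0"
  proof (rule iter_coeff_graded[where V = "\<lambda>y. y \<in> involutions" and deg = rank and d = 4, OF _ assms])
    show "\<exists>z. z \<in> involutions \<and> rank y = rank z + 4 \<and> g z \<noteq> 0"
      if "y \<in> involutions" "inv_op c g y \<noteq> 0" for c g y
      using that rem_props[of y c] rank_rem[of y c] by (auto simp: inv_op_def split: if_splits)
  qed
  then show ?thesis by (auto simp: delta_def rank_def split: if_splits)
qed

section \<open>Marked shifted tableaux\<close>

text \<open>Longer rows come first, so this is the index, from 0, of the row of length
  \<open>s\<close>.\<close>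

definition row :: "nat set \<Rightarrow> nat \<Rightarrow> nat" where
  "row S s = card {s' \<in> S. s < s'}"

definition diagram :: "nat set \<Rightarrow> (nat \<times> nat) set" where
  "diagram S = {(i, j). \<exists>s\<in>S. i = row S s \<and> i \<le> j \<and> j < i + s}"

lemma row_less: "finite S \<Longrightarrow> s \<in> S \<Longrightarrow> s' < s \<Longrightarrow> row S s < row S s'"
  unfolding row_def by (intro psubset_card_mono) auto

lemma row_inj: "finite S \<Longrightarrow> s \<in> S \<Longrightarrow> s' \<in> S \<Longrightarrow> row S s = row S s' \<longleftrightarrow> s = s'"
  using row_less[of S s s'] row_less[of S s' s] by (cases s s' rule: linorder_cases) auto

text \<open>As \<open>c\<close> is not a part, replacing \<open>Suc c\<close> by \<open>c\<close>
  does not change the order among the parts.\<close>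

lemma row_lower:
  assumes "strict_partition S" "removable c S" "s \<in> S" "s \<noteq> Suc c"
  shows "row (lower c S) s = row S s"
proof (cases "s > Suc c")
  case True
  then have "{s' \<in> lower c S. s < s'} = {s' \<in> S. s < s'}" by (auto simp: lower_def)
  then show ?thesis by (simp add: row_def)
next
  case False
  then have s: "s < c" using assms by (cases "s = c") (auto simp: removable_def)
  then have "{s' \<in> lower c S. s < s'} = insert c ({s' \<in> S. s < s'} - {Suc c})"
    by (auto simp: lower_def)
  moreover have "finite S" "Suc c \<in> S" "c \<notin> S" using assms by (auto simp: strict_partition_def removable_def)
  moreover have "Suc (card ({s' \<in> S. s < s'} - {Suc c})) = card {s' \<in> S. s < s'}"
    using calculation s by (intro card_Suc_Diff1) auto
  ultimately show ?thesis by (simp add: row_def)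
qed

section \<open>Corners and removable contents\<close>

definition corner :: "(nat \<times> nat) set \<Rightarrow> nat \<times> nat \<Rightarrow> bool" where
  "corner X b \<longleftrightarrow> b \<in> X \<and> (\<forall>j > snd b. (fst b, j) \<notin> X) \<and> (\<forall>i > fst b. (i, snd b) \<notin> X)"

definition content :: "nat \<times> nat \<Rightarrow> nat" where
  "content b = snd b - fst b"

lemma diagram_le: "(i, j) \<in> diagram S \<Longrightarrow> i \<le> j"
  by (auto simp: diagram_def)

lemma corner_imp_removable:
  assumes S: "strict_partition S" and b: "corner (diagram S) b" "content b = c"
  shows "removable c S \<and> b = (row S (Suc c), row S (Suc c) + c)"
proof -
  have fin: "finite S" using S by (simp add: strict_partition_def)
  obtain i j where ij: "b = (i, j)" by (cases b)
  then have "(i, j) \<in> diagram S" using b by (simp add: corner_def)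
  then obtain s where s: "s \<in> S" "i = row S s" "i \<le> j" "j < i + s" by (auto simp: diagram_def)
  have j: "j = i + c" using b(2) ij s(3) by (simp add: content_def)
  have "(i, Suc j) \<notin> diagram S" using b(1) ij by (simp add: corner_def)
  then have "s = Suc c" using s j by (auto simp: diagram_def)
  moreover have "c \<notin> S"
  proof
    assume c: "c \<in> S"
    \<comment> \<open>A part \<open>c\<close> would fill the next row, which ends exactly below
      \<open>b\<close>.\<close>
    have "{s' \<in> S. c < s'} = insert (Suc c) {s' \<in> S. Suc c < s'}" using s(1) \<open>s = Suc c\<close> by auto
    then have "row S c = Suc i" using s(2) \<open>s = Suc c\<close> fin by (simp add: row_def)
    moreover have "c > 0" using c S by (auto simp: strict_partition_def intro: gr0I)
    ultimately have "(Suc i, j) \<in> diagram S" using c j by (auto simp: diagram_def intro!: bexI[of _ c])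
    then show False using b(1) ij by (simp add: corner_def)
  qed
  ultimately show ?thesis using s ij j by (simp add: removable_def)
qed

lemma removable_imp_corner:
  assumes S: "strict_partition S" and rem: "removable c S"
  shows "corner (diagram S) (row S (Suc c), row S (Suc c) + c)"
    and "diagram (lower c S) = diagram S - {(row S (Suc c), row S (Suc c) + c)}"
proof -
  have fin: "finite S" and c: "Suc c \<in> S" "c \<notin> S"
    using assms by (auto simp: strict_partition_def removable_def)
  let ?i = "row S (Suc c)"
  have "(?i, j) \<notin> diagram S" if "j > ?i + c" for j
    using that row_inj[OF fin c(1)] by (auto simp: diagram_def)
  moreover have "(i, ?i + c) \<notin> diagram S" if i: "i > ?i" for i
  proof
    assume "(i, ?i + c) \<in> diagram S"
    then obtain s where s: "s \<in> S" "i = row S s" "?i + c < i + s" by (auto simp: diagram_def)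
    have "s < Suc c"
    proof (rule ccontr)
      assume "\<not> s < Suc c"
      then show False using i s(2) row_less[OF fin s(1), of "Suc c"] by (cases "s = Suc c") auto
    qed
    then have "s < c" using s(1) c(2) by (cases "s = c") auto
    \<comment> \<open>At most \<open>c - s - 1\<close> rows lie strictly between those of
      \<open>Suc c\<close> and \<open>s\<close>; moving down that far, the row of \<open>s\<close>
      still ends left of column \<open>?i + c\<close>.\<close>
    have "{s' \<in> S. s < s'} \<subseteq> insert (Suc c) {s' \<in> S. Suc c < s'} \<union> {s<..<c}"
    proof
      fix x assume "x \<in> {s' \<in> S. s < s'}"
      then show "x \<in> insert (Suc c) {s' \<in> S. Suc c < s'} \<union> {s<..<c}"
        using c(2) by (cases x "Suc c" rule: linorder_cases) (auto simp: less_Suc_eq)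
    qed
    then have "row S s \<le> card (insert (Suc c) {s' \<in> S. Suc c < s'} \<union> {s<..<c})"
      unfolding row_def using fin by (intro card_mono) auto
    also have "\<dots> \<le> Suc ?i + (c - Suc s)"
      using fin card_Un_le[of "insert (Suc c) {s' \<in> S. Suc c < s'}" "{s<..<c}"] by (simp add: row_def)
    finally show False using s(2,3) \<open>s < c\<close> by simp
  qed
  moreover have "(?i, ?i + c) \<in> diagram S" using c(1) by (auto simp: diagram_def intro!: bexI[of _ "Suc c"])
  ultimately show "corner (diagram S) (?i, ?i + c)" by (simp add: corner_def)
  have rowc: "row (lower c S) c = ?i" if "c > 0"
  proof -
    have "{s' \<in> lower c S. c < s'} = {s' \<in> S. Suc c < s'}" using that by (auto simp: lower_def)
    then show ?thesis by (simp add: row_def)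
  qed
  show "diagram (lower c S) = diagram S - {(?i, ?i + c)}"
  proof (intro set_eqI iffI)
    fix b assume "b \<in> diagram (lower c S)"
    then obtain i j s where b: "b = (i, j)" "s \<in> lower c S" "i = row (lower c S) s" "i \<le> j" "j < i + s"
      by (auto simp: diagram_def)
    show "b \<in> diagram S - {(?i, ?i + c)}"
    proof (cases "s = c")
      case True
      then have "i = ?i" using b rowc by (cases "c = 0") (auto simp: lower_def)
      then show ?thesis using b True c(1) by (auto simp: diagram_def)
    next
      case False
      then have s: "s \<in> S" "s \<noteq> Suc c" using b(2) by (auto simp: lower_def)
      then have "i = row S s" using b(3) row_lower[OF S rem] by simp
      then show ?thesis using b s row_inj[OF fin s(1) c(1)] by (auto simp: diagram_def)
    qed
  next
    fix b assume "b \<in> diagram S - {(?i, ?i + c)}"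
    then obtain i j s where b: "b = (i, j)" "s \<in> S" "i = row S s" "i \<le> j" "j < i + s" "b \<noteq> (?i, ?i + c)"
      by (auto simp: diagram_def)
    show "b \<in> diagram (lower c S)"
    proof (cases "s = Suc c")
      case True
      then have "j < i + c" "c > 0" using b by (auto simp: less_Suc_eq)
      then show ?thesis using b True rowc by (auto simp: diagram_def lower_def intro!: bexI[of _ c])
    next
      case False
      then have "s \<in> lower c S" using b by (simp add: lower_def)
      then show ?thesis using b row_lower[OF S rem b(2) False] by (auto simp: diagram_def intro!: bexI[of _ s])
    qed
  qed
qed

lemma finite_diagram: "finite S \<Longrightarrow> finite (diagram S)"
proof -
  assume "finite S"
  have "diagram S \<subseteq> (\<Union>s\<in>S. {row S s} \<times> {row S s..<row S s + s})"
    by (auto simp: diagram_def)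
  then show ?thesis by (rule finite_subset) (use \<open>finite S\<close> in auto)
qed

text \<open>The tableau conditions for an arbitrary set of boxes, so that a corner can be taken away
  without tracking row lengths.\<close>

definition tableaux :: "(nat \<times> nat) set \<Rightarrow> (nat \<times> nat \<Rightarrow> marked) set" where
  "tableaux X = {T \<in> X \<rightarrow>\<^sub>E {e. 1 \<le> unmark e}.
        (\<forall>i j k. j < k \<longrightarrow> (i, j) \<in> X \<longrightarrow> (i, k) \<in> X \<longrightarrow>
           marked_le (T (i, j)) (T (i, k)) \<and> (T (i, j) = T (i, k) \<longrightarrow> \<not> is_primed (T (i, j)))) \<and>
        (\<forall>i j k. i < k \<longrightarrow> (i, j) \<in> X \<longrightarrow> (k, j) \<in> X \<longrightarrow>
           marked_le (T (i, j)) (T (k, j)) \<and> (T (i, j) = T (k, j) \<longrightarrow> is_primed (T (i, j)))) \<and>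
        (\<forall>i. (i, i) \<in> X \<longrightarrow> \<not> is_primed (T (i, i)))}"

definition weight :: "(nat \<times> nat) set \<Rightarrow> (nat \<times> nat \<Rightarrow> marked) \<Rightarrow> nat multiset" where
  "weight X T = image_mset (\<lambda>b. unmark (T b)) (mset_set X)"

definition tabs :: "(nat \<times> nat) set \<Rightarrow> (nat \<Rightarrow> marked \<Rightarrow> bool) \<Rightarrow> nat multiset \<Rightarrow> (nat \<times> nat \<Rightarrow> marked) set" where
  "tabs X Q w = {T \<in> tableaux X. (\<forall>b\<in>X. Q (content b) (T b)) \<and> weight X T = w}"

lemma set_weight: "finite X \<Longrightarrow> set_mset (weight X T) = (\<lambda>b. unmark (T b)) ` X"
  by (simp add: weight_def)

lemma finite_tabs:
  assumes "finite X"
  shows "finite (tabs X Q w)"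
proof -
  have "tabs X Q w \<subseteq> X \<rightarrow>\<^sub>E (Primed ` set_mset w \<union> Unprimed ` set_mset w)"
  proof
    fix T assume T: "T \<in> tabs X Q w"
    have "T b \<in> Primed ` set_mset w \<union> Unprimed ` set_mset w" if "b \<in> X" for b
    proof -
      have "unmark (T b) \<in># w" using T that set_weight[OF assms, of T] by (auto simp: tabs_def)
      then show ?thesis by (cases "T b") auto
    qed
    then show "T \<in> X \<rightarrow>\<^sub>E (Primed ` set_mset w \<union> Unprimed ` set_mset w)"
      using T by (auto simp: tabs_def tableaux_def PiE_iff)
  qed
  then show ?thesis by (rule finite_subset) (intro finite_PiE assms finite_UnI finite_imageI finite_set_mset)
qed

lemma marked_le_antisym: "marked_le e q \<Longrightarrow> marked_le q e \<Longrightarrow> e = q"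
  by (cases e; cases q) auto

text \<open>Boxes with the largest entry \<open>q\<close> are admitted one content at a time, by increasing content if \<open>q\<close> is
  unprimed and by decreasing content if \<open>q\<close> is primed.  A box with entry \<open>q\<close> in the newly admitted content
  \<open>c\<close> is then a corner.\<close>

locale letter =
  fixes Q :: "nat \<Rightarrow> marked \<Rightarrow> bool" and q :: marked and c :: nat
  assumes le: "Q c' e \<Longrightarrow> marked_le e q"
    and side: "Q c' q \<Longrightarrow> if is_primed q then c < c' else c' < c"
    and pos: "1 \<le> unmark q"
    and diag: "is_primed q \<Longrightarrow> 0 < c"
begin

definition Q' :: "nat \<Rightarrow> marked \<Rightarrow> bool" where
  "Q' c' e \<longleftrightarrow> Q c' e \<or> c' = c \<and> e = q"

text \<open>Entries to the right of \<open>b\<close> or below it are at least \<open>q\<close>,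
  hence equal to \<open>q\<close>. In the row this requires an unprimed \<open>q\<close> in a
  content above \<open>c\<close>, in the column a primed \<open>q\<close> in a content below
  \<open>c\<close>; \<open>side\<close> excludes both.\<close>

lemma entry_corner:
  assumes T: "T \<in> tabs X Q' w" and b: "b \<in> X" "content b = c" "T b = q"
    and X: "\<And>i j. (i, j) \<in> X \<Longrightarrow> i \<le> j"
  shows "corner X b"
proof -
  obtain i j where ij: "b = (i, j)" by (cases b)
  have j: "j = i + c" using b ij X[of i j] by (simp add: content_def)
  have Q': "Q' (content b) (T b)" if "b \<in> X" for b using T that by (simp add: tabs_def)
  have tab: "T \<in> tableaux X" using T by (simp add: tabs_def)
  have "(i, k) \<notin> X" if k: "k > j" for k
  proof
    assume ik: "(i, k) \<in> X"
    have *: "marked_le q (T (i, k))" "q = T (i, k) \<Longrightarrow> \<not> is_primed q"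
      using tab k ik b ij unfolding tableaux_def by force+
    have "k - i \<noteq> c" using j k by simp
    then have Q: "Q (k - i) (T (i, k))" using Q'[OF ik] by (simp add: Q'_def content_def)
    then have "T (i, k) = q" using le * marked_le_antisym by blast
    then show False using side[of "k - i"] Q * j k by simp
  qed
  moreover have "(k, j) \<notin> X" if k: "k > i" for k
  proof
    assume kj: "(k, j) \<in> X"
    have *: "marked_le q (T (k, j))" "q = T (k, j) \<Longrightarrow> is_primed q"
      using tab k kj b ij unfolding tableaux_def by force+
    have jk: "j - k < c" using j k X[OF kj] by simp
    then have Q: "Q (j - k) (T (k, j))" using Q'[OF kj] by (simp add: Q'_def content_def)
    then have "T (k, j) = q" using le * marked_le_antisym by blast
    then show False using side[of "j - k"] Q * jk by simp
  qed
  ultimately show ?thesis using b(1) ij by (simp add: corner_def)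
qed

lemma weight_insert:
  assumes "finite X" "b \<in> X"
  shows "weight X (T(b := e)) = add_mset (unmark e) (weight (X - {b}) T)"
proof -
  have "mset_set X = add_mset b (mset_set (X - {b}))" using assms by (simp add: mset_set.remove)
  moreover have "image_mset (\<lambda>x. unmark ((T(b := e)) x)) (mset_set (X - {b})) = image_mset (\<lambda>b. unmark (T b)) (mset_set (X - {b}))"
    using assms by (intro image_mset_cong) auto
  ultimately show ?thesis by (simp add: weight_def)
qed

text \<open>Boxes to the left of the corner have content below \<open>c\<close>, boxes above it
  content above \<open>c\<close>. By \<open>side\<close> a second \<open>q\<close> in the row is
  then unprimed and one in the column primed, as the rules demand.\<close>

lemma tableaux_insert:
  assumes T: "T \<in> tableaux (X - {b})" "\<And>b'. b' \<in> X - {b} \<Longrightarrow> Q (content b') (T b')"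
    and b: "corner X b" "content b = c" and X: "\<And>i j. (i, j) \<in> X \<Longrightarrow> i \<le> j"
  shows "T(b := q) \<in> tableaux X"
proof -
  obtain i0 j0 where b0: "b = (i0, j0)" by (cases b)
  have bX: "b \<in> X" using b by (simp add: corner_def)
  have j0: "j0 = i0 + c" using b b0 X[of i0 j0] bX by (simp add: content_def)
  have "T(b := q) \<in> X \<rightarrow>\<^sub>E {e. 1 \<le> unmark e}"
    using T(1) pos bX by (auto simp: tableaux_def PiE_iff extensional_def)
  moreover have "marked_le ((T(b := q)) (i, j)) ((T(b := q)) (i, k)) \<and>
      ((T(b := q)) (i, j) = (T(b := q)) (i, k) \<longrightarrow> \<not> is_primed ((T(b := q)) (i, j)))"
    if jk: "j < k" "(i, j) \<in> X" "(i, k) \<in> X" for i j k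
  proof -
    have "(i, j) \<noteq> b" using jk b b0 by (auto simp: corner_def)
    show ?thesis
    proof (cases "(i, k) = b")
      case True
      have Q: "Q (j - i) (T (i, j))" using T(2)[of "(i, j)"] jk \<open>(i, j) \<noteq> b\<close> by (simp add: content_def)
      have "j - i < c" using True jk j0 b0 X[OF jk(2)] by auto
      then show ?thesis using True \<open>(i, j) \<noteq> b\<close> le[OF Q] side[of "j - i"] Q by auto
    next
      case False
      then show ?thesis using T(1) jk \<open>(i, j) \<noteq> b\<close> unfolding tableaux_def by force
    qed
  qed
  moreover have "marked_le ((T(b := q)) (i, j)) ((T(b := q)) (k, j)) \<and>
      ((T(b := q)) (i, j) = (T(b := q)) (k, j) \<longrightarrow> is_primed ((T(b := q)) (i, j)))"
    if ik: "i < k" "(i, j) \<in> X" "(k, j) \<in> X" for i j k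
  proof -
    have "(i, j) \<noteq> b" using ik b b0 by (auto simp: corner_def)
    show ?thesis
    proof (cases "(k, j) = b")
      case True
      have Q: "Q (j - i) (T (i, j))" using T(2)[of "(i, j)"] ik \<open>(i, j) \<noteq> b\<close> by (simp add: content_def)
      have "c < j - i" using True ik j0 b0 by auto
      then show ?thesis using True \<open>(i, j) \<noteq> b\<close> le[OF Q] side[of "j - i"] Q by auto
    next
      case False
      then show ?thesis using T(1) ik \<open>(i, j) \<noteq> b\<close> unfolding tableaux_def by force
    qed
  qed
  moreover have "\<not> is_primed ((T(b := q)) (i, i))" if "(i, i) \<in> X" for i
  proof (cases "(i, i) = b")
    case True
    then have "c = 0" using j0 b0 by simp
    then show ?thesis using diag True by auto
  next
    case False
    then show ?thesis using T(1) that by (simp add: tableaux_def)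
  qed
  ultimately show ?thesis unfolding tableaux_def by blast
qed

lemma tableaux_restrict:
  "T \<in> tableaux X \<Longrightarrow> restrict T (X - {b}) \<in> tableaux (X - {b})"
  unfolding tableaux_def by (auto simp: PiE_iff)

text \<open>Split according to whether the single corner of content \<open>c\<close> holds
  \<open>q\<close>; if so, erase it.\<close>

lemma tabs_corner:
  assumes fin: "finite X" and b: "corner X b" "content b = c"
    and uniq: "\<And>b'. corner X b' \<Longrightarrow> content b' = c \<Longrightarrow> b' = b"
    and X: "\<And>i j. (i, j) \<in> X \<Longrightarrow> i \<le> j"
  shows "card (tabs X Q' (add_mset (unmark q) w)) =
    card (tabs X Q (add_mset (unmark q) w)) + card (tabs (X - {b}) Q w)"
proof -
  let ?w = "add_mset (unmark q) w" and ?f = "\<lambda>T. T(b := q)"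
  have bX: "b \<in> X" using b by (simp add: corner_def)
  have notQ: "\<not> Q c q" using side by (metis less_irrefl)
  have "tabs X Q' ?w = tabs X Q ?w \<union> ?f ` tabs (X - {b}) Q w"
  proof (intro set_eqI iffI)
    fix T assume T: "T \<in> tabs X Q' ?w"
    have other: "Q (content b') (T b')" if "b' \<in> X" "b' \<noteq> b" for b'
    proof (rule ccontr)
      assume "\<not> ?thesis"
      then have "content b' = c" "T b' = q" using T \<open>b' \<in> X\<close> by (auto simp: tabs_def Q'_def)
      then show False using entry_corner[OF T \<open>b' \<in> X\<close> _ _ X] uniq \<open>b' \<noteq> b\<close> by blast
    qed
    show "T \<in> tabs X Q ?w \<union> ?f ` tabs (X - {b}) Q w"
    proof (cases "T b = q")
      case False
      then have "Q (content b) (T b)" using T bX b by (auto simp: tabs_def Q'_def)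
      then show ?thesis using T other by (auto simp: tabs_def)
    next
      case True
      let ?T = "restrict T (X - {b})"
      have "T \<in> extensional X" using T by (auto simp: tabs_def tableaux_def PiE_def)
      then have TT: "T = ?f ?T" using True bX by (auto simp: fun_eq_iff extensional_def)
      have "?w = add_mset (unmark q) (weight (X - {b}) ?T)"
        using weight_insert[OF fin bX, of ?T q] TT T by (simp add: tabs_def)
      then have "?T \<in> tabs (X - {b}) Q w"
        using T other tableaux_restrict by (auto simp: tabs_def)
      then show ?thesis using TT by blast
    qed
  next
    fix T assume "T \<in> tabs X Q ?w \<union> ?f ` tabs (X - {b}) Q w"
    then show "T \<in> tabs X Q' ?w"
    proof
      assume "T \<in> tabs X Q ?w"
      then show ?thesis by (simp add: tabs_def Q'_def)
    next
      assume "T \<in> ?f ` tabs (X - {b}) Q w"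
      then obtain T' where T': "T' \<in> tabs (X - {b}) Q w" "T = ?f T'" by blast
      then show ?thesis
        using tableaux_insert[of T' X b] b X weight_insert[OF fin bX, of T' q]
        by (auto simp: tabs_def Q'_def)
    qed
  qed
  moreover have "tabs X Q ?w \<inter> ?f ` tabs (X - {b}) Q w = {}"
    using bX notQ b by (auto simp: tabs_def)
  moreover have "inj_on ?f (tabs (X - {b}) Q w)"
  proof (rule inj_onI)
    fix T T' assume *: "T \<in> tabs (X - {b}) Q w" "T' \<in> tabs (X - {b}) Q w" "?f T = ?f T'"
    have "T b = undefined" if "T \<in> tabs (X - {b}) Q w" for T
    proof -
      have "T \<in> X - {b} \<rightarrow>\<^sub>E {e. 1 \<le> unmark e}" using that by (simp add: tabs_def tableaux_def)
      then show ?thesis by (rule PiE_arb) simp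
    qed
    then have "T b = undefined" "T' b = undefined" using * by blast+
    then show "T = T'" using *(3) by (metis fun_upd_triv fun_upd_upd)
  qed
  ultimately show ?thesis using fin
    by (simp add: card_Un_disjoint finite_tabs card_image)
qed

lemma tabs_no_corner:
  assumes "\<And>b. corner X b \<Longrightarrow> content b \<noteq> c" and X: "\<And>i j. (i, j) \<in> X \<Longrightarrow> i \<le> j"
  shows "tabs X Q' w = tabs X Q w"
proof (intro set_eqI iffI)
  fix T assume T: "T \<in> tabs X Q' w"
  have "Q (content b) (T b)" if "b \<in> X" for b
  proof (rule ccontr)
    assume "\<not> ?thesis"
    then have "content b = c" "T b = q" using T that by (auto simp: tabs_def Q'_def)
    then show False using entry_corner[OF T that _ _ X] assms(1) by blast
  qed
  then show "T \<in> tabs X Q w" using T by (auto simp: tabs_def)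
qed (auto simp: tabs_def Q'_def)

lemma tabs_no_letter:
  assumes "finite X" "unmark q \<notin># w"
  shows "tabs X Q' w = tabs X Q w"
proof (intro set_eqI iffI)
  fix T assume T: "T \<in> tabs X Q' w"
  have "T b \<noteq> q" if "b \<in> X" for b
    using set_weight[OF assms(1), of T] that T assms(2) by (auto simp: tabs_def)
  then show "T \<in> tabs X Q w" using T by (auto simp: tabs_def Q'_def)
qed (auto simp: tabs_def Q'_def)

text \<open>Admitting \<open>q\<close> in content \<open>c\<close> reproduces the recursion of
  \<open>elems_coeff\<close> for a new head \<open>c\<close>.\<close>

lemma tabs_letter:
  assumes S: "strict_partition S" "S \<subseteq> {1..b}" and w: "unmark q \<notin># w"
    and rec: "\<And>k S. strict_partition S \<Longrightarrow> S \<subseteq> {1..b} \<Longrightarrow>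
        int (card (tabs (diagram S) Q (replicate_mset k (unmark q) + w))) = elems_coeff part_op cs k g S"
  shows "int (card (tabs (diagram S) Q' (replicate_mset k (unmark q) + w))) = elems_coeff part_op (c # cs) k g S"
proof (cases k)
  case 0
  have "finite (diagram S)" using S(1) by (simp add: finite_diagram strict_partition_def)
  then show ?thesis using tabs_no_letter[OF _ w] rec[OF S, of 0] 0 by simp
next
  case (Suc j)
  have fin: "finite (diagram S)" using S(1) by (simp add: finite_diagram strict_partition_def)
  show ?thesis
  proof (cases "removable c S")
    case True
    let ?b = "(row S (Suc c), row S (Suc c) + c)"
    note corner = removable_imp_corner[OF S(1) True]
    have "card (tabs (diagram S) Q' (add_mset (unmark q) (replicate_mset j (unmark q) + w))) =
        card (tabs (diagram S) Q (add_mset (unmark q) (replicate_mset j (unmark q) + w))) +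
        card (tabs (diagram (lower c S)) Q (replicate_mset j (unmark q) + w))"
      unfolding corner(2) using corner_imp_removable[OF S(1)]
      by (intro tabs_corner fin corner(1)) (auto simp: content_def dest: diagram_le)
    then show ?thesis
      using rec[OF S, of "Suc j"] rec[OF lower_props(1)[OF S(1) True] lower_bound[OF True S(2)], of j] True Suc
      by (simp add: part_op_def)
  next
    case False
    then have "tabs (diagram S) Q' w = tabs (diagram S) Q w" for w
      using corner_imp_removable[OF S(1)] by (intro tabs_no_corner) (auto dest: diagram_le)
    then show ?thesis using rec[OF S, of k] False Suc by (simp add: part_op_def)
  qed
qed

end

lemma marked_le_of_less: "unmark e < unmark q \<Longrightarrow> marked_le e q"
  by (cases e; cases q) auto

definition primed_stage :: "nat \<Rightarrow> nat \<Rightarrow> nat \<Rightarrow> nat \<Rightarrow> marked \<Rightarrow> bool" where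
  "primed_stage m N c c' e \<longleftrightarrow> unmark e < N \<or> e = Primed N \<and> c \<le> c' \<and> c' \<le> m"

definition unprimed_stage :: "nat \<Rightarrow> nat \<Rightarrow> nat \<Rightarrow> nat \<Rightarrow> marked \<Rightarrow> bool" where
  "unprimed_stage m N c c' e \<longleftrightarrow> primed_stage m N 1 c' e \<or> e = Unprimed N \<and> c' < c"

lemma card_tabs_primed:
  assumes N: "1 \<le> N" "N \<notin># w" and c: "1 \<le> c" "c \<le> Suc m" and S: "strict_partition S" "S \<subseteq> {1..b}"
    and g: "\<And>S. strict_partition S \<Longrightarrow> S \<subseteq> {1..b} \<Longrightarrow> int (card (tabs (diagram S) (\<lambda>_ e. unmark e < N) w)) = g S"
  shows "int (card (tabs (diagram S) (primed_stage m N c) (replicate_mset k N + w))) =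
    elems_coeff part_op [c..<Suc m] k g S"
  using c S
proof (induction "Suc m - c" arbitrary: c k S)
  case 0
  note S = "0.prems"(3,4)
  have c: "c = Suc m" using 0 by simp
  have fin: "finite (diagram S)" using S by (simp add: finite_diagram strict_partition_def)
  have Q: "primed_stage m N c = (\<lambda>_ e. unmark e < N)"
    by (auto simp: primed_stage_def c fun_eq_iff)
  show ?case
  proof (cases k)
    case 0
    then show ?thesis using g[OF S] by (simp add: Q[unfolded c] c)
  next
    case (Suc j)
    have "tabs (diagram S) (\<lambda>_ e. unmark e < N) (replicate_mset k N + w) = {}"
    proof -
      have "N \<notin># weight (diagram S) T" if "\<forall>b\<in>diagram S. unmark (T b) < N" for T
        using set_weight[OF fin, of T] that by auto
      then show ?thesis using Suc by (auto simp: tabs_def) (metis union_single_eq_member)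
    qed
    then show ?thesis by (simp add: Q[unfolded c] c Suc)
  qed
next
  case (Suc n)
  interpret letter "primed_stage m N (Suc c)" "Primed N" c
    using N Suc.prems by unfold_locales (auto simp: primed_stage_def intro: marked_le_of_less)
  have "Q' = primed_stage m N c"
    using Suc.hyps(2) Suc.prems by (auto simp: Q'_def primed_stage_def fun_eq_iff)
  moreover have "[c..<Suc m] = c # [Suc c..<Suc m]" using Suc.hyps(2) by (intro upt_conv_Cons) simp
  ultimately show ?case
    using tabs_letter[where cs = "[Suc c..<Suc m]" and g = g and w = w and S = S and k = k and b = b] Suc N(2)
    by (simp del: upt_Suc)
qed

lemma card_tabs_unprimed:
  assumes N: "1 \<le> N" "N \<notin># w" and S: "strict_partition S" "S \<subseteq> {1..b}"
    and g: "\<And>S. strict_partition S \<Longrightarrow> S \<subseteq> {1..b} \<Longrightarrow> int (card (tabs (diagram S) (\<lambda>_ e. unmark e < N) w)) = g S"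
  shows "int (card (tabs (diagram S) (unprimed_stage m N c) (replicate_mset k N + w))) =
    elems_coeff part_op (rev [0..<c] @ [1..<Suc m]) k g S"
  using S
proof (induction c arbitrary: k S)
  case 0
  have "unprimed_stage m N 0 = primed_stage m N 1" by (simp add: unprimed_stage_def fun_eq_iff)
  then show ?case using card_tabs_primed[of N w 1 m S b g k] assms(1,2) g 0 by (simp del: upt_Suc)
next
  case (Suc c)
  interpret letter "unprimed_stage m N c" "Unprimed N" c
    using N by unfold_locales
      (auto simp: unprimed_stage_def primed_stage_def intro: marked_le_of_less)
  have "Q' = unprimed_stage m N (Suc c)"
    by (auto simp: Q'_def unprimed_stage_def fun_eq_iff)
  then show ?case
    using tabs_letter[where cs = "rev [0..<c] @ [1..<Suc m]" and g = g and w = w and S = S and k = k and b = b] Suc N(2)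
    by (simp add: upt_Suc_append[of 0 c] del: upt_Suc)
qed

lemma K_word_eq: "K_word m = rev [0..<Suc m] @ [1..<Suc m]"
  by (simp add: K_word_def upt_conv_Cons del: upt_Suc)

text \<open>Parts up to \<open>Suc m\<close> have contents up to \<open>m\<close>, and no primed
  entry has content 0, so after the last stage every entry up to \<open>N\<close> is
  allowed.\<close>

lemma card_tabs_step:
  assumes "1 \<le> N" "N \<notin># w" and S: "strict_partition S" "S \<subseteq> {1..Suc m}"
    and g: "\<And>S. strict_partition S \<Longrightarrow> S \<subseteq> {1..Suc m} \<Longrightarrow> int (card (tabs (diagram S) (\<lambda>_ e. unmark e < N) w)) = g S"
  shows "int (card (tabs (diagram S) (\<lambda>_ e. unmark e \<le> N) (replicate_mset k N + w))) =
    elems_coeff part_op (K_word m) k g S"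
proof -
  have "tabs (diagram S) (\<lambda>_ e. unmark e \<le> N) v = tabs (diagram S) (unprimed_stage m N (Suc m)) v" for v
  proof -
    have "unprimed_stage m N (Suc m) (content b) (T b) \<longleftrightarrow> unmark (T b) \<le> N"
      if T: "T \<in> tableaux (diagram S)" and b: "b \<in> diagram S" for T b
    proof -
      obtain i j where ij: "b = (i, j)" by (cases b)
      have "content b \<le> m" using b S(2) ij by (force simp: diagram_def content_def)
      moreover have "content b \<noteq> 0" if "T b = Primed N"
      proof
        assume "content b = 0"
        then have "j = i" using ij b diagram_le[of i j S] by (simp add: content_def)
        then show False using T b ij that by (force simp: tableaux_def)
      qed
      ultimately show ?thesis
        by (cases "T b") (auto simp: unprimed_stage_def primed_stage_def)
    qed
    then show ?thesis unfolding tabs_def by blast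
  qed
  then show ?thesis using card_tabs_unprimed[of N w S "Suc m" g m "Suc m" k] assms by (simp add: K_word_eq del: upt_Suc)
qed

lemma card_tabs_iter_coeff:
  assumes "strict_partition S" "S \<subseteq> {1..Suc m}"
  shows "int (card (tabs (diagram S) (\<lambda>_ e. unmark e \<le> length l) (mset (mono_seq l)))) =
    iter_coeff part_op (K_word m) (delta {}) l S"
  using assms
proof (induction l arbitrary: S)
  case Nil
  have fin: "finite (diagram S)" using Nil by (simp add: finite_diagram strict_partition_def)
  show ?case
  proof (cases "S = {}")
    case True
    have "tabs {} (\<lambda>_ e. unmark e \<le> 0) {#} = {\<lambda>_. undefined}"
      by (auto simp: tabs_def tableaux_def weight_def)
    then show ?thesis using True by (simp add: diagram_def delta_def)
  next
    case False
    then obtain s where "s \<in> S" by blast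
    moreover have "s > 0" using \<open>s \<in> S\<close> Nil(1) by (auto simp: strict_partition_def intro: gr0I)
    ultimately have "(row S s, row S s) \<in> diagram S" by (auto simp: diagram_def)
    then have "weight (diagram S) T \<noteq> {#}" for T
      using set_weight[OF fin, of T] by force
    then show ?thesis using False by (simp add: tabs_def delta_def)
  qed
next
  case (Cons k l)
  let ?N = "Suc (length l)"
  have "?N \<notin># mset (mono_seq l)" using mono_seq_set[of ?N l] by auto
  then show ?case
    using card_tabs_step[of ?N "mset (mono_seq l)" S m "iter_coeff part_op (K_word m) (delta {}) l" k]
      Cons by (simp add: less_Suc_eq_le add.commute)
qed

section \<open>From sets of parts back to lists\<close>

lemma row_nth:
  assumes "sorted_wrt (>) \<mu>" "i < length \<mu>"
  shows "row (set \<mu>) (\<mu> ! i) = i"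
proof -
  have "{s' \<in> set \<mu>. \<mu> ! i < s'} = (!) \<mu> ` {..<i}"
  proof (intro set_eqI iffI)
    fix s' assume "s' \<in> {s' \<in> set \<mu>. \<mu> ! i < s'}"
    then obtain j where j: "j < length \<mu>" "s' = \<mu> ! j" "\<mu> ! i < \<mu> ! j" by (auto simp: in_set_conv_nth)
    then have "j < i" using sorted_wrt_nth_less[OF assms(1), of i j] by (cases i j rule: linorder_cases) auto
    then show "s' \<in> (!) \<mu> ` {..<i}" using j by auto
  qed (use assms(2) sorted_wrt_nth_less[OF assms(1), of _ i] in auto)
  moreover have "inj_on ((!) \<mu>) {..<i}"
    using assms(2) sorted_wrt_nth_less[OF assms(1)]
    by (intro linorder_inj_onI') (metis lessThan_iff less_irrefl order.strict_trans)
  ultimately show ?thesis by (simp add: row_def card_image)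
qed

lemma shifted_diagram_eq:
  assumes "sorted_wrt (>) \<mu>"
  shows "shifted_diagram \<mu> = diagram (set \<mu>)"
proof -
  note row = row_nth[OF assms]
  show ?thesis
  proof (intro set_eqI iffI)
    fix b assume "b \<in> shifted_diagram \<mu>"
    then obtain i j where "b = (i, j)" "i < length \<mu>" "i \<le> j" "j < i + \<mu> ! i"
      by (auto simp: shifted_diagram_def)
    then show "b \<in> diagram (set \<mu>)" using row by (auto simp: diagram_def intro!: bexI[of _ "\<mu> ! i"])
  next
    fix b assume "b \<in> diagram (set \<mu>)"
    then show "b \<in> shifted_diagram \<mu>" using row
      by (auto simp: diagram_def shifted_diagram_def in_set_conv_nth)
  qed
qed

lemma schur_P_eq: "schur_P \<mu> w = int (card {T \<in> tableaux (shifted_diagram \<mu>). weight (shifted_diagram \<mu>) T = w})"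
  by (simp add: schur_P_def gen_fun_def marked_shifted_tableaux_def tableaux_def weight_def)

lemma finite_shifted_diagram: "finite (shifted_diagram \<mu>)"
proof -
  have "shifted_diagram \<mu> \<subseteq> (\<Union>i<length \<mu>. {i} \<times> {i..<i + \<mu> ! i})"
    by (auto simp: shifted_diagram_def)
  then show ?thesis by (rule finite_subset) auto
qed

lemma schur_P_zero: "0 \<in># w \<Longrightarrow> schur_P \<mu> w = 0"
proof -
  assume "0 \<in># w"
  then have "{T \<in> tableaux (shifted_diagram \<mu>). weight (shifted_diagram \<mu>) T = w} = {}"
    using set_weight[OF finite_shifted_diagram, of \<mu>] by (fastforce simp: tableaux_def PiE_iff)
  then show ?thesis unfolding schur_P_eq by (simp only:) simp
qed

lemma schur_P_iter_coeff:
  assumes \<mu>: "sorted_wrt (>) \<mu>" "set \<mu> \<subseteq> {1..Suc m}"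
  shows "schur_P \<mu> (mset (mono_seq l)) = iter_coeff part_op (K_word m) (delta {}) l (set \<mu>)"
proof -
  have "{T \<in> tableaux (diagram (set \<mu>)). weight (diagram (set \<mu>)) T = mset (mono_seq l)} =
    tabs (diagram (set \<mu>)) (\<lambda>_ e. unmark e \<le> length l) (mset (mono_seq l))"
  proof -
    have "unmark (T b) \<le> length l"
      if "weight (diagram (set \<mu>)) T = mset (mono_seq l)" "b \<in> diagram (set \<mu>)" for T b
    proof -
      have "unmark (T b) \<in># mset (mono_seq l)"
        using set_weight[of "diagram (set \<mu>)" T] that by (auto simp: finite_diagram)
      then show ?thesis using mono_seq_set by auto
    qed
    then show ?thesis by (auto simp: tabs_def)
  qed
  moreover have "strict_partition (set \<mu>)" using \<mu>(2) by (auto simp: strict_partition_def)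
  ultimately show ?thesis
    using card_tabs_iter_coeff[of "set \<mu>" m l] \<mu> by (simp add: schur_P_eq shifted_diagram_eq)
qed

section \<open>I-Grassmannian involutions\<close>

text \<open>The part \<open>s\<close> in row \<open>k\<close>, counted from 0, gives the cycle \<open>(n + 1 - s, n + 1 + k)\<close>.\<close>

definition grass :: "int \<Rightarrow> nat set \<Rightarrow> int perm \<Rightarrow> bool" where
  "grass n S y \<longleftrightarrow> strict_partition S \<and>
     (\<forall>s\<in>S. y \<langle>$\<rangle> (n + 1 - int s) = n + 1 + int (row S s) \<and> y \<langle>$\<rangle> (n + 1 + int (row S s)) = n + 1 - int s) \<and>
     (\<forall>x. (\<forall>s\<in>S. x \<noteq> n + 1 - int s \<and> x \<noteq> n + 1 + int (row S s)) \<longrightarrow> y \<langle>$\<rangle> x = x)"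

lemma grass_strict: "grass n S y \<Longrightarrow> strict_partition S"
  by (simp add: grass_def)

lemma grassD:
  assumes "grass n S y"
  shows "s \<in> S \<Longrightarrow> y \<langle>$\<rangle> (n + 1 - int s) = n + 1 + int (row S s)"
    "s \<in> S \<Longrightarrow> y \<langle>$\<rangle> (n + 1 + int (row S s)) = n + 1 - int s"
    "(\<And>s. s \<in> S \<Longrightarrow> x \<noteq> n + 1 - int s \<and> x \<noteq> n + 1 + int (row S s)) \<Longrightarrow> y \<langle>$\<rangle> x = x"
  using assms by (auto simp: grass_def)

lemma grass_unique: "grass n S y \<Longrightarrow> grass n S y' \<Longrightarrow> y = y'"
proof (rule perm_eqI)
  fix x assume y: "grass n S y" and y': "grass n S y'"
  consider s where "s \<in> S" "x = n + 1 - int s" | s where "s \<in> S" "x = n + 1 + int (row S s)"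
    | "\<And>s. s \<in> S \<Longrightarrow> x \<noteq> n + 1 - int s \<and> x \<noteq> n + 1 + int (row S s)" by blast
  then show "y \<langle>$\<rangle> x = y' \<langle>$\<rangle> x"
  proof cases
    case 1
    then show ?thesis by (simp only: grassD(1)[OF y] grassD(1)[OF y'])
  next
    case 2
    then show ?thesis by (simp only: grassD(2)[OF y] grassD(2)[OF y'])
  next
    case 3
    show ?thesis using grassD(3)[OF y 3] grassD(3)[OF y' 3] by simp
  qed
qed

lemma grass_involution: "grass n S y \<Longrightarrow> y \<in> involutions"
proof (rule involutionI)
  fix x assume y: "grass n S y"
  consider s where "s \<in> S" "x = n + 1 - int s" | s where "s \<in> S" "x = n + 1 + int (row S s)"
    | "\<And>s. s \<in> S \<Longrightarrow> x \<noteq> n + 1 - int s \<and> x \<noteq> n + 1 + int (row S s)" by blast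
  then show "y \<langle>$\<rangle> (y \<langle>$\<rangle> x) = x"
  proof cases
    case 3
    show ?thesis using grassD(3)[OF y 3] by simp
  qed (simp_all only: grassD(1,2)[OF y])
qed

lemma grass_empty: "grass n {} 1"
  by (simp add: grass_def strict_partition_def)

lemma row_less_card: "strict_partition S \<Longrightarrow> s \<in> S \<Longrightarrow> row S s < card S"
  unfolding row_def strict_partition_def by (intro psubset_card_mono) auto

lemma grass_support:
  assumes "grass n S y" "S \<subseteq> {1..b}" "x < n + 1 - int b \<or> n + int (card S) < x"
  shows "y \<langle>$\<rangle> x = x"
proof (rule grassD(3)[OF assms(1)])
  fix s assume s: "s \<in> S"
  then have "s \<le> b" "row S s < card S"
    using assms(2) row_less_card grass_strict[OF assms(1)] by auto
  then show "x \<noteq> n + 1 - int s \<and> x \<noteq> n + 1 + int (row S s)" using assms(3) by auto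
qed

lemma prod_transpositions:
  fixes f g :: "nat \<Rightarrow> int"
  assumes "inj_on f {..<r}" "inj_on g {..<r}" "\<And>j k. j < r \<Longrightarrow> k < r \<Longrightarrow> f j \<noteq> g k"
  defines "P \<equiv> prod_list (map (\<lambda>k. \<langle>f k \<leftrightarrow> g k\<rangle>) [0..<r])"
  shows "(\<forall>k<r. P \<langle>$\<rangle> (f k) = g k \<and> P \<langle>$\<rangle> (g k) = f k) \<and> (\<forall>x. (\<forall>k<r. x \<noteq> f k \<and> x \<noteq> g k) \<longrightarrow> P \<langle>$\<rangle> x = x)"
  using assms(1-3) unfolding P_def
proof (induction r)
  case (Suc r)
  let ?P = "prod_list (map (\<lambda>k. \<langle>f k \<leftrightarrow> g k\<rangle>) [0..<r])"
  have IH: "(\<forall>k<r. ?P \<langle>$\<rangle> (f k) = g k \<and> ?P \<langle>$\<rangle> (g k) = f k) \<and> (\<forall>x. (\<forall>k<r. x \<noteq> f k \<and> x \<noteq> g k) \<longrightarrow> ?P \<langle>$\<rangle> x = x)"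
    using Suc.prems by (intro Suc.IH) (auto simp: inj_on_def)
  have ne: "f k \<noteq> f r" "g k \<noteq> g r" "f k \<noteq> g r" "g k \<noteq> f r" if "k < r" for k
    using Suc.prems(3)[of k r] Suc.prems(3)[of r k] that
      inj_onD[OF Suc.prems(1), of k r] inj_onD[OF Suc.prems(2), of k r] by auto
  have "\<forall>k<r. f r \<noteq> f k \<and> f r \<noteq> g k" "\<forall>k<r. g r \<noteq> f k \<and> g r \<noteq> g k"
    using ne by (simp_all add: eq_commute)
  then have fr: "?P \<langle>$\<rangle> (f r) = f r" "?P \<langle>$\<rangle> (g r) = g r" using conjunct2[OF IH] by blast+
  have eq: "prod_list (map (\<lambda>k. \<langle>f k \<leftrightarrow> g k\<rangle>) [0..<Suc r]) = ?P * \<langle>f r \<leftrightarrow> g r\<rangle>" by simp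
  show ?case unfolding eq
  proof (intro conjI allI impI)
    fix k assume "k < Suc r"
    then consider "k = r" | "k < r" by linarith
    then show "(?P * \<langle>f r \<leftrightarrow> g r\<rangle>) \<langle>$\<rangle> (f k) = g k" "(?P * \<langle>f r \<leftrightarrow> g r\<rangle>) \<langle>$\<rangle> (g k) = f k"
      using IH fr ne by (cases, simp_all add: apply_mult)+
  next
    fix x assume "\<forall>k<Suc r. x \<noteq> f k \<and> x \<noteq> g k"
    then show "(?P * \<langle>f r \<leftrightarrow> g r\<rangle>) \<langle>$\<rangle> x = x" using IH by (simp add: apply_mult)
  qed
qed simp

lemma form_imp_grass:
  fixes \<phi> :: "int list"
  assumes \<phi>: "sorted_wrt (<) \<phi>" "\<forall>p\<in>set \<phi>. p \<le> n"
    and y: "y = prod_list (map (\<lambda>k. \<langle>\<phi> ! k \<leftrightarrow> n + int (Suc k)\<rangle>) [0..<length \<phi>])"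
  defines "\<mu> \<equiv> map (\<lambda>p. nat (n + 1 - p)) \<phi>"
  shows "sorted_wrt (>) \<mu>" "grass n (set \<mu>) y"
proof -
  show \<mu>: "sorted_wrt (>) \<mu>"
    using \<phi> unfolding \<mu>_def sorted_wrt_map by (elim sorted_wrt_mono_rel[rotated]) auto
  have nth: "n + 1 - int (\<mu> ! k) = \<phi> ! k" "row (set \<mu>) (\<mu> ! k) = k" if "k < length \<phi>" for k
  proof -
    show "n + 1 - int (\<mu> ! k) = \<phi> ! k" using bspec[OF \<phi>(2) nth_mem[OF that]] that by (simp add: \<mu>_def)
    show "row (set \<mu>) (\<mu> ! k) = k" using row_nth[OF \<mu>, of k] that by (simp add: \<mu>_def)
  qed
  have "inj_on ((!) \<phi>) {..<length \<phi>}"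
    using \<phi>(1) by (simp add: inj_on_nth strict_sorted_iff)
  moreover have "\<phi> ! j \<noteq> n + int (Suc k)" if "j < length \<phi>" for j k
    using \<phi>(2) that nth_mem[OF that] by force
  ultimately have *: "(\<forall>k<length \<phi>. y \<langle>$\<rangle> (\<phi> ! k) = n + int (Suc k) \<and> y \<langle>$\<rangle> (n + int (Suc k)) = \<phi> ! k) \<and>
    (\<forall>x. (\<forall>k<length \<phi>. x \<noteq> \<phi> ! k \<and> x \<noteq> n + int (Suc k)) \<longrightarrow> y \<langle>$\<rangle> x = x)"
    unfolding y by (intro prod_transpositions) (auto simp: inj_on_def)
  have len: "length \<mu> = length \<phi>" by (simp add: \<mu>_def)
  have suc: "n + 1 + int k = n + int (Suc k)" for k by simp
  show "grass n (set \<mu>) y"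
    unfolding grass_def
  proof (intro conjI allI impI ballI)
    show "strict_partition (set \<mu>)" using \<phi>(2) by (auto simp: strict_partition_def \<mu>_def)
  next
    fix s assume "s \<in> set \<mu>"
    then obtain k where k: "k < length \<phi>" "s = \<mu> ! k" by (auto simp: in_set_conv_nth len)
    then show "y \<langle>$\<rangle> (n + 1 - int s) = n + 1 + int (row (set \<mu>) s)"
      "y \<langle>$\<rangle> (n + 1 + int (row (set \<mu>) s)) = n + 1 - int s"
      using * nth[OF k(1)] by (simp_all only: k(2) suc)
  next
    fix x assume x: "\<forall>s\<in>set \<mu>. x \<noteq> n + 1 - int s \<and> x \<noteq> n + 1 + int (row (set \<mu>) s)"
    have "x \<noteq> \<phi> ! k \<and> x \<noteq> n + int (Suc k)" if k: "k < length \<phi>" for k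
      using bspec[OF x, of "\<mu> ! k"] nth[OF k] k len by (simp only: suc nth_mem) simp
    then show "y \<langle>$\<rangle> x = x" using * by blast
  qed
qed

lemma ex_grass:
  assumes "strict_partition S"
  shows "\<exists>y. grass n S y"
proof -
  have fin: "finite S" and pos: "0 \<notin> S" using assms by (auto simp: strict_partition_def)
  define \<phi> where "\<phi> = map (\<lambda>s. n + 1 - int s) (rev (sorted_list_of_set S))"
  have "sorted_wrt (<) \<phi>"
    unfolding \<phi>_def sorted_wrt_map sorted_wrt_rev
    by (rule sorted_wrt_mono_rel[OF _ strict_sorted_list_of_set]) simp
  moreover have "1 \<le> s" if "s \<in> S" for s using pos that by (cases s) auto
  then have "\<forall>p\<in>set \<phi>. p \<le> n" using fin by (auto simp: \<phi>_def)
  moreover have "set (map (\<lambda>p. nat (n + 1 - p)) \<phi>) = S"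
    using fin by (simp add: \<phi>_def image_image)
  ultimately show ?thesis using form_imp_grass(2)[of \<phi> n] by metis
qed

definition grass_perm :: "int \<Rightarrow> nat set \<Rightarrow> int perm" where
  "grass_perm n S = (THE y. grass n S y)"

lemma grass_perm_eq: "grass n S y \<Longrightarrow> grass_perm n S = y"
  unfolding grass_perm_def using grass_unique by blast

lemma grass_grass_perm: "strict_partition S \<Longrightarrow> grass n S (grass_perm n S)"
  using ex_grass grass_perm_eq by metis

lemma grass_le:
  assumes y: "grass n S y" and c: "1 \<le> c"
  shows "c \<notin> S \<Longrightarrow> y \<langle>$\<rangle> (n + 1 - int c) = n + 1 - int c"
  using c by (intro grassD(3)[OF y]) auto

text \<open>The points \<open>n - c\<close> and \<open>n - c + 1\<close> are moved beyond
  \<open>n\<close> if \<open>Suc c\<close> and \<open>c\<close> are parts and fixed otherwise. If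
  both are parts, the larger one has the smaller row and hence the smaller image.\<close>

lemma grass_desc:
  assumes y: "grass n S y" and c: "1 \<le> c"
  shows "desc (n - int c) y \<longleftrightarrow> removable c S"
proof -
  have fin: "finite S" using grass_strict[OF y] by (simp add: strict_partition_def)
  have "y \<langle>$\<rangle> (n - int c) = (if Suc c \<in> S then n + 1 + int (row S (Suc c)) else n - int c)"
    using grassD(1)[OF y, of "Suc c"] grass_le[OF y, of "Suc c"] by auto
  moreover have "y \<langle>$\<rangle> (n - int c + 1) = (if c \<in> S then n + 1 + int (row S c) else n - int c + 1)"
    using grassD(1)[OF y, of "c"] grass_le[OF y c] by (auto simp: algebra_simps)
  ultimately show ?thesis using row_less[OF fin, of "Suc c" c] c
    by (auto simp: desc_def removable_def)
qed

lemma grass_rem: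
  assumes y: "grass n S y" and c: "1 \<le> c" and r: "removable c S"
  shows "grass n (lower c S) (rem (n - int c) y)"
proof -
  let ?S = "lower c S" and ?s = "simple_refl (n - int c)"
  note S = grass_strict[OF y]
  have Sc: "Suc c \<in> S" "c \<notin> S" using r by (auto simp: removable_def)
  have yc: "y \<langle>$\<rangle> (n - int c) = n + 1 + int (row S (Suc c))"
    "y \<langle>$\<rangle> (n + 1 + int (row S (Suc c))) = n - int c"
    using grassD(1,2)[OF y Sc(1)] by simp_all
  then have rem: "rem (n - int c) y = ?s * y * ?s" using c by (simp add: rem_def)
  have rowc: "row ?S c = row S (Suc c)"
  proof -
    have "{s' \<in> ?S. c < s'} = {s' \<in> S. Suc c < s'}" using c by (auto simp: lower_def)
    then show ?thesis by (simp add: row_def)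
  qed
  have rows: "row ?S s = row S s" if "s \<in> S" "s \<noteq> Suc c" for s
    using row_lower[OF S r that] .
  show ?thesis
    unfolding grass_def rem
  proof (intro conjI allI impI ballI)
    show "strict_partition ?S" by (rule lower_props(1)[OF S r])
  next
    fix s assume s: "s \<in> ?S"
    show "(?s * y * ?s) \<langle>$\<rangle> (n + 1 - int s) = n + 1 + int (row ?S s)"
      "(?s * y * ?s) \<langle>$\<rangle> (n + 1 + int (row ?S s)) = n + 1 - int s"
    proof (atomize (full), cases "s = c")
      case True
      then show "(?s * y * ?s) \<langle>$\<rangle> (n + 1 - int s) = n + 1 + int (row ?S s) \<and>
        (?s * y * ?s) \<langle>$\<rangle> (n + 1 + int (row ?S s)) = n + 1 - int s"
        using yc c rowc by (simp add: apply_mult apply_simple_refl)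
    next
      case False
      then have sS: "s \<in> S" "s \<noteq> Suc c" using s by (auto simp: lower_def)
      then show "(?s * y * ?s) \<langle>$\<rangle> (n + 1 - int s) = n + 1 + int (row ?S s) \<and>
        (?s * y * ?s) \<langle>$\<rangle> (n + 1 + int (row ?S s)) = n + 1 - int s"
        using grassD(1,2)[OF y sS(1)] rows[OF sS] False c by (auto simp: apply_mult apply_simple_refl)
    qed
  next
    fix x assume x: "\<forall>s\<in>?S. x \<noteq> n + 1 - int s \<and> x \<noteq> n + 1 + int (row ?S s)"
    have cS: "c \<in> ?S" using c by (simp add: lower_def)
    have xc: "x \<noteq> n - int c + 1" "x \<noteq> n + 1 + int (row S (Suc c))"
      using bspec[OF x cS] rowc by auto
    show "(?s * y * ?s) \<langle>$\<rangle> x = x"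
    proof (cases "x = n - int c")
      case True
      then show ?thesis using grass_le[OF y c Sc(2)]
        by (simp add: apply_mult apply_simple_refl algebra_simps)
    next
      case False
      have "y \<langle>$\<rangle> x = x"
      proof (rule grassD(3)[OF y])
        fix s assume s: "s \<in> S"
        show "x \<noteq> n + 1 - int s \<and> x \<noteq> n + 1 + int (row S s)"
        proof (cases "s = Suc c")
          case True
          then show ?thesis using False xc by auto
        next
          case ne: False
          then have "s \<in> ?S" using s by (simp add: lower_def)
          then show ?thesis using x rows[OF s ne] by metis
        qed
      qed
      then show ?thesis using False xc(1) by (simp add: apply_mult apply_simple_refl)
    qed
  qed
qed

text \<open>Letters \<open>n - c\<close> with \<open>c \<ge> 1\<close> keep the Grassmannian form
  and the same \<open>n\<close>, so they act through the partition alone.\<close>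

lemma elems_grass:
  assumes "\<And>S y. grass n S y \<Longrightarrow> G y = p S" "\<forall>c\<in>set cs. 1 \<le> c" "grass n S y"
  shows "elems inv_op t (map (\<lambda>c. n - int c) cs) G y = elems part_op t cs p S"
  using assms(2,3)
proof (induction cs arbitrary: S y)
  case Nil
  then show ?case using assms(1) by simp
next
  case (Cons c cs)
  then have c: "1 \<le> c" and y: "grass n S y" by auto
  have "inv_op (n - int c) (elems inv_op t (map (\<lambda>c. n - int c) cs) G) y = part_op c (elems part_op t cs p) S"
    using grass_desc[OF y c] grass_involution[OF y] Cons.IH[OF _ grass_rem[OF y c]] Cons.prems(1)
    by (auto simp: inv_op_def[of "n - int c"] part_op_def[of c])
  then show ?case using Cons.IH[OF _ y] Cons.prems(1) by (simp add: elem_def)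
qed

lemma I_Grassmannian_form:
  assumes y: "y \<in> involutions" "I_Grassmannian y" "y \<noteq> 1"
  shows "\<exists>n \<phi>. Grassmannian_form y n \<phi>"
proof -
  \<comment> \<open>The upper ends of the cycles, to be recognised as an interval starting at
    \<open>n + 1\<close>.\<close>
  define B where "B = {b. y \<langle>$\<rangle> b < b}"
  have "B \<subseteq> affected y" by (auto simp: B_def in_affected)
  then have fin: "finite B" by (rule finite_subset) simp
  have "B \<noteq> {}"
  proof
    assume "B = {}"
    then have "b \<le> y \<langle>$\<rangle> b" for b by (auto simp: B_def not_less)
    then have "y \<langle>$\<rangle> b = b" for b using involutionD[OF y(1), of b] by (metis order_antisym)
    then show False using y(3) by (auto simp: perm_eq_iff)
  qed
  define n where "n = Min B - 1"
  have n1: "n + 1 \<in> B" and min: "\<And>b. b \<in> B \<Longrightarrow> n + 1 \<le> b"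
    using fin \<open>B \<noteq> {}\<close> Min_in[of B] by (auto simp: n_def)
  have vn: "visible_descent y n"
  proof -
    have "y \<langle>$\<rangle> (n + 1) \<le> n" using n1 by (simp add: B_def)
    moreover have "n \<le> y \<langle>$\<rangle> n" using min[of n] by (force simp: B_def)
    ultimately show ?thesis by (simp add: visible_descent_def)
  qed
  \<comment> \<open>As \<open>y\<close> lowers \<open>b\<close>, only \<open>y (b - 1) < y b\<close>
    can keep \<open>b - 1\<close> from being a visible descent; then \<open>b - 1\<close> is lowered
    too.\<close>
  have step: "b - 1 \<in> B \<and> y \<langle>$\<rangle> (b - 1) < y \<langle>$\<rangle> b" if "b \<in> B" "b \<noteq> n + 1" for b
  proof -
    have "\<not> visible_descent y (b - 1)"
      using vn that(2) y(2) unfolding I_Grassmannian_def by force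
    then show ?thesis using that(1) by (auto simp: visible_descent_def B_def)
  qed
  define r where "r = card B"
  have down: "n + 1 + int k \<in> B \<Longrightarrow> j \<le> k \<Longrightarrow> n + 1 + int j \<in> B" for j k
  proof (induction k)
    case (Suc k)
    show ?case
    proof (cases "j = Suc k")
      case False
      have "n + 1 + int (Suc k) - 1 \<in> B" using step[OF Suc.prems(1)] by simp
      moreover have "n + 1 + int (Suc k) - 1 = n + 1 + int k" by simp
      ultimately have "n + 1 + int k \<in> B" by (simp only:)
      then show ?thesis using Suc.IH Suc.prems(2) False by simp
    qed (use Suc.prems in simp)
  qed simp
  have B: "B = (\<lambda>k. n + 1 + int k) ` {..<r}"
  proof -
    define K where "K = {k. n + 1 + int k \<in> B}"
    have BK: "B = (\<lambda>k. n + 1 + int k) ` K"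
      using min by (force simp: K_def image_iff intro: exI[of _ "nat (_ - n - 1)"])
    have "inj_on (\<lambda>k. n + 1 + int k) K" by (auto simp: inj_on_def)
    then have "finite K" using fin BK finite_imageD by metis
    moreover have "\<And>j k. k \<in> K \<Longrightarrow> j \<le> k \<Longrightarrow> j \<in> K" using down by (auto simp: K_def)
    ultimately obtain m where m: "K = {..<m}"
    proof (cases "K = {}")
      case False
      have "K = {..<Suc (Max K)}"
      proof (intro set_eqI iffI)
        fix k assume "k \<in> {..<Suc (Max K)}"
        then show "k \<in> K" using \<open>\<And>j k. k \<in> K \<Longrightarrow> j \<le> k \<Longrightarrow> j \<in> K\<close> Max_in[OF \<open>finite K\<close> False] by simp
      qed (use Max_ge[OF \<open>finite K\<close>] in \<open>simp add: less_Suc_eq_le\<close>)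
      then show thesis using that by blast
    qed (use that[of 0] in simp)
    have "r = m" using card_image[OF \<open>inj_on (\<lambda>k. n + 1 + int k) K\<close>] BK m by (simp add: r_def)
    then show ?thesis using BK m by simp
  qed
  define \<phi> where "\<phi> = map (\<lambda>k. y \<langle>$\<rangle> (n + 1 + int k)) [0..<r]"
  have inB: "n + 1 + int k \<in> B" if "k < r" for k using B that by auto
  have inc: "y \<langle>$\<rangle> (n + 1 + int j) < y \<langle>$\<rangle> (n + 1 + int k)" if "j < k" "k < r" for j k
    using that
  proof (induction k)
    case (Suc k)
    have "y \<langle>$\<rangle> (n + 1 + int (Suc k) - 1) < y \<langle>$\<rangle> (n + 1 + int (Suc k))"
      by (rule conjunct2[OF step[OF inB[OF Suc.prems(2)]]]) simp
    moreover have "n + 1 + int (Suc k) - 1 = n + 1 + int k" by simp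
    ultimately have "y \<langle>$\<rangle> (n + 1 + int k) < y \<langle>$\<rangle> (n + 1 + int (Suc k))" by (simp only:)
    then show ?case using Suc by (cases "j = k") auto
  qed simp
  \<comment> \<open>Otherwise \<open>y b\<close> lies in the interval \<open>B\<close> as well, but
    \<open>y\<close> raises it back to \<open>b\<close>.\<close>
  have le: "y \<langle>$\<rangle> b \<le> n" if b: "b \<in> B" for b
  proof (rule ccontr)
    assume *: "\<not> y \<langle>$\<rangle> b \<le> n"
    obtain k where "k < r" "b = n + 1 + int k" using b unfolding B by auto
    moreover have "y \<langle>$\<rangle> b < b" using b by (simp add: B_def)
    ultimately have "y \<langle>$\<rangle> b \<in> B" using * unfolding B
      by (intro image_eqI[of _ _ "nat (y \<langle>$\<rangle> b - n - 1)"]) auto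
    then show False using involutionD[OF y(1), of b] \<open>y \<langle>$\<rangle> b < b\<close> by (simp add: B_def)
  qed
  have len: "length \<phi> = r" and nth: "\<And>k. k < r \<Longrightarrow> \<phi> ! k = y \<langle>$\<rangle> (n + 1 + int k)"
    by (simp_all add: \<phi>_def)
  have suc: "n + int (Suc k) = n + 1 + int k" for k by simp
  have form: "y = prod_list (map (\<lambda>k. \<langle>\<phi> ! k \<leftrightarrow> n + int (Suc k)\<rangle>) [0..<length \<phi>])" (is "y = ?P")
  proof (rule perm_eqI)
    fix x
    have P: "(\<forall>k<r. ?P \<langle>$\<rangle> (\<phi> ! k) = n + int (Suc k) \<and> ?P \<langle>$\<rangle> (n + int (Suc k)) = \<phi> ! k) \<and>
      (\<forall>x. (\<forall>k<r. x \<noteq> \<phi> ! k \<and> x \<noteq> n + int (Suc k)) \<longrightarrow> ?P \<langle>$\<rangle> x = x)"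
      unfolding len
    proof (rule prod_transpositions)
      show "inj_on ((!) \<phi>) {..<r}" by (auto simp: inj_on_def nth apply_inj)
      show "\<phi> ! j \<noteq> n + int (Suc k)" if "j < r" "k < r" for j k
        using le[OF inB[OF that(1)]] that by (simp add: nth)
    qed (simp add: inj_on_def)
    consider k where "k < r" "x = \<phi> ! k" | k where "k < r" "x = n + int (Suc k)"
      | "\<forall>k<r. x \<noteq> \<phi> ! k \<and> x \<noteq> n + int (Suc k)" by blast
    then show "y \<langle>$\<rangle> x = ?P \<langle>$\<rangle> x"
    proof cases
      case (1 k)
      then show ?thesis using P involutionD[OF y(1), of "n + 1 + int k"] nth by simp
    next
      case (2 k)
      then have "?P \<langle>$\<rangle> x = \<phi> ! k" using P by blast
      then show ?thesis using 2 nth by (simp only: suc)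
    next
      case 3
      have "x \<notin> B" using 3 B by (auto simp: suc)
      moreover have "y \<langle>$\<rangle> x \<notin> B"
      proof
        assume "y \<langle>$\<rangle> x \<in> B"
        then obtain k where k: "k < r" "y \<langle>$\<rangle> x = n + 1 + int k" using B by auto
        then have "x = \<phi> ! k" using involutionD[OF y(1), of x] nth by simp
        then show False using 3 k by blast
      qed
      ultimately have "y \<langle>$\<rangle> x = x" using involutionD[OF y(1), of x] by (simp add: B_def)
      moreover have "?P \<langle>$\<rangle> x = x" using P 3 by blast
      ultimately show ?thesis by simp
    qed
  qed
  have "\<phi> \<noteq> []" using len \<open>B \<noteq> {}\<close> fin by (auto simp: r_def)
  moreover have "sorted_wrt (<) \<phi>" by (simp add: sorted_wrt_iff_nth_less len nth inc)
  moreover have "\<forall>p\<in>set \<phi>. p \<le> n" using le inB by (auto simp: \<phi>_def)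
  ultimately show ?thesis using form unfolding Grassmannian_form_def by blast
qed

text \<open>The points lowered by \<open>y\<close> are exactly \<open>n + 1, \<dots>, n + r\<close>,
  and \<phi> lists their images.\<close>

lemma Grassmannian_form_unique:
  assumes "Grassmannian_form y n \<phi>" "Grassmannian_form y n' \<phi>'"
  shows "n = n' \<and> \<phi> = \<phi>'"
proof -
  have descr: "{b. y \<langle>$\<rangle> b < b} = {n<..n + int (length \<phi>)} \<and> (\<forall>k<length \<phi>. \<phi> ! k = y \<langle>$\<rangle> (n + 1 + int k)) \<and> \<phi> \<noteq> []"
    if "Grassmannian_form y n \<phi>" for n \<phi>
  proof -
    have \<phi>: "sorted_wrt (<) \<phi>" "\<forall>p\<in>set \<phi>. p \<le> n" "\<phi> \<noteq> []"
      "y = prod_list (map (\<lambda>k. \<langle>\<phi> ! k \<leftrightarrow> n + int (Suc k)\<rangle>) [0..<length \<phi>])"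
      using that by (auto simp: Grassmannian_form_def)
    have le: "\<phi> ! k \<le> n" if "k < length \<phi>" for k using \<phi>(2) that by auto
    have "inj_on ((!) \<phi>) {..<length \<phi>}"
      using \<phi>(1) by (simp add: inj_on_nth strict_sorted_iff)
    moreover have "\<phi> ! j \<noteq> n + int (Suc k)" if "j < length \<phi>" for j k
      using le[OF that] by simp
    ultimately have *: "(\<forall>k<length \<phi>. y \<langle>$\<rangle> (\<phi> ! k) = n + int (Suc k) \<and> y \<langle>$\<rangle> (n + int (Suc k)) = \<phi> ! k) \<and>
      (\<forall>x. (\<forall>k<length \<phi>. x \<noteq> \<phi> ! k \<and> x \<noteq> n + int (Suc k)) \<longrightarrow> y \<langle>$\<rangle> x = x)"
      unfolding \<phi>(4) by (intro prod_transpositions) (auto simp: inj_on_def)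
    have "y \<langle>$\<rangle> b < b \<longleftrightarrow> b \<in> {n<..n + int (length \<phi>)}" for b
    proof
      assume b: "y \<langle>$\<rangle> b < b"
      then obtain k where k: "k < length \<phi>" "b = \<phi> ! k \<or> b = n + int (Suc k)" using * by (metis less_irrefl)
      then have "b = n + int (Suc k)" using * b le[OF k(1)] by auto
      then show "b \<in> {n<..n + int (length \<phi>)}" using k by auto
    next
      assume "b \<in> {n<..n + int (length \<phi>)}"
      then have k: "nat (b - n - 1) < length \<phi>" "b = n + int (Suc (nat (b - n - 1)))" by auto
      then have "y \<langle>$\<rangle> b = \<phi> ! nat (b - n - 1)" using * by metis
      then show "y \<langle>$\<rangle> b < b" using le[OF k(1)] k(2) by linarith
    qed
    moreover have "\<phi> ! k = y \<langle>$\<rangle> (n + 1 + int k)" if "k < length \<phi>" for k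
    proof -
      have "n + 1 + int k = n + int (Suc k)" by simp
      then show ?thesis using * that by (simp only:)
    qed
    ultimately show ?thesis using \<phi>(3) by blast
  qed
  note d = descr[OF assms(1)] and d' = descr[OF assms(2)]
  have *: "{n<..n + int (length \<phi>)} = {n'<..n' + int (length \<phi>')}" using d d' by simp
  have "length \<phi> > 0" "length \<phi>' > 0" using d d' by auto
  then have "n + 1 \<in> {n<..n + int (length \<phi>)}" "n' + 1 \<in> {n'<..n' + int (length \<phi>')}"
    unfolding greaterThanAtMost_iff by linarith+
  then have "n = n'" using * by auto
  moreover have "length \<phi> = length \<phi>'"
  proof -
    have "length \<phi> = card {n<..n + int (length \<phi>)}" by simp
    also have "\<dots> = card {n'<..n' + int (length \<phi>')}" by (simp only: *)
    finally show ?thesis by simp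
  qed
  ultimately show ?thesis using d d' by (auto intro: nth_equalityI)
qed

lemma shape_eq:
  assumes "Grassmannian_form y n \<phi>" "y \<noteq> 1"
  shows "shape y = map (\<lambda>p. nat (n + 1 - p)) \<phi>"
proof -
  have "(THE \<mu>. \<exists>n \<phi>. Grassmannian_form y n \<phi> \<and> \<mu> = map (\<lambda>p. nat (n + 1 - p)) \<phi>) = map (\<lambda>p. nat (n + 1 - p)) \<phi>"
    using assms(1) Grassmannian_form_unique[OF assms(1)] by (intro the_equality) blast+
  then show ?thesis using assms(2) by (simp add: shape_def)
qed

lemma I_Grassmannian_grass:
  assumes "y \<in> involutions" "I_Grassmannian y"
  shows "sorted_wrt (>) (shape y) \<and> (\<exists>n. grass n (set (shape y)) y)"
proof (cases "y = 1")
  case True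
  then show ?thesis using grass_empty by (auto simp: shape_def)
next
  case False
  then obtain n \<phi> where f: "Grassmannian_form y n \<phi>" using I_Grassmannian_form assms by blast
  then show ?thesis using form_imp_grass[of \<phi> n y] shape_eq[OF f False]
    by (auto simp: Grassmannian_form_def)
qed

section \<open>The coefficients agree\<close>

lemma sum_strict_partition:
  assumes "strict_partition S"
  shows "\<Sum>{1..card S} \<le> \<Sum>S" "\<Sum>S = \<Sum>{1..card S} \<Longrightarrow> S = {1..card S}"
proof -
  have "\<Sum>{1..card S} \<le> \<Sum>S \<and> (\<Sum>S = \<Sum>{1..card S} \<longrightarrow> S = {1..card S})"
    using assms
  proof (induction "card S" arbitrary: S)
    case 0
    then show ?case by (simp add: strict_partition_def)
  next
    case (Suc r)
    have fin: "finite S" and pos: "0 \<notin> S" using Suc.prems by (auto simp: strict_partition_def)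
    have ne: "S \<noteq> {}" using Suc.hyps(2) by auto
    let ?m = "Max S"
    have m: "?m \<in> S" using fin ne by simp
    have sub: "S \<subseteq> {1..?m}"
      using fin pos by (auto simp: Suc_le_eq intro: gr0I)
    have "card S \<le> ?m" using card_mono[OF _ sub] by simp
    moreover have "\<Sum>{1..r} \<le> \<Sum>(S - {?m})"
    proof -
      have r: "r = card (S - {?m})" using Suc.hyps(2) m by simp
      show ?thesis using Suc.hyps(1)[OF r] Suc.prems r by (simp add: strict_partition_def)
    qed
    moreover have "\<Sum>S = ?m + \<Sum>(S - {?m})" using m fin by (simp add: sum.remove)
    moreover have "\<Sum>{1..card S} = \<Sum>{1..r} + card S" using Suc.hyps(2)[symmetric] by simp
    moreover have "S = {1..card S}" if "?m = card S"
      using sub that by (intro card_subset_eq) auto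
    ultimately show ?case by linarith
  qed
  then show "\<Sum>{1..card S} \<le> \<Sum>S" "\<Sum>S = \<Sum>{1..card S} \<Longrightarrow> S = {1..card S}" by blast+
qed

text \<open>Without removable boxes off the diagonal, each part above 1 brings the next smaller one
  along: a staircase.\<close>

lemma no_removable:
  assumes S: "strict_partition S" and no: "\<And>c. 1 \<le> c \<Longrightarrow> \<not> removable c S"
  shows "S = {1..card S}"
proof -
  have fin: "finite S" and pos: "0 \<notin> S" using S by (auto simp: strict_partition_def)
  have down: "s \<in> S \<Longrightarrow> 1 \<le> k \<Longrightarrow> k \<le> s \<Longrightarrow> k \<in> S" for s k
  proof (induction s)
    case (Suc s)
    then show ?case using no[of s] by (cases "k = Suc s") (auto simp: removable_def)
  qed (use pos in simp)
  show ?thesis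
  proof (cases "S = {}")
    case False
    have "S = {1..Max S}"
      using down[OF Max_in[OF fin False]] Max_ge[OF fin] pos by (auto simp: Suc_le_eq intro: gr0I)
    then show ?thesis by (metis card_atLeastAtMost diff_Suc_1)
  qed simp
qed

text \<open>The involution obtained from \<open>grass_perm n {1..r}\<close> by removing the letters
  \<open>n, \<dots>, n + j - 1\<close>.\<close>

definition stair :: "int \<Rightarrow> int \<Rightarrow> int \<Rightarrow> int perm \<Rightarrow> bool" where
  "stair n r j y \<longleftrightarrow> (\<forall>x. y \<langle>$\<rangle> x =
     (if n - r + 1 \<le> x \<and> x \<le> n - r + j then x + r - 1
      else if n - r + j < x \<and> x < n then x + r
      else if n \<le> x \<and> x < n + j then x - r + 1
      else if x = n + j then n + r
      else if n + j < x \<and> x < n + r then x - r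
      else if x = n + r then n + j
      else x))"

lemma row_interval: "1 \<le> s \<Longrightarrow> s \<le> r \<Longrightarrow> row {1..r} s = r - s"
proof -
  assume "1 \<le> s" "s \<le> r"
  then have "{s' \<in> {1..r}. s < s'} = {s<..r}" by auto
  then show ?thesis by (simp add: row_def)
qed

lemma grass_interval_iff:
  "grass n {1..r} y \<longleftrightarrow> (\<forall>x. y \<langle>$\<rangle> x =
     (if n - int r < x \<and> x \<le> n then x + int r
      else if n < x \<and> x \<le> n + int r then x - int r else x))"
proof
  assume y: "grass n {1..r} y"
  show "\<forall>x. y \<langle>$\<rangle> x =
     (if n - int r < x \<and> x \<le> n then x + int r
      else if n < x \<and> x \<le> n + int r then x - int r else x)"
  proof
    fix x
    consider "n - int r < x" "x \<le> n" | "n < x" "x \<le> n + int r" | "x \<le> n - int r \<or> n + int r < x"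
      by linarith
    then show "y \<langle>$\<rangle> x =
     (if n - int r < x \<and> x \<le> n then x + int r
      else if n < x \<and> x \<le> n + int r then x - int r else x)"
    proof cases
      case 1
      define s where "s = nat (n + 1 - x)"
      have s: "1 \<le> s" "s \<le> r" "x = n + 1 - int s" using 1 by (auto simp: s_def)
      then show ?thesis using grassD(1)[OF y, of s] 1 row_interval[of s r] by simp
    next
      case 2
      define s where "s = nat (n + 1 + int r - x)"
      have s: "1 \<le> s" "s \<le> r" "x = n + 1 + int (r - s)" using 2 by (auto simp: s_def)
      then show ?thesis using grassD(2)[OF y, of s] 2 row_interval[of s r] by simp
    next
      case 3
      then show ?thesis using grass_support[OF y, of r x] by auto
    qed
  qed
next
  assume *: "\<forall>x. y \<langle>$\<rangle> x =
     (if n - int r < x \<and> x \<le> n then x + int r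
      else if n < x \<and> x \<le> n + int r then x - int r else x)"
  show "grass n {1..r} y"
    unfolding grass_def
  proof (intro conjI ballI allI impI)
    show "strict_partition {1..r}" by (simp add: strict_partition_def)
  next
    fix s assume "s \<in> {1..r}"
    then show "y \<langle>$\<rangle> (n + 1 - int s) = n + 1 + int (row {1..r} s)"
      "y \<langle>$\<rangle> (n + 1 + int (row {1..r} s)) = n + 1 - int s"
      using row_interval[of s r] by (auto simp: *[rule_format])
  next
    fix x assume x: "\<forall>s\<in>{1..r}. x \<noteq> n + 1 - int s \<and> x \<noteq> n + 1 + int (row {1..r} s)"
    have "\<not> (n - int r < x \<and> x \<le> n)"
    proof
      assume "n - int r < x \<and> x \<le> n"
      then have "nat (n + 1 - x) \<in> {1..r}" "x = n + 1 - int (nat (n + 1 - x))" by auto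
      then show False using x by blast
    qed
    moreover have "\<not> (n < x \<and> x \<le> n + int r)"
    proof
      assume a: "n < x \<and> x \<le> n + int r"
      define s where "s = nat (n + 1 + int r - x)"
      have s: "1 \<le> s" "s \<le> r" "x = n + 1 + int (r - s)" using a by (auto simp: s_def)
      then show False using bspec[OF x, of s] row_interval[of s r] by simp
    qed
    ultimately show "y \<langle>$\<rangle> x = x" by (auto simp: *[rule_format])
  qed
qed

lemma stair_step:
  assumes y: "stair n r j y" and j: "0 \<le> j" "j < r - 1"
  shows "desc (n + j) y" "stair n r (j + 1) (rem (n + j) y)"
proof -
  note val = y[unfolded stair_def, rule_format]
  show "desc (n + j) y" using j by (auto simp: desc_def val)
  have "y \<langle>$\<rangle> (n + j) \<noteq> n + j + 1" using j by (auto simp: val)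
  then show "stair n r (j + 1) (rem (n + j) y)"
    using j unfolding stair_def rem_def by (auto simp: apply_mult apply_simple_refl val)
qed

lemma stair_last:
  assumes y: "stair n r (r - 1) y" and r: "1 \<le> r"
  shows "desc (n + r - 1) y" "rem (n + r - 1) y \<langle>$\<rangle> x =
     (if n - r < x \<and> x < n then x + (r - 1)
      else if n \<le> x \<and> x < n + (r - 1) then x - (r - 1) else x)"
proof -
  note val = y[unfolded stair_def, rule_format]
  show "desc (n + r - 1) y" using r by (auto simp: desc_def val)
  have "y \<langle>$\<rangle> (n + r - 1) = n + r - 1 + 1" using r by (auto simp: val)
  then show "rem (n + r - 1) y \<langle>$\<rangle> x =
     (if n - r < x \<and> x < n then x + (r - 1)
      else if n \<le> x \<and> x < n + (r - 1) then x - (r - 1) else x)"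
    using r unfolding rem_def by (auto simp: apply_mult apply_simple_refl val)
qed

lemma ivl_Suc: "ivl lo (Suc k) = ivl lo k @ [lo + int k]"
  by (simp add: ivl_def)

lemma ivl_append: "ivl lo (j + k) = ivl lo j @ ivl (lo + int j) k"
  by (induction k) (simp_all add: ivl_Suc, simp_all add: ivl_def)


lemma elems_expand_le:
  assumes lin: "\<And>i. lin (u i)" and M: "length is \<le> M"
  shows "elems u t is g x = (\<Sum>k\<le>M. t ^ k * elems_coeff u is k g x)"
  unfolding elems_expand[of u, OF lin] using M
  by (intro sum.mono_neutral_left) (auto simp: elems_coeff_big[of u, OF lin])

lemma elems_coeff_skip_left:
  "\<forall>i\<in>set is. \<forall>g. u i g y = 0 \<Longrightarrow> elems_coeff u (is @ js) k g y = elems_coeff u js k g y"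
proof (induction "is")
  case (Cons i "is")
  then show ?case by (cases k) auto
qed simp

text \<open>Removing letters below \<open>h\<close> keeps all points beyond \<open>h\<close> fixed,
  so no letter from \<open>h\<close> on ever becomes a descent.\<close>

lemma elems_coeff_skip_right:
  assumes "\<And>x. h < x \<Longrightarrow> y \<langle>$\<rangle> x = x" "\<forall>i\<in>set is. i < h" "\<forall>j\<in>set js. h \<le> j"
  shows "elems_coeff inv_op (is @ js) k g y = elems_coeff inv_op is k g y"
  using assms
proof (induction "is" arbitrary: k y)
  case Nil
  obtain m where m: "\<And>x. x < m \<Longrightarrow> y \<langle>$\<rangle> x = x" using affected_bound[of y] by blast
  have "\<not> desc j y" if "h \<le> j" for j
    using supp_desc(2)[of m h y j] m Nil.prems(1) that by force
  then show ?case
    using elems_coeff_skip_left[of js inv_op y "[]" k g] Nil.prems(3)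
    by (auto simp: inv_op_def[of _ _ y])
next
  case (Cons i "is")
  have IH: "elems_coeff inv_op (is @ js) k g y = elems_coeff inv_op is k g y" for k
    using Cons.prems by (intro Cons.IH) auto
  have "rem i y \<langle>$\<rangle> x = x" if "h < x" for x
    using Cons.prems(1)[OF that] Cons.prems(2) that
    by (auto simp: rem_def apply_mult apply_simple_refl)
  then have "elems_coeff inv_op (is @ js) j g (rem i y) = elems_coeff inv_op is j g (rem i y)" for j
    using Cons.prems by (intro Cons.IH) auto
  then show ?case using IH by (cases k) (simp_all add: inv_op_def[of i])
qed

lemma elems_coeff_full:
  assumes "\<And>i. lin (u i)"
  shows "elems_coeff u is (length is) g = foldr u is g"
  by (induction "is") (auto simp: elems_coeff_big[of u, OF assms])

lemma stair_chain:
  assumes "stair n (int r) j y" "y \<in> involutions" "0 \<le> j" "j + int k = int r - 1"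
  shows "foldr inv_op (ivl (n + j) (Suc k)) g y = g (grass_perm (n - 1) {1..r - 1})"
  using assms
proof (induction k arbitrary: j y)
  case 0
  then have j: "j = int r - 1" "1 \<le> r" by auto
  have y: "stair n (int r) (int r - 1) y" using 0 j by simp
  note last = stair_last[OF y]
  have "grass (n - 1) {1..r - 1} (rem (n + int r - 1) y)"
    unfolding grass_interval_iff using last(2) j(2) by (auto simp: of_nat_diff)
  then have "grass_perm (n - 1) {1..r - 1} = rem (n + int r - 1) y" by (rule grass_perm_eq)
  then show ?case using last(1) j 0(2) by (simp add: ivl_def inv_op_def add_diff_eq)
next
  case (Suc k)
  have j: "j < int r - 1" using Suc.prems by simp
  note step = stair_step[OF Suc.prems(1,3) j]
  have "ivl (n + j) (Suc (Suc k)) = (n + j) # ivl (n + (j + 1)) (Suc k)"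
    using ivl_append[of "n + j" 1 "Suc k"] by (simp add: ivl_def add.assoc)
  moreover have "foldr inv_op (ivl (n + (j + 1)) (Suc k)) g (rem (n + j) y) = g (grass_perm (n - 1) {1..r - 1})"
    using Suc.prems by (intro Suc.IH step(2) rem_props(1)[OF Suc.prems(2) step(1)]) auto
  ultimately show ?case using step(1) Suc.prems(2) by (simp add: inv_op_def[of "n + j"])
qed

text \<open>The counterpart of removing one box from each row of the staircase, which leaves the
  staircase of size \<open>r - 1\<close>; on the side of involutions the visible descent shifts to
  \<open>n - 1\<close>.\<close>

lemma grass_stair:
  assumes y: "grass n {1..r} y" and r: "1 \<le> r"
  shows "foldr inv_op (ivl n r) g y = g (grass_perm (n - 1) {1..r - 1})"
proof -
  have "stair n (int r) 0 y"
    using y[unfolded grass_interval_iff, rule_format] r by (auto simp: stair_def)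
  then show ?thesis
    using stair_chain[of n r 0 y "r - 1" g] grass_involution[OF y] r by (simp add: of_nat_diff)
qed

lemma rank_grass:
  assumes "grass n S y"
  shows "rank y = 4 * \<Sum>S"
  using assms
proof (induction "\<Sum>S" arbitrary: n S y rule: less_induct)
  case less
  note S = grass_strict[OF less.prems]
  show ?case
  proof (cases "\<exists>c\<ge>1. removable c S")
    case True
    then obtain c where c: "1 \<le> c" "removable c S" by blast
    have "rank (rem (n - int c) y) = 4 * \<Sum>(lower c S)"
      using grass_rem[OF less.prems c] lower_props(2)[OF S c(2)] by (intro less.hyps) auto
    then show ?thesis
      using rank_rem[OF grass_involution[OF less.prems]] grass_desc[OF less.prems c(1)] c(2)
        lower_props(2)[OF S c(2)] by simp
  next
    case False
    define r where "r = card S"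
    have Sr: "S = {1..r}" using no_removable[OF S] False by (auto simp: r_def)
    show ?thesis
    proof (cases "r = 0")
      case True
      then have "y = 1" using grass_unique[OF less.prems] grass_empty Sr by simp
      then show ?thesis using True Sr by (simp add: rank_def)
    next
      \<comment> \<open>For a staircase no letter below \<open>n\<close> is available; removing the
        \<open>r\<close> letters from \<open>n\<close> on leads to the next smaller
        staircase.\<close>
      case r: False
      define z where "z = grass_perm (n - 1) {1..r - 1}"
      have z: "grass (n - 1) {1..r - 1} z"
        unfolding z_def by (rule grass_grass_perm) (simp add: strict_partition_def)
      have y: "grass n {1..r} y" using less.prems Sr by simp
      have chain: "foldr inv_op (ivl n r) (delta z) y = 1"
        using grass_stair[OF y, of "delta z"] r by (simp add: z_def delta_def)
      moreover have "ivl n r \<noteq> []" using r by (simp add: ivl_def)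
      ultimately obtain x where x: "x \<in> involutions" "y = fold dem_conj (rev (ivl n r)) x" "rank y = rank x + 4 * length (ivl n r)"
        using inv_op_word2[of "ivl n r" "delta z" y] by auto
      then have "delta z x = 1" using inv_op_word1[of x "ivl n r" "delta z"] chain by simp
      then have "x = z" by (simp add: delta_def split: if_splits)
      have sum: "\<Sum>{1..r} = r + \<Sum>{1..r - 1}" using r by (cases r) auto
      have "rank z = 4 * \<Sum>{1..r - 1}" using z sum r by (intro less.hyps) (auto simp: Sr)
      then show ?thesis using x(3) \<open>x = z\<close> sum by (simp add: Sr ivl_def)
    qed
  qed
qed

text \<open>Contents \<open>0, \<dots>, c - 1\<close> turn the staircase into
  \<open>{1..r} - {c}\<close>. Skipping content \<open>c\<close> would leave too few parts for
  \<open>r - c\<close> boxes, so only one term survives.\<close>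

lemma part_op_stair:
  assumes "c \<le> r" "r \<le> b" "1 \<le> r"
  shows "elems_coeff part_op [c..<b] (r - c) p ({1..r} - {c}) = p {1..r - 1}"
  using assms
proof (induction "r - c" arbitrary: c)
  case 0
  then have "c = r" by simp
  moreover have "{1..r} - {r} = {1..r - 1}" using 0 by auto
  ultimately show ?case by simp
next
  case (Suc k)
  have w: "[c..<b] = c # [Suc c..<b]" using Suc by (intro upt_conv_Cons) simp
  let ?S = "{1..r} - {c}"
  have "{s \<in> ?S. s > Suc c} = {Suc c<..r}" by auto
  then have "card {s \<in> ?S. s > Suc c} < Suc k" using Suc.hyps(2) by simp
  then have "elems_coeff part_op [Suc c..<b] (Suc k) p ?S = 0"
    by (intro elems_coeff_degree) auto
  moreover have "removable c ?S" "lower c ?S = {1..r} - {Suc c}"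
    using Suc by (auto simp: removable_def lower_def)
  moreover have "elems_coeff part_op [Suc c..<b] (r - Suc c) p ({1..r} - {Suc c}) = p {1..r - 1}"
    using Suc by (intro Suc.hyps(1)) auto
  moreover have "r - c = Suc k" "r - Suc c = k" using Suc.hyps(2) by auto
  ultimately show ?case by (simp add: w part_op_def)
qed

section \<open>Induction on the size of the shape\<close>

definition coeff_F :: "int \<Rightarrow> nat set \<Rightarrow> nat list \<Rightarrow> int" where
  "coeff_F n S l = inv_stanley (grass_perm n S) (mset (mono_seq l))"

definition coeff_P :: "nat set \<Rightarrow> nat list \<Rightarrow> int" where
  "coeff_P S l = int (card (tabs (diagram S) (\<lambda>_ e. unmark e \<le> length l) (mset (mono_seq l))))"

lemma coeff_F_iter:
  assumes "strict_partition S" "S \<subseteq> {1..b}" "lo \<le> n + 1 - int b" "n + int (card S) \<le> lo + int N"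
  shows "coeff_F n S l = iter_coeff inv_op (ivl lo N) (delta 1) l (grass_perm n S)"
  unfolding coeff_F_def
  using grass_support[OF grass_grass_perm[OF assms(1)] assms(2)] assms(3,4)
  by (intro inv_stanley_iter_coeff) auto

lemma coeff_P_iter:
  assumes "strict_partition S" "S \<subseteq> {1..Suc m}"
  shows "coeff_P S l = iter_coeff part_op (K_word m) (delta {}) l S"
  unfolding coeff_P_def by (rule card_tabs_iter_coeff[OF assms])

context
  fixes n :: int and S :: "nat set" and m :: nat
  assumes S: "strict_partition S" "S \<subseteq> {1..Suc m}"
    and IH: "\<And>n S' l. strict_partition S' \<Longrightarrow> \<Sum>S' < \<Sum>S \<Longrightarrow> coeff_F n S' l = coeff_P S' l"
begin

text \<open>The letters \<open>n - m, \<dots>, n + m\<close>, in the same arrangement as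
  \<open>K_word m\<close>: \<open>n - c\<close> for \<open>c = m, \<dots>, 1\<close>, followed by
  \<open>n, \<dots>, n + m\<close>.\<close>

abbreviation "letters \<equiv> ivl (n - int m) (m + Suc m)"
abbreviation "gF \<equiv> iter_coeff inv_op letters (delta 1)"
abbreviation "gP \<equiv> iter_coeff part_op (K_word m) (delta {})"
abbreviation "yS \<equiv> grass_perm n S"
abbreviation "rS \<equiv> card S"

lemma card_bound: "S' \<subseteq> {1..Suc m} \<Longrightarrow> card S' \<le> Suc m"
  using card_mono[of "{1..Suc m}" S'] by simp

lemma F_iter: "strict_partition S' \<Longrightarrow> S' \<subseteq> {1..Suc m} \<Longrightarrow> coeff_F n S' l = gF l (grass_perm n S')"
  using card_bound[of S'] by (intro coeff_F_iter) auto

lemma W_split: "letters = map (\<lambda>c. n - int c) (rev [1..<Suc m]) @ ivl n (Suc m)"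
proof -
  have "ivl (n - int k) k = map (\<lambda>c. n - int c) (rev [1..<Suc k])" for k
  proof (rule nth_equalityI)
    fix i assume "i < length (ivl (n - int k) k)"
    then show "ivl (n - int k) k ! i = map (\<lambda>c. n - int c) (rev [1..<Suc k]) ! i"
      by (simp add: ivl_def rev_nth del: upt_Suc) 
  qed (simp add: ivl_def)
  then show ?thesis using ivl_append[of "n - int m" m "Suc m"] by (simp only: diff_add_cancel)
qed

lemma K_word_split: "K_word m = rev [1..<Suc m] @ [0..<Suc m]"
  by (simp add: K_word_def upt_conv_Cons del: upt_Suc)

text \<open>The degree bound on the difference: its parts from letters below \<open>n\<close> and
  from unprimed contents \<open>\<ge> 1\<close> are inverted away, and what is left has degree at
  most \<open>rS\<close>.\<close>

lemma coeff_large: "rS < k \<Longrightarrow> gF (k # l) yS = gP (k # l) S"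
proof -
  assume k: "rS < k"
  \<comment> \<open>The letters from \<open>n\<close> on leave the Grassmannian form; their effect
    is recorded as a function of the partition, so that the common factor
    \<open>rev [1..<Suc m]\<close> can be applied to \<open>X\<close> and \<open>Z\<close>
    alike.\<close>
  define X where "X = (\<lambda>t S. elems inv_op t (ivl n (Suc m)) (gF l) (grass_perm n S))"
  define Z where "Z = (\<lambda>t. elems part_op t [0..<Suc m] (gP l))"
  define Y where "Y = (\<lambda>t. elems part_op t (rev [1..<Suc m]) (\<lambda>S. X t S - Z t S))"
  let ?N = "max (length letters) (length (K_word m))"
  let ?dF = "\<lambda>S k. elems_coeff inv_op letters k (gF l) (grass_perm n S) - elems_coeff part_op (K_word m) k (gP l) S"
  have Y: "Y t S' = (\<Sum>k\<le>?N. t ^ k * ?dF S' k)" if S': "strict_partition S'" for S' t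
  proof -
    have "elems part_op t (rev [1..<Suc m]) (X t) S' =
        elems inv_op t (map (\<lambda>c. n - int c) (rev [1..<Suc m])) (elems inv_op t (ivl n (Suc m)) (gF l)) (grass_perm n S')"
      using grass_grass_perm[OF S'] grass_perm_eq
      by (intro elems_grass[symmetric]) (auto simp: X_def)
    also have "\<dots> = elems inv_op t letters (gF l) (grass_perm n S')" by (simp only: W_split elems_append)
    finally have 1: "elems part_op t (rev [1..<Suc m]) (X t) S' = elems inv_op t letters (gF l) (grass_perm n S')" .
    have 2: "elems part_op t (rev [1..<Suc m]) (Z t) S' = elems part_op t (K_word m) (gP l) S'"
      by (simp add: Z_def K_word_split del: upt_Suc)
    have "Y t S' = elems inv_op t letters (gF l) (grass_perm n S') - elems part_op t (K_word m) (gP l) S'"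
      unfolding Y_def using 1 2 by (subst lin_diff) (auto intro: elems_lin lin_part_op)
    also have "\<dots> = (\<Sum>k\<le>?N. t ^ k * ?dF S' k)"
      unfolding right_diff_distrib sum_subtractf
      by (intro arg_cong2[where f = "(-)"] elems_expand_le lin_inv_op lin_part_op) auto
    finally show ?thesis .
  qed
  have "Y t S' = 0" if S': "strict_partition S'" "S' \<subseteq> {1..Suc m}" "\<Sum>S' < \<Sum>S" for t S'
  proof -
    have "?dF S' k = 0" for k
      using IH[OF S'(1,3), of n "k # l"] F_iter[OF S'(1,2), of "k # l"] coeff_P_iter[OF S'(1,2), of "k # l"]
      by simp
    then show ?thesis by (simp add: Y[OF S'(1)])
  qed
  \<comment> \<open>\<open>Y\<close> vanishes on all smaller partitions, hence the inverse of the
    common factor does not change its value at \<open>S\<close>.\<close>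
  then have tri: "elems part_op (- t) [1..<Suc m] (Y t) S = Y t S" for t
    by (intro elems_part_op_triangular[OF S]) auto
  have "X t S - Z t S = Y t S" for t
  proof -
    have "elems part_op (- t) [1..<Suc m] (Y t) = (\<lambda>S. X t S - Z t S)"
      unfolding Y_def by (rule part.H_inverse)
    then show ?thesis using tri[of t] by (simp add: fun_eq_iff)
  qed
  moreover have "X t S - Z t S = (\<Sum>k\<le>?N. t ^ k *
      (elems_coeff inv_op (ivl n (Suc m)) k (gF l) yS - elems_coeff part_op [0..<Suc m] k (gP l) S))" for t
  proof -
    have "length (ivl n (Suc m)) \<le> ?N" "length [0..<Suc m] \<le> ?N" by (auto simp: ivl_def)
    then show ?thesis
      unfolding X_def Z_def right_diff_distrib sum_subtractf
      by (intro arg_cong2[where f = "(-)"] elems_expand_le lin_inv_op lin_part_op)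
  qed
  ultimately have "(\<Sum>k\<le>?N. t ^ k * (?dF S k -
      (elems_coeff inv_op (ivl n (Suc m)) k (gF l) yS - elems_coeff part_op [0..<Suc m] k (gP l) S))) = 0" for t
    using Y[OF S(1), of t] by (simp add: right_diff_distrib sum_subtractf)
  note zero = int_poly_zero[OF this]
  \<comment> \<open>The involution fixes all points beyond \<open>n + rS\<close>, which leaves only
    the \<open>rS\<close> letters \<open>n, \<dots>, n + rS - 1\<close>.\<close>
  have F0: "elems_coeff inv_op (ivl n (Suc m)) k (gF l) yS = 0"
  proof -
    have "rS \<le> Suc m" using card_bound[OF S(2)] .
    then have split: "ivl n (Suc m) = ivl n rS @ ivl (n + int rS) (Suc m - rS)"
      using ivl_append[of n rS "Suc m - rS"] by simp
    have "elems_coeff inv_op (ivl n (Suc m)) k (gF l) yS = elems_coeff inv_op (ivl n rS) k (gF l) yS"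
      unfolding split
      using grass_support[OF grass_grass_perm[OF S(1)] S(2)]
      by (intro elems_coeff_skip_right[where h = "n + int rS"]) (auto simp: set_ivl)
    also have "\<dots> = 0" using k by (simp add: elems_coeff_big[of inv_op, OF lin_inv_op] ivl_def)
    finally show ?thesis .
  qed
  have P0: "elems_coeff part_op [0..<Suc m] k (gP l) S = 0"
  proof (rule elems_coeff_degree)
    show "finite S" using S(1) by (simp add: strict_partition_def)
    then have "card {s \<in> S. 0 < s} \<le> rS" by (intro card_mono) auto
    then show "card {s \<in> S. 0 < s} < k" using k by simp
  qed
  show ?thesis
  proof (cases "k \<le> ?N")
    case True
    then show ?thesis using zero[of k] F0 P0 by simp
  next
    case False
    then show ?thesis
      by (simp add: elems_coeff_big[of inv_op, OF lin_inv_op] elems_coeff_big[of part_op, OF lin_part_op])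
  qed
qed

text \<open>A staircase has no removable box off the diagonal, so the first removals come from
  letters \<open>\<ge> n\<close> and contents \<open>\<ge> 0\<close> in increasing order. Taking
  \<open>rS\<close> of them is possible in one way only, leading to the smaller staircase on both
  sides.\<close>

lemma coeff_stair:
  assumes Sr: "S = {1..rS}" and r: "1 \<le> rS"
  shows "gF (rS # l) yS = gP (rS # l) S"
proof -
  have y: "grass n {1..rS} yS" using grass_grass_perm[OF S(1)] Sr by metis
  have rm: "rS \<le> Suc m" using card_bound[OF S(2)] .
  have norem: "\<not> removable c S" if "1 \<le> c" for c
    using that by (subst Sr) (auto simp: removable_def)
  let ?S = "{1..rS - 1}"
  have sum: "\<Sum>{1..rS} = rS + \<Sum>?S" using r by (cases rS) auto
  have S': "strict_partition ?S" "\<Sum>?S < \<Sum>S" "?S \<subseteq> {1..m}" "?S \<subseteq> {1..Suc m}"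
    using rm r sum Sr by (auto simp: strict_partition_def)
  have "gF (rS # l) yS = elems_coeff inv_op (ivl n (Suc m)) rS (gF l) yS"
  proof -
    have "inv_op i g yS = 0" if i: "i \<in> set (map (\<lambda>c. n - int c) (rev [1..<Suc m]))" for i g
    proof -
      obtain c where "i = n - int c" "1 \<le> c" using i by auto
      then show ?thesis
        using grass_desc[OF grass_grass_perm[OF S(1)], of c n] norem[of c] by (simp add: inv_op_def)
    qed
    then show ?thesis
      unfolding iter_coeff_Cons by (subst (1) W_split) (rule elems_coeff_skip_left, blast)
  qed
  also have "\<dots> = elems_coeff inv_op (ivl n rS) rS (gF l) yS"
  proof -
    have split: "ivl n (Suc m) = ivl n rS @ ivl (n + int rS) (Suc m - rS)"
      using ivl_append[of n rS "Suc m - rS"] rm by simp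
    show ?thesis
      unfolding split
      using grass_support[OF grass_grass_perm[OF S(1)] S(2)]
      by (intro elems_coeff_skip_right[where h = "n + int rS"]) (auto simp: set_ivl)
  qed
  also have "\<dots> = gF l (grass_perm (n - 1) ?S)"
    using elems_coeff_full[of inv_op "ivl n rS", OF lin_inv_op] grass_stair[OF y r]
    by (simp add: ivl_def)
  also have "\<dots> = coeff_F (n - 1) ?S l"
    using rm r by (intro coeff_F_iter[symmetric] S'(1,3)) (auto simp: of_nat_diff)
  also have "\<dots> = coeff_P ?S l" by (rule IH[OF S'(1,2)])
  also have "\<dots> = gP l ?S" by (rule coeff_P_iter[OF S'(1,4)])
  also have "\<dots> = elems_coeff part_op [0..<Suc m] rS (gP l) S"
  proof -
    have "{1..rS} - {0} = {1..rS}" by auto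
    also have "\<dots> = S" by (rule Sr[symmetric])
    finally have *: "{1..rS} - {0} = S" .
    show ?thesis using part_op_stair[of 0 rS "Suc m" "gP l", unfolded *] rm r by (simp del: upt_Suc)
  qed
  also have "\<dots> = gP (rS # l) S"
    unfolding iter_coeff_Cons using norem
    by (subst (2) K_word_split) (rule elems_coeff_skip_left[symmetric], auto simp: part_op_def)
  finally show ?thesis .
qed

lemma gF_perm: "mset l = mset l' \<Longrightarrow> gF l = gF l'"
  by (rule iter_coeff_perm) (auto intro: lin_inv_op ivl_commute)

lemma gP_perm: "mset l = mset l' \<Longrightarrow> gP l = gP l'"
  by (rule iter_coeff_perm) (auto intro: lin_part_op part.K_commute)

lemma coeff_eq: "coeff_F n S l = coeff_P S l"
proof -
  define C where "C = (\<lambda>M. gF (sorted_list_of_multiset M) yS - gP (sorted_list_of_multiset M) S)"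
  have C: "C (mset l) = gF l yS - gP l S" for l
    using gF_perm[of "sorted_list_of_multiset (mset l)" l] gP_perm[of "sorted_list_of_multiset (mset l)" l]
    by (simp add: C_def)
  have Cs: "C M = gF l yS - gP l S" if "mset l = M" for l M using C[of l] that by simp
  have y: "grass n S yS" by (rule grass_grass_perm[OF S(1)])
  have "C (mset l) = 0"
  proof (rule cancel_vanish[where C = C and d = "\<Sum>S" and r = rS])
    fix a :: nat and M :: "nat multiset" assume a: "0 < a"
    define L where "L = sorted_list_of_multiset M"
    let ?E = "elems_coeff inv_op letters"
    \<comment> \<open>Cancellation is available only at \<open>delta 1\<close>, so the pair goes to
      the innermost end of the list.\<close>
    have F: "(\<Sum>j\<le>2 * a. (- 1) ^ j * gF (L @ [j, 2 * a - j]) yS) = 0"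
    proof -
      have fl: "lin (foldr ?E L)"
        by (rule foldr_lin) (rule elems_coeff_lin[of inv_op, OF lin_inv_op])
      have "(\<Sum>j\<le>2 * a. (- 1) ^ j * gF (L @ [j, 2 * a - j]) yS) =
        foldr ?E L (\<lambda>yS. \<Sum>j\<le>2 * a. (- 1) ^ j * ?E j (?E (2 * a - j) (delta 1)) yS) yS"
        by (subst lin_sum[OF fl]) (simp_all add: iter_coeff_def)
      also have "(\<lambda>yS. \<Sum>j\<le>2 * a. (- 1) ^ j * ?E j (?E (2 * a - j) (delta 1)) yS) = (\<lambda>yS. 0)"
        using a by (intro ext elems_coeff_cancel lin_inv_op ivl_cancel) auto
      finally show ?thesis by (simp only: lin_zero[OF fl])
    qed
    \<comment> \<open>Here cancellation holds on every function and the pair may stand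
      outermost.\<close>
    have P: "(\<Sum>j\<le>2 * a. (- 1) ^ j * gP (j # (2 * a - j) # L) S) = 0"
      using a elems_coeff_cancel[of part_op "K_word m" "gP L" "2 * a" S, OF lin_part_op part.K_inverse]
      by simp
    have "C (add_mset j (add_mset (2 * a - j) M)) = gF (L @ [j, 2 * a - j]) yS - gP (j # (2 * a - j) # L) S" for j
    proof -
      have "mset (L @ [j, 2 * a - j]) = mset (j # (2 * a - j) # L)" by simp
      then have "gF (L @ [j, 2 * a - j]) = gF (j # (2 * a - j) # L)" by (rule gF_perm)
      then show ?thesis using Cs[of "j # (2 * a - j) # L"] by (simp add: L_def)
    qed
    then show "(\<Sum>j\<le>2 * a. (- 1) ^ j * C (add_mset j (add_mset (2 * a - j) M))) = 0"
      using F P by (simp only: right_diff_distrib sum_subtractf)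
  next
    fix M
    show "C (add_mset 0 M) = C M"
      using Cs[of "0 # sorted_list_of_multiset M" "add_mset 0 M"] by (simp add: C_def)
  next
    fix M :: "nat multiset"
    define L where "L = sorted_list_of_multiset M"
    have L: "mset L = M" "sum_list L = \<Sum>\<^sub># M" by (simp_all add: L_def flip: sum_mset_sum_list)
    assume "\<Sum>\<^sub># M \<noteq> \<Sum>S"
    then have "gF L yS = 0" "gP L S = 0"
      using iter_coeff_inv_op_graded[OF grass_involution[OF y], of letters L] rank_grass[OF y]
        iter_coeff_part_op_graded[OF S(1), of "K_word m" L] L by auto
    then show "C M = 0" using Cs[OF L(1)] by simp
  next
    fix k :: nat and M assume "rS < k"
    then show "C (add_mset k M) = 0"
      using Cs[of "k # sorted_list_of_multiset M" "add_mset k M"] coeff_large[of k] by simp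
  next
    show "\<Sum>{1..rS} \<le> \<Sum>S" by (rule sum_strict_partition(1)[OF S(1)])
  next
    show "C (mset_set {1..rS}) = 0"
    proof (cases "S = {1..rS}")
      case False
      \<comment> \<open>Off the staircase the monomial has the wrong degree, so both coefficients
        are 0.\<close>
      define L where "L = sorted_list_of_multiset (mset_set {1..rS})"
      have L: "mset L = mset_set {1..rS}" unfolding L_def by (rule mset_sorted_list_of_multiset)
      have "sum_list L = \<Sum>{1..rS}" by (simp add: L sum_unfold_sum_mset flip: sum_mset_sum_list)
      then have "sum_list L \<noteq> \<Sum>S" using False sum_strict_partition(2)[OF S(1)] by auto
      then have "gF L yS = 0" "gP L S = 0"
        using iter_coeff_inv_op_graded[OF grass_involution[OF y], of letters L] rank_grass[OF y]
          iter_coeff_part_op_graded[OF S(1), of "K_word m" L] by auto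
      then show ?thesis using Cs[OF L] by simp
    next
      case True
      show ?thesis
      proof (cases "rS = 0")
        case r0: True
        then have "S = {}" using True by simp
        then have "yS = 1" using grass_perm_eq[OF grass_empty] by simp
        then show ?thesis using Cs[of "[]" "{#}"] r0 \<open>S = {}\<close> by (simp add: delta_def)
      next
        case r0: False
        \<comment> \<open>Symmetry puts the exponent \<open>rS\<close> first, which is the case
          settled by \<open>coeff_stair\<close>.\<close>
        define L where "L = sorted_list_of_multiset (mset_set {1..rS - 1})"
        have "{1..rS} = insert rS {1..rS - 1}" using r0 by auto
        then have "mset_set {1..rS} = add_mset rS (mset_set {1..rS - 1})" using r0 by simp
        moreover have "mset L = mset_set {1..rS - 1}" unfolding L_def by (rule mset_sorted_list_of_multiset)
        ultimately have "mset (rS # L) = mset_set {1..rS}" by simp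
        then show ?thesis using Cs[of "rS # L"] coeff_stair[OF True, of L] r0 by simp
      qed
    qed
  qed
  then show ?thesis using C[of l] F_iter[OF S] coeff_P_iter[OF S] by simp
qed

end

lemma coeff_F_eq_coeff_P: "strict_partition S \<Longrightarrow> coeff_F n S l = coeff_P S l"
proof (induction "\<Sum>S" arbitrary: n S l rule: less_induct)
  case less
  have "finite S" "0 \<notin> S" using less.prems by (auto simp: strict_partition_def)
  then have "S \<subseteq> {1..Suc (Max S)}" by (auto simp: Suc_le_eq le_SucI intro: gr0I)
  then show ?case using less.hyps by (intro coeff_eq[OF less.prems]) auto
qed

theorem theorem4p20:
  fixes y :: "int perm"
  assumes "y \<in> involutions" and "I_Grassmannian y"
  shows "inv_stanley y = schur_P (shape y)"
proof
  fix w
  obtain n where sorted: "sorted_wrt (>) (shape y)" and y: "grass n (set (shape y)) y"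
    using I_Grassmannian_grass[OF assms] by blast
  let ?S = "set (shape y)"
  have S: "strict_partition ?S" by (rule grass_strict[OF y])
  show "inv_stanley y w = schur_P (shape y) w"
  proof (cases "0 \<in># w")
    case True
    then show ?thesis by (simp add: inv_stanley_zero schur_P_zero)
  next
    case False
    then obtain l where w: "mset (mono_seq l) = w" using ex_mono_seq by blast
    have sub: "?S \<subseteq> {1..Suc (Max ?S)}"
      using S by (auto simp: strict_partition_def Suc_le_eq le_SucI intro: gr0I)
    have "inv_stanley y w = coeff_F n ?S l" by (simp add: coeff_F_def grass_perm_eq[OF y] w)
    also have "\<dots> = coeff_P ?S l" by (rule coeff_F_eq_coeff_P[OF S])
    also have "\<dots> = schur_P (shape y) w"
      using schur_P_iter_coeff[OF sorted sub, of l] coeff_P_iter[OF S sub, of l] w by simp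
    finally show ?thesis .
  qed
qed

end
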